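(* Let $e^e<y\leqslant x$ be real numbers and let $F$ be an arithmetic function for which there exist $s\in\mathbb{Z}_{\geqslant 0}$, $m\in\mathbb{Z}_{\geqslant 1}$ and real numbers $\kappa\in[0,1)$, $\beta\geqslant 0$, $\delta\geqslant 0$ and $A>0$ such that $$\text{(i)}\quad \sum_{n\leqslant z}(F\star\mu)(n)=z\sum_{j=0}^{s}a_j(\log z)^j+O\left(z^{\kappa}(\log ez)^{\beta}\right)\qquad(z\geqslant 1,\ a_j\in\mathbb{C},\ a_s\neq 0)$$ and $$\text{(ii)}\quad \left|(F\star\mu)(n)\right|\leqslant A\,\tau_m(n)\,(\log en)^{\delta}\qquad(n\in\mathbb{Z}_{\geqslant 1}).$$ Then, for any $\varepsilon\in\left(0,\frac12\right]$ and $x^{1/2}e^{-\frac12(\log x)^{1/4}}\leqslant y\leqslant x e^{-(\log x)^{1/4}}$, $$\sum_{x<n\leqslant x+y}F(n)=\frac{y\,a_s}{s+1}(\log x)^{s+1}+O\left(x y^{\kappa-1}e^{(\kappa-1)(\log x)^{1/4}}(\log x)^{\beta}+y(\log x)^{\max\left(s,\;\delta+m-\frac12+\epsilon_{m+1}(x)\right)}+x^{\varepsilon}\right).$$ The implied constant depends only on $A,\varepsilon,m,s,a_0,\dots,a_s$ and on the implied constant arising in (i). Here, for any integer $r\geqslant 2$, the function $\epsilon_r(x)=o(1)$ as $x\to\infty$ is the explicit function given in the context.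
   Context: $\mu$ is the Möbius function, $\tau_m$ is the $m$th Dirichlet-Piltz divisor function (the number of ordered factorizations $n=d_1\cdots d_m$ into positive integers), and $(f\star g)(n)=\sum_{d\mid n}f(d)g(n/d)$ is the Dirichlet convolution product of arithmetic functions $f$ and $g$. For an integer $r\geqslant 2$ and real $x>e^e$, $$\epsilon_r(x)=\sqrt{\frac{r\log\log\log x}{\log\log x}}\left(r-1+\frac{30}{\log\log\log x}\right).$$
   Formalization: The implied constant may also depend on κ and β (it stays uniform in δ, F, x, y); uniformity in β or in κ is false, e.g. x=e^16, y=e^14, κ=0, δ=β, F⋆μ=1 plus an extra (log eN)^β at N=⌊x+y⌋, as β→∞. *)

theory Defs
  imports
    "HOL-Analysis.Analysis"
    "HOL-Computational_Algebra.Squarefree"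
    "HOL-Real_Asymp.Real_Asymp"
begin

text \<open>
  Arithmetic functions are functions on \<^typ>\<open>nat\<close>; their value at \<open>0\<close> is irrelevant.
\<close>

definition moebius_mu :: "nat \<Rightarrow> complex" where
  "moebius_mu n = (if squarefree n then (-1) ^ card (prime_factors n) else 0)"

definition dirichlet_prod :: "(nat \<Rightarrow> complex) \<Rightarrow> (nat \<Rightarrow> complex) \<Rightarrow> nat \<Rightarrow> complex"
    (infixl "\<star>" 70) where
  "(f \<star> g) n = (\<Sum>d | d dvd n. f d * g (n div d))"

definition piltz_tau :: "nat \<Rightarrow> nat \<Rightarrow> nat" where
  "piltz_tau m n = card {ds :: nat list. length ds = m \<and> prod_list ds = n}"

definition eps :: "nat \<Rightarrow> real \<Rightarrow> real" where
  "eps r x = sqrt (real r * ln (ln (ln x)) / ln (ln x)) * (real r - 1 + 30 / ln (ln (ln x)))"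

lemma eps_tendsto_0: "(eps r \<longlongrightarrow> 0) at_top"
proof (cases "r = 0")
  case False
  then have "real r > 0" by simp
  then show ?thesis unfolding eps_def by real_asymp
qed (simp add: eps_def [abs_def])

text \<open>
  On the order of quantifiers in the main statement. The exponents \<open>\<kappa>\<close> and \<open>\<beta>\<close> of the error
  term \<open>O(z powr \<kappa> * ln (e * z) powr \<beta>)\<close> are fixed together with the implied constant \<open>B\<close> of
  that error term, before the resulting constant \<open>K\<close>; everything else that \<open>K\<close> is not said to
  depend on (\<open>\<delta>\<close>, \<open>F\<close>, \<open>x\<close>, \<open>y\<close>) is quantified after it. A constant uniform in \<open>\<beta>\<close> does not exist:
  take \<open>x = exp 16\<close>, \<open>y = exp 14\<close>, \<open>\<kappa> = 0\<close>, \<open>\<delta> = \<beta>\<close>, \<open>N = \<lfloor>x + y\<rfloor>\<close>, and \<open>F \<star> \<mu> = 1\<close> except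
  for the value \<open>1 + ln (e * N) powr \<beta>\<close> at \<open>N\<close>. The hypotheses hold with \<open>A = B = 2\<close>, \<open>m = 1\<close>,
  \<open>s = 0\<close>, \<open>a 0 = 1\<close>, but the left-hand side grows like \<open>17 powr \<beta>\<close> and the bound like
  \<open>16 powr \<beta>\<close>.

  Of the coefficient sequence \<open>a\<close> only \<open>a 0, \<dots>, a s\<close> occur, so \<open>K\<close> may be taken
  to depend on these alone: replace \<open>a j\<close> by \<open>0\<close> for \<open>j > s\<close>.
\<close>

end

theory Submission
  imports Defs "HOL-Number_Theory.Totient"
begin

text \<open>
Put \<open>f = F \<star> \<mu>\<close>, so that \<open>F n\<close> is the sum of \<open>f d\<close> over the divisors \<open>d\<close> of \<open>n\<close>, and let
\<open>L = (ln x) powr (1/4)\<close>. The sum of \<open>F\<close> over \<open>(x, x + y]\<close> runs over the pairs \<open>(d, k)\<close> with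
\<open>x < d * k \<le> x + y\<close>. These are split at \<open>d = T\<close>, where \<open>T = x / K\<close> for an integer \<open>K\<close> chosen such that
\<open>y \<le> T \<le> y * exp L\<close>. Because \<open>K * y \<le> x\<close>, the pairs with \<open>d > T\<close> are exactly those with \<open>k \<le> K\<close>
(\<open>short_sum_hyperbola_split\<close>).

For \<open>k \<le> K\<close>, hypothesis (i) at both ends of \<open>(x / k, (x + y) / k]\<close> gives the part of the main term
that belongs to \<open>(ln x) ^ (s + 1) - (ln T) ^ (s + 1)\<close>. Its error terms \<open>(x / k) powr \<kappa> * (ln x) powr \<beta>\<close>
add up to \<open>x * T powr (\<kappa> - 1) * (ln x) powr \<beta>\<close> (\<open>hyperbola_large_divisors\<close>). For \<open>d \<le> T\<close> the number of
multiples of \<open>d\<close> in the interval is compared with \<open>y / d\<close>; by (i) and summation by parts, the sum of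
\<open>f d / d\<close> supplies the missing \<open>(ln T) ^ (s + 1)\<close> (\<open>logarithmic_mean\<close>). In this comparison the
divisors \<open>d \<le> y\<close> are harmless, each contributing an error \<open>O(\<bar>f d\<bar>)\<close>. What remains is the crux: by (ii),
one has to bound the sum over \<open>x < n \<le> x + y\<close> of the sums of \<open>\<tau>\<^sub>m(d)\<close> over those divisors \<open>d\<close> of \<open>n\<close> that lie
in the window \<open>(y, T]\<close>, which has logarithmic length at most \<open>L\<close>. Without the window this would be of
order \<open>y * (ln x) ^ m\<close>; the window has to save a factor \<open>(ln x) powr (1/2)\<close> (\<open>short_sum_tau_window\<close>). Here \<open>y\<close> may be slightly smaller than
\<open>x powr (1/2)\<close>, so that summing over one variable with the others fixed is too expensive.

The saving combines the methods of Shiu and of Hooley. Write \<open>n = a * b\<close>, where \<open>a \<le> x powr (1/50)\<close> is made of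
the smallest primes of \<open>n\<close> and \<open>b\<close> of the others (\<open>smooth_rough_decomposition\<close>). Typically \<open>b\<close> has boundedly
many prime factors, and its divisors only shift the window, so it suffices to bound
the largest sum of \<open>\<tau>\<^sub>m(d)\<close> over divisors \<open>d\<close> of \<open>a\<close> in any window \<open>(u, u * exp L]\<close>. A Fejer kernel bounds this
maximum by the average over \<open>0 \<le> \<theta> < 1 / L\<close> of \<open>\<bar>\<Sum>d dvd a. \<tau>\<^sub>m(d) * d powr (\<i> * \<theta>)\<bar>\<close>, which is multiplicative
in \<open>a\<close> (\<open>tau_window_le_twisted_tau\<close>). The \<open>b\<close> in an interval are counted by Selberg's sieve, which
yields a factor \<open>1 / ln x\<close> (\<open>selberg_sieve\<close>). The remaining sum over \<open>a\<close> is at most an Euler product,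
of size \<open>exp (\<Sum>p\<le>x. \<bar>1 + m * p powr (\<i> * \<theta>)\<bar> / p)\<close>. For \<open>p > exp (1 / \<theta>)\<close> the angle \<open>\<theta> * ln p\<close> is
equidistributed in the sense that its cosine has bounded sums against \<open>1 / p\<close>, and
\<open>\<bar>1 + m * cis \<phi>\<bar> \<le> m + 1/3 + (7 * cos \<phi> - cos (2 * \<phi>)) / 9\<close> turns this into the bound
\<open>(ln x) powr (m + 1/3) * \<theta> powr (- 2/3)\<close> for the Euler product (\<open>sum_primes_norm_twist_bounds\<close>). Its average over
\<open>\<theta> < 1 / L\<close> is of order \<open>(ln x) powr (m + 1/3) * L powr (2/3) = (ln x) powr (m + 1/2)\<close>, and the factor
\<open>1 / ln x\<close> from the sieve leaves \<open>y * (ln x) powr (m - 1/2)\<close>. As \<open>eps (m + 1) x \<ge> 0\<close> for \<open>x > exp (exp 1)\<close>,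
this has the required size.

The implied constant is uniform in \<open>\<delta>\<close> for two reasons. If \<open>x\<close> is large, then (ii) is used for \<open>d \<le> T \<le> x / exp 1\<close>
only, where \<open>ln (exp 1 * d) \<le> ln x\<close>. If \<open>x\<close> is bounded, then (i) by itself bounds \<open>f\<close>
(\<open>bounded_range_bound\<close>).
\<close>

section \<open>Piltz divisor functions\<close>

lemma finite_factorizations:
  assumes "n > 0"
  shows "finite {ds :: nat list. length ds = m \<and> prod_list ds = n}"
proof -
  have "x dvd prod_list ds" if "x \<in> set ds" for x :: nat and ds
    using that by (induction ds) auto
  then have "{ds :: nat list. length ds = m \<and> prod_list ds = n} \<subseteq> {ds. set ds \<subseteq> {..n} \<and> length ds = m}"
    using assms dvd_imp_le by fastforce
  then show ?thesis
    by (rule finite_subset) (simp add: finite_lists_length_eq)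
qed

lemma piltz_tau_0: "piltz_tau 0 n = (if n = 1 then 1 else 0)"
proof -
  have "{ds :: nat list. length ds = 0 \<and> prod_list ds = n} = (if n = 1 then {[]} else {})"
    by auto
  then show ?thesis unfolding piltz_tau_def by simp
qed

lemma piltz_tau_Suc:
  assumes n: "n > 0"
  shows "piltz_tau (Suc m) n = (\<Sum>d | d dvd n. piltz_tau m d)"
proof -
  have fin: "finite {d. d dvd n}" using n by simp
  have "bij_betw (\<lambda>(d, ds). (n div d) # ds)
      (SIGMA d:{d. d dvd n}. {ds. length ds = m \<and> prod_list ds = d})
      {ds. length ds = Suc m \<and> prod_list ds = n}"
    unfolding bij_betw_def
  proof
    show "inj_on (\<lambda>(d, ds). (n div d) # ds)
      (SIGMA d:{d. d dvd n}. {ds. length ds = m \<and> prod_list ds = d})"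
      by (auto simp: inj_on_def)
    show "(\<lambda>(d, ds). (n div d) # ds) ` (SIGMA d:{d. d dvd n}. {ds. length ds = m \<and> prod_list ds = d})
       = {ds. length ds = Suc m \<and> prod_list ds = n}" (is "?l = ?r")
    proof
      show "?l \<subseteq> ?r" by auto
      show "?r \<subseteq> ?l"
      proof
        fix ds assume "ds \<in> ?r"
        then obtain c cs where c: "ds = c # cs" "length cs = m" "c * prod_list cs = n"
          by (cases ds) auto
        with n have "n div prod_list cs = c" "prod_list cs dvd n"
          by (auto intro!: nonzero_mult_div_cancel_right)
        with c show "ds \<in> ?l"
          by (intro image_eqI[of _ _ "(prod_list cs, cs)"]) auto
      qed
    qed
  qed
  then have "piltz_tau (Suc m) n = card (SIGMA d:{d. d dvd n}. {ds. length ds = m \<and> prod_list ds = d})"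
    unfolding piltz_tau_def by (simp add: bij_betw_same_card)
  also have "\<dots> = (\<Sum>d | d dvd n. piltz_tau m d)"
    unfolding piltz_tau_def using n
    by (subst card_SigmaI[OF fin]) (auto intro!: finite_factorizations)
  finally show ?thesis .
qed

text \<open>
Every divisor of \<open>a * b\<close> is a product of a divisor of \<open>a\<close> and a divisor of \<open>b\<close>, possibly in several ways;
for nonnegative summands the repetitions only help. The condition \<open>P\<close> makes this usable for divisors in
a window.
\<close>
lemma sum_divisors_mult_le:
  fixes u :: "nat \<Rightarrow> real"
  assumes ab: "a > 0" "b > 0" and u: "\<And>d. 0 \<le> u d"
  shows "(\<Sum>d | d dvd a * b \<and> P d. u d) \<le> (\<Sum>e | e dvd b. \<Sum>d | d dvd a \<and> P (d * e). u (d * e))"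
proof -
  let ?S = "SIGMA e:{e. e dvd b}. {d. d dvd a \<and> P (d * e)}"
  have fin: "finite ?S" using ab by (intro finite_SigmaI) auto
  have "{d. d dvd a * b \<and> P d} \<subseteq> (\<lambda>(e, d). d * e) ` ?S"
  proof
    fix d assume "d \<in> {d. d dvd a * b \<and> P d}"
    then obtain d' e where "d = d' * e" "d' dvd a" "e dvd b" "P d"
      using division_decomp[of d a b] by auto
    then show "d \<in> (\<lambda>(e, d). d * e) ` ?S"
      by (intro image_eqI[of _ _ "(e, d')"]) auto
  qed
  then have "(\<Sum>d | d dvd a * b \<and> P d. u d) \<le> sum u ((\<lambda>(e, d). d * e) ` ?S)"
    using fin u by (intro sum_mono2) auto
  also have "\<dots> \<le> sum (u \<circ> (\<lambda>(e, d). d * e)) ?S"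
    using fin u by (intro sum_image_le) auto
  also have "\<dots> = (\<Sum>e | e dvd b. \<Sum>d | d dvd a \<and> P (d * e). u (d * e))"
    using ab by (subst sum.Sigma) (auto simp: o_def split_def)
  finally show ?thesis .
qed

lemma piltz_tau_submult:
  assumes "a > 0" "b > 0"
  shows "piltz_tau m (a * b) \<le> piltz_tau m a * piltz_tau m b"
  using assms
proof (induction m arbitrary: a b)
  case 0
  then show ?case by (auto simp: piltz_tau_0)
next
  case (Suc m)
  have "real (piltz_tau (Suc m) (a * b)) = (\<Sum>d | d dvd a * b \<and> True. real (piltz_tau m d))"
    using Suc.prems by (simp add: piltz_tau_Suc)
  also have "\<dots> \<le> (\<Sum>e | e dvd b. \<Sum>d | d dvd a \<and> True. real (piltz_tau m (d * e)))"
    using Suc.prems by (intro sum_divisors_mult_le) auto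
  also have "\<dots> \<le> (\<Sum>e | e dvd b. \<Sum>d | d dvd a. real (piltz_tau m d) * real (piltz_tau m e))"
    unfolding simp_thms
  proof (rule sum_mono, rule sum_mono)
    fix e d assume "e \<in> {e. e dvd b}" "d \<in> {d. d dvd a}"
    then have "piltz_tau m (d * e) \<le> piltz_tau m d * piltz_tau m e"
      using Suc.prems by (intro Suc.IH) (auto intro: dvd_pos_nat)
    then show "real (piltz_tau m (d * e)) \<le> real (piltz_tau m d) * real (piltz_tau m e)"
      by (simp only: of_nat_mult[symmetric] of_nat_le_iff)
  qed
  also have "\<dots> = real (piltz_tau (Suc m) a) * real (piltz_tau (Suc m) b)"
    using Suc.prems by (simp add: piltz_tau_Suc sum_product sum.swap[of _ "{d. d dvd a}"])
  finally show ?case by (simp only: of_nat_mult[symmetric] of_nat_le_iff)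
qed

lemma sum_divisors_coprime:
  fixes u :: "nat \<Rightarrow> 'a :: comm_monoid_add"
  assumes ab: "a > 0" "b > 0" "coprime a b"
  shows "(\<Sum>d | d dvd a * b. u d) = (\<Sum>d | d dvd a. \<Sum>e | e dvd b. u (d * e))"
proof -
  have "bij_betw (\<lambda>(d, e). d * e) ({d. d dvd a} \<times> {e. e dvd b}) {d. d dvd a * b}"
    unfolding bij_betw_def
  proof
    show "inj_on (\<lambda>(d, e). d * e) ({d. d dvd a} \<times> {e. e dvd b})"
    proof (rule inj_onI, clarsimp)
      fix d e d' e' assume h: "d dvd a" "e dvd b" "d' dvd a" "e' dvd b" "d * e = d' * e'"
      have "coprime d e'" "coprime d' e"
        using h ab by (meson coprime_divisors)+
      then show "d = d' \<and> e = e'"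
        using h(5) coprime_crossproduct_nat[of d e' d' e] by (simp add: mult.commute)
    qed
    show "(\<lambda>(d, e). d * e) ` ({d. d dvd a} \<times> {e. e dvd b}) = {d. d dvd a * b}"
    proof (intro equalityI subsetI)
      fix d assume "d \<in> {d. d dvd a * b}"
      then obtain d' e where "d = d' * e" "d' dvd a" "e dvd b"
        using division_decomp[of d a b] by auto
      then show "d \<in> (\<lambda>(d, e). d * e) ` ({d. d dvd a} \<times> {e. e dvd b})"
        by (intro image_eqI[of _ _ "(d', e)"]) auto
    qed (auto simp: mult_dvd_mono)
  qed
  from sum.reindex_bij_betw[OF this, of u] show ?thesis
    by (simp add: sum.cartesian_product split_def)
qed

lemma piltz_tau_mult_coprime:
  assumes "a > 0" "b > 0" "coprime a b"
  shows "piltz_tau m (a * b) = piltz_tau m a * piltz_tau m b"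
  using assms
proof (induction m arbitrary: a b)
  case 0
  then show ?case by (auto simp: piltz_tau_0)
next
  case (Suc m)
  have "piltz_tau (Suc m) (a * b) = (\<Sum>d | d dvd a. \<Sum>e | e dvd b. piltz_tau m (d * e))"
    using Suc.prems by (simp add: piltz_tau_Suc sum_divisors_coprime)
  also have "\<dots> = (\<Sum>d | d dvd a. \<Sum>e | e dvd b. piltz_tau m d * piltz_tau m e)"
    using Suc.prems by (intro sum.cong refl Suc.IH) (auto intro: dvd_pos_nat coprime_divisors)
  also have "\<dots> = piltz_tau (Suc m) a * piltz_tau (Suc m) b"
    using Suc.prems by (simp add: piltz_tau_Suc sum_product)
  finally show ?case .
qed

lemma piltz_tau_1: "piltz_tau m (Suc 0) = 1"
  by (induction m) (auto simp: piltz_tau_0 piltz_tau_Suc)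

lemma divisors_prime_power:
  assumes "prime (p :: nat)"
  shows "{d. d dvd p ^ k} = (\<lambda>i. p ^ i) ` {..k}"
  using assms divides_primepow_nat[of p _ k] by (auto simp: image_def)

lemma sum_divisors_prime_power:
  fixes u :: "nat \<Rightarrow> 'a :: comm_monoid_add"
  assumes "prime (p :: nat)"
  shows "(\<Sum>d | d dvd p ^ k. u d) = (\<Sum>i\<le>k. u (p ^ i))"
proof -
  have "inj_on (\<lambda>i. p ^ i) {..k}"
    using prime_gt_1_nat[OF assms] by (auto simp: inj_on_def)
  then show ?thesis
    unfolding divisors_prime_power[OF assms] by (simp add: sum.reindex)
qed

lemma piltz_tau_prime:
  assumes "prime p"
  shows "piltz_tau m p = m"
proof (induction m)
  case (Suc m)
  then show ?case using assms sum_divisors_prime_power[OF assms, of "piltz_tau m" 1] prime_gt_0_nat[OF assms]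
    by (simp add: piltz_tau_Suc piltz_tau_1)
qed (use assms in \<open>auto simp: piltz_tau_0\<close>)

lemma piltz_tau_prime_power_le:
  assumes "prime p"
  shows "piltz_tau m (p ^ k) \<le> (k + 1) ^ m"
proof (induction m arbitrary: k)
  case 0
  then show ?case by (auto simp: piltz_tau_0)
next
  case (Suc m)
  have "piltz_tau (Suc m) (p ^ k) = (\<Sum>i\<le>k. piltz_tau m (p ^ i))"
    using prime_gt_0_nat[OF assms] by (simp add: piltz_tau_Suc sum_divisors_prime_power[OF assms])
  also have "\<dots> \<le> (\<Sum>i\<le>k. (k + 1) ^ m)"
    by (intro sum_mono order.trans[OF Suc.IH] power_mono) auto
  finally show ?case by simp
qed

text \<open>
A submultiplicative function with the value \<open>m\<close> at each prime is at most \<open>m ^ k\<close> at a product of \<open>k\<close>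
primes, and \<open>z ^ k \<le> n\<close> if these are at least \<open>z\<close>. Thus \<open>\<tau>\<^sub>m\<close> is bounded on numbers whose prime factors
all exceed a fixed power of the number.
\<close>
lemma piltz_tau_le_rough:
  fixes z :: real
  assumes "n > 0" "z > 1" "m > 0" and rough: "\<And>p. prime p \<Longrightarrow> p dvd n \<Longrightarrow> z \<le> real p"
  shows "real (piltz_tau m n) \<le> real n powr (ln (real m) / ln z)"
  using assms(1) rough
proof (induction n rule: prime_divisors_induct)
  case zero
  then show ?case by simp
next
  case (unit x)
  then show ?case by (simp add: piltz_tau_1)
next
  case (factor p n)
  then have n: "n > 0" and p: "p > 0" "z \<le> real p"
    using prime_gt_0_nat by auto
  have "real (piltz_tau m (p * n)) \<le> real (piltz_tau m p) * real (piltz_tau m n)"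
    using piltz_tau_submult[OF p(1) n] by (simp only: of_nat_mult[symmetric] of_nat_le_iff)
  also have "\<dots> = real m * real (piltz_tau m n)"
    using factor by (simp add: piltz_tau_prime)
  also have "\<dots> \<le> real p powr (ln (real m) / ln z) * real n powr (ln (real m) / ln z)"
  proof (intro mult_mono)
    have "real m = z powr (ln (real m) / ln z)"
      using assms by (simp add: powr_def)
    also have "\<dots> \<le> real p powr (ln (real m) / ln z)"
      using assms p by (intro powr_mono2) auto
    finally show "real m \<le> \<dots>" .
    show "real (piltz_tau m n) \<le> real n powr (ln (real m) / ln z)"
      using factor n by (intro factor.IH) auto
  qed auto
  also have "\<dots> = real (p * n) powr (ln (real m) / ln z)"
    by (simp add: powr_mult)
  finally show ?case .
qed

section \<open>Partial sums and Euler products\<close>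

text \<open>
Expanding the product yields each \<open>w a\<close> with all primes of \<open>a\<close> in \<open>P\<close>, since the exponents of
an \<open>a \<le> N\<close> are less than \<open>N\<close>.
\<close>
lemma euler_product_le:
  fixes w :: "nat \<Rightarrow> real"
  assumes "finite P" and prime: "\<And>p. p \<in> P \<Longrightarrow> prime p"
    and w0: "\<And>n. 0 \<le> w n" and w1: "w 1 \<le> 1"
    and mult: "\<And>a b. a > 0 \<Longrightarrow> b > 0 \<Longrightarrow> coprime a b \<Longrightarrow> w (a * b) \<le> w a * w b"
  shows "(\<Sum>a | 0 < a \<and> a \<le> N \<and> prime_factors a \<subseteq> P. w a) \<le> (\<Prod>p\<in>P. \<Sum>k\<le>N. w (p ^ k))"
  using assms(1) prime
proof (induction P rule: finite_induct)
  case empty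
  have "{a. 0 < a \<and> a \<le> N \<and> prime_factors a \<subseteq> {}} \<subseteq> {1::nat}"
  proof
    fix a assume "a \<in> {a. 0 < a \<and> a \<le> N \<and> prime_factors a \<subseteq> {}}"
    then have "a > 0" "prime_factorization a = {#}" by auto
    then have "a = 1" using prime_factorization_empty_iff[of a] by auto
    then show "a \<in> {1}" by simp
  qed
  then have "(\<Sum>a | 0 < a \<and> a \<le> N \<and> prime_factors a \<subseteq> {}. w a) \<le> (\<Sum>a\<in>{1}. w a)"
    using w0 by (intro sum_mono2) auto
  then show ?case using w1 by simp
next
  case (insert p P)
  let ?A = "\<lambda>P. {a :: nat. 0 < a \<and> a \<le> N \<and> prime_factors a \<subseteq> P}"
  have p: "prime p" using insert by auto
  have finA: "finite (?A Q)" for Q by (rule finite_subset[of _ "{..N}"]) auto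
  have sub: "?A (insert p P) \<subseteq> (\<lambda>(k, r). p ^ k * r) ` ({..N} \<times> {r \<in> ?A P. coprime p r})"
  proof
    fix a assume a: "a \<in> ?A (insert p P)"
    define k where "k = multiplicity p a"
    have "a \<noteq> 0" "\<not> is_unit p" using a p by auto
    then obtain r where r: "a = p ^ k * r" "\<not> p dvd r"
      unfolding k_def by (rule multiplicity_decompose')
    have r0: "r > 0" using a r by (cases r) auto
    have "k < p ^ k" using prime_gt_1_nat[OF p] by (simp add: power_gt_expt)
    also have "p ^ k \<le> a" using r r0 by simp
    finally have "k \<le> N" using a by simp
    moreover have "r \<le> N"
      using r a prime_gt_0_nat[OF p] by (metis (no_types, lifting) dvd_imp_le dvd_triv_right le_trans mem_Collect_eq)
    moreover have "prime_factors r \<subseteq> P"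
    proof
      fix q assume q: "q \<in> prime_factors r"
      then have "q \<in> prime_factors a" using r a
        by (metis (no_types, lifting) dvd_prime_factors dvd_triv_right gr_implies_not0 mem_Collect_eq subsetD)
      then have "q \<in> insert p P" using a by auto
      moreover have "q \<noteq> p" using q r(2) by auto
      ultimately show "q \<in> P" by simp
    qed
    moreover have "coprime p r" using r(2) p prime_imp_coprime by blast
    ultimately show "a \<in> (\<lambda>(k, r). p ^ k * r) ` ({..N} \<times> {r \<in> ?A P. coprime p r})"
      using r r0 by (intro image_eqI[of _ _ "(k, r)"]) auto
  qed
  have fin: "finite ({..N} \<times> {r \<in> ?A P. coprime p r})"
    using finA[of P] by simp
  have "(\<Sum>a\<in>?A (insert p P). w a) \<le> sum w ((\<lambda>(k, r). p ^ k * r) ` ({..N} \<times> {r \<in> ?A P. coprime p r}))"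
    using sub fin w0 by (intro sum_mono2) auto
  also have "\<dots> \<le> sum (w \<circ> (\<lambda>(k, r). p ^ k * r)) ({..N} \<times> {r \<in> ?A P. coprime p r})"
    using fin w0 by (intro sum_image_le) auto
  also have "\<dots> = (\<Sum>k\<le>N. \<Sum>r | r \<in> ?A P \<and> coprime p r. w (p ^ k * r))"
    by (simp add: sum.cartesian_product split_def o_def)
  also have "\<dots> \<le> (\<Sum>k\<le>N. \<Sum>r | r \<in> ?A P \<and> coprime p r. w (p ^ k) * w r)"
    using prime_gt_0_nat[OF p] by (intro sum_mono mult) auto
  also have "\<dots> \<le> (\<Sum>k\<le>N. \<Sum>r\<in>?A P. w (p ^ k) * w r)"
    using finA[of P] w0 by (intro sum_mono sum_mono2) auto
  also have "\<dots> = (\<Sum>k\<le>N. w (p ^ k)) * (\<Sum>r\<in>?A P. w r)"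
    by (simp add: sum_product)
  also have "\<dots> \<le> (\<Sum>k\<le>N. w (p ^ k)) * (\<Prod>p\<in>P. \<Sum>k\<le>N. w (p ^ k))"
    using insert w0 by (intro mult_left_mono) (auto intro!: sum_nonneg)
  finally show ?case using insert by simp
qed

section \<open>The Moebius function\<close>

lemma moebius_mu_mult:
  assumes "coprime a b" "a > 0" "b > 0"
  shows "moebius_mu (a * b) = moebius_mu a * moebius_mu b"
proof -
  have "squarefree (a * b) \<longleftrightarrow> squarefree a \<and> squarefree b"
    using assms(1) by (metis squarefree_mult_coprime squarefree_multD)
  moreover have "p \<notin> prime_factors b" if "p \<in> prime_factors a" for p
    using that coprime_common_divisor[OF assms(1), of p] by (auto simp: in_prime_factors_iff)
  then have "prime_factors a \<inter> prime_factors b = {}" by blast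
  then have "card (prime_factors (a * b)) = card (prime_factors a) + card (prime_factors b)"
    using assms by (simp add: prime_factors_product card_Un_disjoint)
  ultimately show ?thesis
    by (simp add: moebius_mu_def power_add)
qed

lemma moebius_mu_1: "moebius_mu (Suc 0) = 1"
  by (simp add: moebius_mu_def)

lemma moebius_mu_prime_power:
  assumes "prime p"
  shows "moebius_mu (p ^ i) = (if i = 0 then 1 else if i = 1 then -1 else 0)"
proof -
  have "squarefree (p ^ i) \<longleftrightarrow> i \<le> 1"
    using assms squarefree_power_iff[of p i] squarefree_prime[of p]
    by (auto simp: not_prime_unit)
  then show ?thesis
    using assms by (auto simp: moebius_mu_def prime_factorization_prime)
qed

text \<open>
For a prime power \<open>p ^ k\<close> dividing \<open>n\<close> exactly, the sum factors, and the factor at \<open>p\<close> is \<open>1 - 1 + 0\<close>.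
\<close>
lemma sum_moebius_mu:
  assumes "n > 0"
  shows "(\<Sum>d | d dvd n. moebius_mu d) = (if n = 1 then 1 else 0)"
proof (cases "n = 1")
  case False
  then obtain p where p: "prime p" "p dvd n" using prime_factor_nat by blast
  have "n \<noteq> 0" "\<not> is_unit p" using p assms by auto
  then obtain r where r: "n = p ^ multiplicity p n * r" "\<not> p dvd r"
    by (rule multiplicity_decompose')
  define k where "k = multiplicity p n"
  have nk: "n = p ^ k * r" using r(1) by (simp only: k_def)
  have k: "k \<ge> 1"
  proof (rule ccontr)
    assume "\<not> k \<ge> 1"
    then have "k = 0" by simp
    with nk have "n = r" by simp
    with r(2) p(2) show False by simp
  qed
  have "r \<noteq> 0" "p \<noteq> 0" using r(2) p(1) by (metis dvd_0_right, metis not_prime_0)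
  then have r0: "r > 0" "p ^ k > 0" by simp_all
  have cop: "coprime (p ^ k) r" using r(2) p prime_imp_coprime by auto
  have "(\<Sum>d | d dvd n. moebius_mu d) = (\<Sum>d | d dvd p ^ k. \<Sum>e | e dvd r. moebius_mu (d * e))"
    unfolding nk using cop by (rule sum_divisors_coprime[OF r0(2,1)])
  also have "\<dots> = (\<Sum>d | d dvd p ^ k. \<Sum>e | e dvd r. moebius_mu d * moebius_mu e)"
    using coprime_divisors[OF _ _ cop] dvd_pos_nat[OF r0(1)] dvd_pos_nat[OF r0(2)]
    by (intro sum.cong refl moebius_mu_mult) auto
  also have "\<dots> = (\<Sum>i\<le>k. moebius_mu (p ^ i)) * (\<Sum>e | e dvd r. moebius_mu e)"
    by (simp add: sum_product sum_divisors_prime_power[OF p(1), symmetric])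
  also have "(\<Sum>i\<le>k. moebius_mu (p ^ i)) = (\<Sum>i\<in>{0,1}. moebius_mu (p ^ i))"
    using k by (intro sum.mono_neutral_right) (auto simp: moebius_mu_prime_power[OF p(1)])
  also have "\<dots> = 0"
    using moebius_mu_prime_power[OF p(1), of 0] moebius_mu_prime_power[OF p(1), of 1] by simp
  finally show ?thesis using False by simp
qed (auto simp: moebius_mu_1)

lemma dirichlet_prod_moebius_inversion:
  assumes "n > 0"
  shows "(\<Sum>d | d dvd n. (F \<star> moebius_mu) d) = F n"
proof -
  have fin: "finite {d. d dvd n}" using assms by simp
  have "(\<Sum>d | d dvd n. (F \<star> moebius_mu) d) = (\<Sum>d | d dvd n. \<Sum>e | e dvd n \<and> e dvd d. F e * moebius_mu (d div e))"
    unfolding dirichlet_prod_def by (intro sum.cong refl) (auto intro: dvd_trans)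
  also have "\<dots> = (\<Sum>d\<in>{d. d dvd n}. \<Sum>e\<in>{e\<in>{e. e dvd n}. e dvd d}. F e * moebius_mu (d div e))"
    by simp
  also have "\<dots> = (\<Sum>e\<in>{e. e dvd n}. \<Sum>d\<in>{d\<in>{d. d dvd n}. e dvd d}. F e * moebius_mu (d div e))"
    by (rule sum.swap_restrict[OF fin fin])
  also have "\<dots> = (\<Sum>e | e dvd n. F e * (\<Sum>c | c dvd n div e. moebius_mu c))"
  proof (intro sum.cong refl)
    fix e assume "e \<in> {e. e dvd n}"
    then obtain k where k: "n = e * k" and e: "e > 0" using assms by (auto simp: dvd_def)
    have eq: "{d\<in>{d. d dvd n}. e dvd d} = (\<lambda>c. e * c) ` {c. c dvd k}"
      using e k by (auto simp: dvd_def image_def mult.assoc)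
    have "(\<Sum>d\<in>{d\<in>{d. d dvd n}. e dvd d}. F e * moebius_mu (d div e)) = (\<Sum>c | c dvd k. F e * moebius_mu c)"
      unfolding eq using e by (subst sum.reindex) (auto simp: inj_on_def)
    then show "(\<Sum>d\<in>{d\<in>{d. d dvd n}. e dvd d}. F e * moebius_mu (d div e)) = F e * (\<Sum>c | c dvd n div e. moebius_mu c)"
      using e k by (simp add: sum_distrib_left)
  qed
  also have "\<dots> = (\<Sum>e | e dvd n. if e = n then F e else 0)"
  proof (intro sum.cong refl)
    fix e assume "e \<in> {e. e dvd n}"
    then obtain k where k: "n = e * k" and e: "e > 0" using assms by (auto simp: dvd_def)
    then show "F e * (\<Sum>c | c dvd n div e. moebius_mu c) = (if e = n then F e else 0)"
      using assms by (subst sum_moebius_mu) auto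
  qed
  also have "\<dots> = F n" using fin by (simp add: sum.delta')
  finally show ?thesis .
qed

section \<open>Selberg's upper bound sieve\<close>

lemma card_multiples_interval:
  fixes X Y :: real and l :: nat
  assumes "X \<ge> 0" "Y \<ge> 0" "l > 0"
  shows "\<bar>real (card {n. X < real n \<and> real n \<le> X + Y \<and> l dvd n}) - Y / l\<bar> \<le> 1"
proof -
  have eq: "{n. X < real n \<and> real n \<le> X + Y \<and> l dvd n} = (\<lambda>k. l * k) ` {nat \<lfloor>X / l\<rfloor><..nat \<lfloor>(X + Y) / l\<rfloor>}"
  proof (intro equalityI subsetI)
    fix n assume n: "n \<in> {n. X < real n \<and> real n \<le> X + Y \<and> l dvd n}"
    then obtain k where k: "n = l * k" by (auto simp: dvd_def)
    with n have "X < real l * real k" "real l * real k \<le> X + Y" by auto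
    then have "X / l < real k" "real k \<le> (X + Y) / l"
      using assms by (auto simp: field_simps)
    then have "\<lfloor>X / l\<rfloor> < int k" "int k \<le> \<lfloor>(X + Y) / l\<rfloor>"
      by linarith+
    moreover have "0 \<le> \<lfloor>X / l\<rfloor>" using assms by simp
    ultimately have "k \<in> {nat \<lfloor>X / l\<rfloor><..nat \<lfloor>(X + Y) / l\<rfloor>}"
      by (simp add: nat_less_iff le_nat_iff)
    with k show "n \<in> (\<lambda>k. l * k) ` {nat \<lfloor>X / l\<rfloor><..nat \<lfloor>(X + Y) / l\<rfloor>}" by auto
  next
    fix n assume "n \<in> (\<lambda>k. l * k) ` {nat \<lfloor>X / l\<rfloor><..nat \<lfloor>(X + Y) / l\<rfloor>}"
    then obtain k where k: "n = l * k" "nat \<lfloor>X / l\<rfloor> < k" "k \<le> nat \<lfloor>(X + Y) / l\<rfloor>" by force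
    have "0 \<le> X / l" "0 \<le> (X + Y) / l" using assms by auto
    with k have "X / l < real k" "real k \<le> (X + Y) / l"
      by linarith+
    then show "n \<in> {n. X < real n \<and> real n \<le> X + Y \<and> l dvd n}"
      using assms k by (auto simp: field_simps)
  qed
  have "card {n. X < real n \<and> real n \<le> X + Y \<and> l dvd n} = nat \<lfloor>(X + Y) / l\<rfloor> - nat \<lfloor>X / l\<rfloor>"
    unfolding eq using assms by (subst card_image) (auto simp: inj_on_def)
  moreover have "0 \<le> X / l" "X / l \<le> (X + Y) / l" "(X + Y) / l = X / l + Y / l"
    using assms by (auto simp: field_simps)
  ultimately show ?thesis
    by (simp add: of_nat_diff nat_mono floor_mono) linarith
qed

lemma sum_inverse_squares_le: "(\<Sum>n\<in>{M<..N}. 1 / (real n)\<^sup>2) \<le> 2"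
proof -
  have 1: "(\<Sum>n\<in>{0<..N}. 1 / (real n)\<^sup>2) \<le> 2 - 1 / real N" if "N > 0" for N
    using that
  proof (induction N rule: nat_induct_non_zero)
    case 1
    have "{0<..1::nat} = {1}" by auto
    then show ?case by simp
  next
    case (Suc n)
    have "{0<..Suc n} = insert (Suc n) {0<..n}" by auto
    moreover have "1 / real n - 1 / real (Suc n) = 1 / (real n * real (Suc n))"
      using Suc by (simp add: field_simps)
    moreover have "1 / real (Suc n) ^ 2 \<le> 1 / (real n * real (Suc n))"
      using Suc unfolding power2_eq_square by (intro divide_left_mono mult_right_mono) auto
    ultimately show ?case using Suc by simp
  qed
  have "(\<Sum>n\<in>{M<..N}. 1 / (real n)\<^sup>2) \<le> (\<Sum>n\<in>{0<..N}. 1 / (real n)\<^sup>2)"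
    by (intro sum_mono2) auto
  also have "\<dots> \<le> 2"
  proof (cases "N = 0")
    case False
    then have "(\<Sum>n\<in>{0<..N}. 1 / (real n)\<^sup>2) \<le> 2 - 1 / real N" by (intro 1) simp
    also have "\<dots> \<le> 2" by simp
    finally show ?thesis .
  qed simp
  finally show ?thesis .
qed

text \<open>
Each \<open>n \<le> z\<close> is a squarefree number times a square, and the sum of the reciprocals of the squares is at most 2.
\<close>
lemma sum_inverse_squarefree_ge:
  fixes z :: real
  assumes "z \<ge> 1"
  shows "ln z / 2 \<le> (\<Sum>r | squarefree r \<and> real r \<le> z. 1 / real r)"
proof -
  define N where "N = nat \<lfloor>z\<rfloor>"
  have N: "N \<ge> 1" "real N \<le> z" "z < real N + 1" unfolding N_def using assms by linarith+
  let ?D = "{r::nat. squarefree r \<and> real r \<le> z}"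
  have D: "?D \<subseteq> {1..N}"
  proof
    fix r assume r: "r \<in> ?D"
    then have "r \<noteq> 0" by (intro notI) simp
    moreover have "r \<le> N" using r N by auto
    ultimately show "r \<in> {1..N}" by simp
  qed
  then have finD: "finite ?D" by (rule finite_subset) auto
  have "ln z \<le> ln (real N + 1)" using N assms by simp
  also have "\<dots> \<le> harm N" using ln_le_harm[of N] by (simp add: add.commute)
  also have "harm N = (\<Sum>n\<in>{1..N}. 1 / real n)" by (simp add: harm_def inverse_eq_divide)
  also have "\<dots> \<le> sum (\<lambda>n. 1 / real n) ((\<lambda>(r, k). r * k\<^sup>2) ` (?D \<times> {1..N}))"
  proof (rule sum_mono2)
    show "{1..N} \<subseteq> (\<lambda>(r, k). r * k\<^sup>2) ` (?D \<times> {1..N})"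
    proof
      fix n assume n: "n \<in> {1..N}"
      have eq: "n = squarefree_part n * square_part n ^ 2"
        by (simp add: squarefree_decompose)
      then have p: "squarefree_part n > 0" "square_part n > 0"
        using n by (auto intro: Nat.gr0I)
      have "square_part n \<le> square_part n ^ 2" by (simp add: power2_eq_square)
      also have "\<dots> \<le> n" using p(1) by (subst (2) eq) simp
      finally have "square_part n \<le> N" using n by simp
      moreover have "squarefree_part n \<le> n" using p(2) by (subst (2) eq) simp
      then have "real (squarefree_part n) \<le> z" using n N by simp
      ultimately show "n \<in> (\<lambda>(r, k). r * k\<^sup>2) ` (?D \<times> {1..N})"
        using eq p n by (intro image_eqI[of _ _ "(squarefree_part n, square_part n)"]) auto
    qed
  qed (use finD in auto)
  also have "\<dots> \<le> sum ((\<lambda>n. 1 / real n) \<circ> (\<lambda>(r, k). r * k\<^sup>2)) (?D \<times> {1..N})"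
    using finD by (intro sum_image_le) auto
  also have "\<dots> = (\<Sum>r\<in>?D. 1 / real r) * (\<Sum>k\<in>{1..N}. 1 / real k ^ 2)"
    by (simp add: sum_product sum.cartesian_product split_def o_def)
  also have "\<dots> \<le> (\<Sum>r\<in>?D. 1 / real r) * 2"
  proof (intro mult_left_mono sum_nonneg)
    show "(\<Sum>k\<in>{1..N}. 1 / real k ^ 2) \<le> 2"
      using sum_inverse_squares_le[where M = 0 and N = N] by (simp add: atLeastSucAtMost_greaterThanAtMost)
  qed auto
  finally show ?thesis by simp
qed

text \<open>
For real weights \<open>\<lambda>\<close> with \<open>\<lambda> 1 = 1\<close>, supported on squarefree \<open>d \<le> z\<close>, the square of the sum of \<open>\<lambda> d\<close> over the
divisors \<open>d\<close> of \<open>n\<close> is 1 for a sifted \<open>n\<close> and nonnegative otherwise. Summation over the interval gives the quadratic form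
\<open>\<Sum>d e. \<lambda> d * \<lambda> e / lcm d e\<close>, which the identity \<open>gcd d e = (\<Sum>r dvd gcd d e. totient r)\<close> diagonalises.
\<close>
lemma selberg_sieve:
  fixes X Y z :: real
  assumes "X \<ge> 0" "Y \<ge> 0" "z > 1"
  shows "real (card {n. X < real n \<and> real n \<le> X + Y \<and> (\<forall>p. prime p \<longrightarrow> p dvd n \<longrightarrow> z < real p)}) \<le> 2 * Y / ln z + z ^ 4"
proof -
  define D where "D = {r::nat. squarefree r \<and> real r \<le> z}"
  define H where "H = (\<Sum>r\<in>D. 1 / real r)"
  define mu where "mu = (\<lambda>n. Re (moebius_mu n))"
  \<comment> \<open>The weights that minimise the quadratic form have \<open>totient k\<close> in place of \<open>k\<close>. The choice here loses
    at most a constant factor, only uses \<open>totient k \<le> k\<close>, and satisfies \<open>\<bar>lam d\<bar> \<le> d\<close>.\<close>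
  define lam where "lam = (\<lambda>d. mu d * real d / H * (\<Sum>k | k \<in> D \<and> d dvd k. 1 / real k))"
  have D_pos: "d > 0" if "d \<in> D" for d using that by (auto simp: D_def intro: Nat.gr0I)
  have D_le: "real d \<le> z" if "d \<in> D" for d using that by (auto simp: D_def)
  have subD: "D \<subseteq> {1..nat \<lfloor>z\<rfloor>}" using D_pos D_le by (auto simp: Suc_le_eq le_nat_floor)
  then have finD: "finite D" by (rule finite_subset) auto
  have "card D \<le> card {1..nat \<lfloor>z\<rfloor>}" using subD by (intro card_mono) auto
  then have "real (card D) \<le> real (nat \<lfloor>z\<rfloor>)" by simp
  also have "\<dots> \<le> z" using assms by linarith
  finally have cardD: "real (card D) \<le> z" .
  have D_dvd: "d \<in> D" if "k \<in> D" "d dvd k" for d k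
    using that dvd_imp_le[of d k] D_pos[of k] by (auto simp: D_def intro: squarefree_mono)
  have D1: "1 \<in> D" using assms by (auto simp: D_def)
  have "ln z / 2 \<le> H" unfolding H_def D_def using assms by (intro sum_inverse_squarefree_ge) auto
  moreover have "ln z > 0" using assms by simp
  ultimately have H: "H > 0" "1 / H \<le> 2 / ln z" by (auto simp: field_simps)
  have mu_abs: "\<bar>mu d\<bar> \<le> 1" for d
    unfolding mu_def moebius_mu_def by (cases "even (card (prime_factors d))") auto
  have mu_mult: "mu (a * b) = mu a * mu b" if "coprime a b" "a > 0" "b > 0" for a b
    using that unfolding mu_def by (simp add: moebius_mu_mult) (simp add: moebius_mu_def minus_one_power_iff)
  have sum_mu: "(\<Sum>d | d dvd n. mu d) = (if n = 1 then 1 else 0)" if "n > 0" for n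
    using arg_cong[OF sum_moebius_mu[OF that], of Re] unfolding mu_def by auto
  have lam1: "lam 1 = 1"
    using H unfolding lam_def mu_def H_def by (simp add: moebius_mu_1)
  have lam_le: "\<bar>lam d\<bar> \<le> z" if "d \<in> D" for d
  proof -
    have "(\<Sum>k | k \<in> D \<and> d dvd k. 1 / real k) \<le> H"
      unfolding H_def using finD by (intro sum_mono2) auto
    moreover have "0 \<le> (\<Sum>k | k \<in> D \<and> d dvd k. 1 / real k)" by (intro sum_nonneg) auto
    moreover have "\<bar>mu d\<bar> * real d \<le> 1 * real d" using mu_abs[of d] by (rule mult_right_mono) simp
    ultimately have "\<bar>mu d\<bar> * real d / H * \<bar>\<Sum>k | k \<in> D \<and> d dvd k. 1 / real k\<bar> \<le> 1 * real d / H * H"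
      using H by (intro mult_mono[OF divide_right_mono]) auto
    then have "\<bar>lam d\<bar> \<le> 1 * real d / H * H"
      unfolding lam_def abs_mult abs_divide using H by (simp only: abs_of_nat abs_of_pos)
    also have "\<dots> \<le> z" using D_le[OF that] H by simp
    finally show ?thesis .
  qed
  \<comment> \<open>Moebius inversion recovers the diagonal variables from \<open>lam\<close>.\<close>
  have y: "(\<Sum>d | d \<in> D \<and> r dvd d. lam d / real d) = mu r / (real r * H)" if r: "r \<in> D" for r
  proof -
    have "(\<Sum>d | d \<in> D \<and> r dvd d. lam d / real d) = (\<Sum>d | d \<in> D \<and> r dvd d. \<Sum>k | k \<in> D \<and> d dvd k. mu d / (H * real k))"
    proof (intro sum.cong refl)
      fix d assume "d \<in> {d. d \<in> D \<and> r dvd d}"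
      then have "d > 0" using D_pos by blast
      then have "lam d / real d = mu d / H * (\<Sum>k | k \<in> D \<and> d dvd k. 1 / real k)"
        unfolding lam_def by (simp add: field_simps)
      then show "lam d / real d = (\<Sum>k | k \<in> D \<and> d dvd k. mu d / (H * real k))"
        by (simp add: sum_distrib_left)
    qed
    also have "\<dots> = (\<Sum>d\<in>{d \<in> D. r dvd d}. \<Sum>k\<in>{k \<in> {k \<in> D. r dvd k}. d dvd k}. mu d / (H * real k))"
      by (intro sum.cong refl) (auto intro: dvd_trans)
    also have "\<dots> = (\<Sum>k\<in>{k \<in> D. r dvd k}. \<Sum>d\<in>{d \<in> {d \<in> D. r dvd d}. d dvd k}. mu d / (H * real k))"
      using finD by (intro sum.swap_restrict) auto
    also have "\<dots> = (\<Sum>k\<in>{k \<in> D. r dvd k}. if k = r then mu r / (H * real r) else 0)"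
    proof (intro sum.cong refl)
      fix k assume "k \<in> {k \<in> D. r dvd k}"
      then obtain e where e: "k = r * e" and k: "k \<in> D" by (auto simp: dvd_def)
      have pos: "r > 0" "e > 0" using D_pos[OF k] e by (auto intro: Nat.gr0I)
      have eq: "{d \<in> {d \<in> D. r dvd d}. d dvd k} = (\<lambda>c. r * c) ` {c. c dvd e}"
        using D_dvd[OF k] e pos by (auto simp: image_def dvd_def)
      have cop: "coprime r c" if "c dvd e" for c
      proof (rule ccontr)
        assume "\<not> coprime r c"
        then obtain p where p: "prime p" "p dvd gcd r c"
          using prime_factor_nat[of "gcd r c"] unfolding coprime_iff_gcd_eq_1 by blast
        have "p dvd r" using p(2) by (rule dvd_trans) simp
        moreover have "p dvd c" using p(2) by (rule dvd_trans) simp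
        then have "p dvd e" using that by (rule dvd_trans)
        ultimately have "p\<^sup>2 dvd k" unfolding e power2_eq_square by (rule mult_dvd_mono)
        with k p(1) show False by (auto simp: D_def squarefree_def not_prime_unit)
      qed
      have "(\<Sum>d\<in>{d \<in> {d \<in> D. r dvd d}. d dvd k}. mu d / (H * real k)) = (\<Sum>c | c dvd e. mu (r * c) / (H * real k))"
        unfolding eq using pos by (subst sum.reindex) (auto simp: inj_on_def)
      also have "\<dots> = (\<Sum>c | c dvd e. mu r / (H * real k) * mu c)"
        using cop pos by (intro sum.cong refl) (auto simp: mu_mult dvd_pos_nat)
      also have "\<dots> = mu r / (H * real k) * (if e = 1 then 1 else 0)"
        unfolding sum_distrib_left[symmetric] sum_mu[OF pos(2)] ..
      also have "\<dots> = (if k = r then mu r / (H * real r) else 0)"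
        using e pos by auto
      finally show "(\<Sum>d\<in>{d \<in> {d \<in> D. r dvd d}. d dvd k}. mu d / (H * real k)) = (if k = r then mu r / (H * real r) else 0)" .
    qed
    also have "\<dots> = mu r / (real r * H)" using r finD by (simp add: mult.commute)
    finally show ?thesis .
  qed
  have gcd: "1 / real (lcm d e) = (\<Sum>r | r \<in> D \<and> r dvd d \<and> r dvd e. real (totient r)) / (real d * real e)"
    if "d \<in> D" "e \<in> D" for d e
  proof -
    have "(\<Sum>r | r \<in> D \<and> r dvd d \<and> r dvd e. real (totient r)) = real (\<Sum>r | r dvd gcd d e. totient r)"
      unfolding of_nat_sum using D_dvd that by (intro sum.cong refl) auto
    also have "\<dots> = real (gcd d e)" by (simp only: totient_divisor_sum)
    finally have 1: "(\<Sum>r | r \<in> D \<and> r dvd d \<and> r dvd e. real (totient r)) = real (gcd d e)" .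
    have "real d * real e = real (gcd d e) * real (lcm d e)"
      unfolding of_nat_mult[symmetric] by (rule arg_cong[OF prod_gcd_lcm_nat])
    moreover have "gcd d e > 0" "lcm d e > 0" using D_pos that by (auto simp: lcm_pos_nat)
    ultimately show ?thesis unfolding 1 by (simp add: field_simps)
  qed
  have Q: "(\<Sum>d\<in>D. \<Sum>e\<in>D. lam d * lam e / real (lcm d e)) \<le> 1 / H"
  proof -
    have "(\<Sum>d\<in>D. \<Sum>e\<in>D. lam d * lam e / real (lcm d e))
      = (\<Sum>d\<in>D. \<Sum>e\<in>D. \<Sum>r\<in>D. if r dvd d \<and> r dvd e then real (totient r) * (lam d / real d) * (lam e / real e) else 0)"
    proof (intro sum.cong refl)
      fix d e assume de: "d \<in> D" "e \<in> D"
      have "lam d * lam e / real (lcm d e) = lam d * lam e * (1 / real (lcm d e))" by simp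
      also have "\<dots> = (\<Sum>r | r \<in> D \<and> r dvd d \<and> r dvd e. real (totient r) * (lam d / real d) * (lam e / real e))"
        unfolding gcd[OF de] by (simp add: sum_distrib_left sum_distrib_right sum_divide_distrib mult_ac)
      also have "\<dots> = (\<Sum>r\<in>D. if r dvd d \<and> r dvd e then real (totient r) * (lam d / real d) * (lam e / real e) else 0)"
        by (rule sum.inter_filter[OF finD])
      finally show "lam d * lam e / real (lcm d e) = \<dots>" .
    qed
    also have "\<dots> = (\<Sum>r\<in>D. \<Sum>d\<in>D. \<Sum>e\<in>D. if r dvd d \<and> r dvd e then real (totient r) * (lam d / real d) * (lam e / real e) else 0)"
      by (rule trans[OF sum.cong[OF refl sum.swap] sum.swap])
    also have "\<dots> = (\<Sum>r\<in>D. real (totient r) * (\<Sum>d | d \<in> D \<and> r dvd d. lam d / real d) ^ 2)"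
    proof (intro sum.cong refl)
      fix r assume "r \<in> D"
      have s: "(\<Sum>d | d \<in> D \<and> r dvd d. lam d / real d) = (\<Sum>d\<in>D. if r dvd d then lam d / real d else 0)"
        using finD by (simp add: sum.inter_filter)
      show "(\<Sum>d\<in>D. \<Sum>e\<in>D. if r dvd d \<and> r dvd e then real (totient r) * (lam d / real d) * (lam e / real e) else 0)
        = real (totient r) * (\<Sum>d | d \<in> D \<and> r dvd d. lam d / real d) ^ 2"
        unfolding s power2_eq_square unfolding sum_product unfolding sum_distrib_left
        by (rule sum.cong[OF refl], rule sum.cong[OF refl]) simp
    qed
    also have "\<dots> = (\<Sum>r\<in>D. real (totient r) * (mu r / (real r * H)) ^ 2)"
      using y by simp
    also have "\<dots> \<le> (\<Sum>r\<in>D. 1 / real r / H ^ 2)"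
    proof (rule sum_mono)
      fix r assume r: "r \<in> D"
      have "(mu r)\<^sup>2 \<le> 1" using mu_abs[of r] by (simp add: abs_square_le_1)
      moreover have "real (totient r) \<le> real r" by (simp add: totient_le)
      ultimately have "real (totient r) * (mu r)\<^sup>2 \<le> real r * 1" by (intro mult_mono) auto
      then have "real (totient r) * (mu r)\<^sup>2 / (real r * H)\<^sup>2 \<le> real r * 1 / (real r * H)\<^sup>2"
        by (intro divide_right_mono) auto
      then show "real (totient r) * (mu r / (real r * H)) ^ 2 \<le> 1 / real r / H ^ 2"
        using D_pos[OF r] H by (simp add: power_divide power_mult_distrib power2_eq_square mult_ac)
    qed
    also have "\<dots> = 1 / H" unfolding sum_divide_distrib[symmetric] H_def[symmetric] using H
      by (simp add: power2_eq_square)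
    finally show ?thesis .
  qed
  let ?I = "{n. X < real n \<and> real n \<le> X + Y}"
  have finI: "finite ?I"
    by (rule finite_subset[of _ "{..nat \<lfloor>X + Y\<rfloor>}"]) (auto simp: le_nat_floor)
  let ?S = "{n. X < real n \<and> real n \<le> X + Y \<and> (\<forall>p. prime p \<longrightarrow> p dvd n \<longrightarrow> z < real p)}"
  have "real (card ?S) = (\<Sum>n\<in>?S. (\<Sum>d | d \<in> D \<and> d dvd n. lam d)\<^sup>2)"
  proof -
    have "(\<Sum>d | d \<in> D \<and> d dvd n. lam d)\<^sup>2 = 1" if n: "n \<in> ?S" for n
    proof -
      have "{d. d \<in> D \<and> d dvd n} = {1}"
      proof (intro equalityI subsetI)
        fix d assume d: "d \<in> {d. d \<in> D \<and> d dvd n}"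
        show "d \<in> {1}"
        proof (rule ccontr)
          assume "d \<notin> {1}"
          then obtain p where p: "prime p" "p dvd d" using prime_factor_nat by blast
          have "d \<in> D" "d dvd n" using d by auto
          then have "p \<le> d" "real d \<le> z" using p D_pos D_le by (simp_all add: dvd_imp_le)
          then have "real p \<le> z" by linarith
          moreover have "p dvd n" using p(2) \<open>d dvd n\<close> by (rule dvd_trans)
          then have "z < real p" using n p(1) by blast
          ultimately show False by simp
        qed
      qed (use D1 in auto)
      then show ?thesis using lam1 by simp
    qed
    then show ?thesis by simp
  qed
  also have "\<dots> \<le> (\<Sum>n\<in>?I. (\<Sum>d | d \<in> D \<and> d dvd n. lam d)\<^sup>2)"
    using finI by (intro sum_mono2) auto
  also have "\<dots> = (\<Sum>n\<in>?I. \<Sum>d\<in>D. \<Sum>e\<in>D. if lcm d e dvd n then lam d * lam e else 0)"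
  proof (intro sum.cong refl)
    fix n
    have s: "(\<Sum>d | d \<in> D \<and> d dvd n. lam d) = (\<Sum>d\<in>D. if d dvd n then lam d else 0)"
      using finD by (simp add: sum.inter_filter)
    show "(\<Sum>d | d \<in> D \<and> d dvd n. lam d)\<^sup>2 = (\<Sum>d\<in>D. \<Sum>e\<in>D. if lcm d e dvd n then lam d * lam e else 0)"
      unfolding s power2_eq_square sum_product by (intro sum.cong refl) auto
  qed
  also have "\<dots> = (\<Sum>d\<in>D. \<Sum>e\<in>D. \<Sum>n\<in>?I. if lcm d e dvd n then lam d * lam e else 0)"
    by (subst sum.swap, rule sum.cong[OF refl], rule sum.swap)
  also have "\<dots> = (\<Sum>d\<in>D. \<Sum>e\<in>D. lam d * lam e * real (card {n. X < real n \<and> real n \<le> X + Y \<and> lcm d e dvd n}))"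
    using finI by (intro sum.cong refl) (simp add: sum.If_cases Int_def conj_assoc)
  also have "\<dots> \<le> (\<Sum>d\<in>D. \<Sum>e\<in>D. lam d * lam e * (Y / real (lcm d e)) + z * z)"
  proof (intro sum_mono)
    fix d e assume de: "d \<in> D" "e \<in> D"
    let ?c = "real (card {n. X < real n \<and> real n \<le> X + Y \<and> lcm d e dvd n})"
    have "\<bar>?c - Y / real (lcm d e)\<bar> \<le> 1"
      using assms D_pos de by (intro card_multiples_interval) (auto simp: lcm_pos_nat)
    then have "\<bar>lam d * lam e * (?c - Y / real (lcm d e))\<bar> \<le> z * z * 1"
      unfolding abs_mult using assms lam_le de by (intro mult_mono) auto
    then show "lam d * lam e * ?c \<le> lam d * lam e * (Y / real (lcm d e)) + z * z"
      by (simp add: algebra_simps)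
  qed
  also have "\<dots> = Y * (\<Sum>d\<in>D. \<Sum>e\<in>D. lam d * lam e / real (lcm d e)) + real (card D) ^ 2 * z\<^sup>2"
    by (simp add: sum.distrib sum_distrib_left power2_eq_square mult_ac)
  also have "\<dots> \<le> Y * (1 / H) + z ^ 2 * z\<^sup>2"
    using mult_left_mono[OF Q assms(2)] mult_right_mono[OF power_mono[OF cardD, of 2], of "z\<^sup>2"]
    by (intro add_mono) auto
  also have "\<dots> \<le> Y * (2 / ln z) + z ^ 4"
    using H assms by (intro add_mono mult_left_mono) (auto simp: power_add[symmetric])
  finally show ?thesis by (simp add: mult.commute)
qed

section \<open>Estimates of Chebyshev and Mertens\<close>

lemma abel_summation_bound:
  fixes c g :: "nat \<Rightarrow> real"
  assumes "M < N" and D: "\<And>k. M < k \<Longrightarrow> k \<le> N \<Longrightarrow> \<bar>\<Sum>n\<in>{M<..k}. c n\<bar> \<le> D"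
  shows "\<bar>\<Sum>n\<in>{M<..N}. c n * g n\<bar> \<le> D * (\<bar>g N\<bar> + (\<Sum>n\<in>{M<..<N}. \<bar>g (Suc n) - g n\<bar>))"
proof -
  define C where "C = (\<lambda>k. \<Sum>n\<in>{M<..k}. c n)"
  have "(\<Sum>n\<in>{M<..N}. c n * g n) = C N * g N - (\<Sum>n\<in>{M<..<N}. C n * (g (Suc n) - g n))"
  proof -
    have "Suc M \<le> N" using assms by simp
    then show ?thesis
    proof (induction N rule: dec_induct)
      case base
      have "{M<..Suc M} = {Suc M}" "{M<..<Suc M} = {}" by auto
      then show ?case by (simp add: C_def)
    next
      case (step n)
      have e: "{M<..Suc n} = insert (Suc n) {M<..n}" "{M<..<Suc n} = insert n {M<..<n}"
        using step by auto
      have "C (Suc n) = C n + c (Suc n)" unfolding C_def e by simp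
      then show ?case using step.IH unfolding e by (simp add: algebra_simps)
    qed
  qed
  also have "\<bar>\<dots>\<bar> \<le> \<bar>C N * g N\<bar> + \<bar>\<Sum>n\<in>{M<..<N}. C n * (g (Suc n) - g n)\<bar>" by simp
  also have "\<dots> \<le> D * \<bar>g N\<bar> + (\<Sum>n\<in>{M<..<N}. D * \<bar>g (Suc n) - g n\<bar>)"
  proof (rule add_mono)
    show "\<bar>C N * g N\<bar> \<le> D * \<bar>g N\<bar>" unfolding abs_mult C_def using assms by (intro mult_right_mono D) auto
    show "\<bar>\<Sum>n\<in>{M<..<N}. C n * (g (Suc n) - g n)\<bar> \<le> (\<Sum>n\<in>{M<..<N}. D * \<bar>g (Suc n) - g n\<bar>)"
      unfolding C_def by (rule order.trans[OF sum_abs], rule sum_mono, unfold abs_mult, rule mult_right_mono, rule D) auto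
  qed
  finally show ?thesis by (simp add: sum_distrib_left algebra_simps)
qed

lemma prod_primes_dvd:
  assumes "finite A" "\<And>p. p \<in> A \<Longrightarrow> prime p" "\<And>p. p \<in> A \<Longrightarrow> p dvd (n::nat)"
  shows "\<Prod>A dvd n"
  using assms
proof (induction A rule: finite_induct)
  case (insert p A)
  have "coprime p (\<Prod>A)"
  proof (rule prod_coprime_right)
    fix q assume "q \<in> A"
    then show "coprime p q" using insert by (intro primes_coprime) auto
  qed
  then show ?case using insert by (simp add: divides_mult)
qed auto

lemma finite_primes_upto: "finite {p :: nat. prime p \<and> p \<le> N}"
  by (rule finite_subset[of _ "{..N}"]) auto

text \<open>
All primes in \<open>(n, 2 * n]\<close> divide the central binomial coefficient, which is at most \<open>4 ^ n\<close>.
\<close>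
lemma chebyshev_theta_le: "(\<Sum>p | prime p \<and> p \<le> N. ln (real p)) \<le> 4 * real N"
proof (cases "N = 0")
  case False
  define \<theta> where "\<theta> = (\<lambda>N. \<Sum>p | prime p \<and> p \<le> N. ln (real p))"
  have step: "\<theta> (2 * n) \<le> \<theta> n + 2 * real n * ln 2" if "n > 0" for n
  proof -
    define A where "A = {p. prime p \<and> n < p \<and> p \<le> 2 * n}"
    have fin: "finite A" by (rule finite_subset[of _ "{..2*n}"]) (auto simp: A_def)
    have "p dvd (2 * n choose n)" if "p \<in> A" for p
    proof -
      have p: "prime p" "n < p" "p \<le> 2 * n" using that by (auto simp: A_def)
      have "fact n * fact (2 * n - n) * (2 * n choose n) = fact (2 * n)"
        by (rule binomial_fact_lemma) simp
      moreover have "p dvd fact (2 * n)" using p by (simp only: prime_dvd_fact_iff)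
      moreover have "2 * n - n = n" by simp
      ultimately have "p dvd fact n * fact n * (2 * n choose n)" by metis
      moreover have "\<not> p dvd fact n" using p by (simp add: prime_dvd_fact_iff)
      ultimately show ?thesis using p(1) by (meson prime_dvd_multD)
    qed
    then have "\<Prod>A dvd (2 * n choose n)"
      using fin by (intro prod_primes_dvd) (auto simp: A_def)
    then have "\<Prod>A \<le> (2 * n choose n)" by (rule dvd_imp_le) simp
    also have "\<dots> \<le> (\<Sum>k\<le>2 * n. 2 * n choose k)" by (rule member_le_sum) auto
    also have "\<dots> = 2 ^ (2 * n)" by (rule choose_row_sum)
    finally have "real (\<Prod>A) \<le> real (2 ^ (2 * n))" by (rule of_nat_mono)
    then have le: "real (\<Prod>A) \<le> 2 ^ (2 * n)" by simp
    have pos: "real (\<Prod>A) > 0" by (auto simp: A_def prime_gt_0_nat intro!: prod_pos)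
    have "(\<Sum>p\<in>A. ln (real p)) = ln (\<Prod>p\<in>A. real p)"
      using fin by (subst ln_prod) (auto simp: A_def prime_gt_0_nat)
    also have "\<dots> \<le> ln (2 ^ (2 * n))" using le pos by simp
    also have "\<dots> = 2 * real n * ln 2" by (simp add: ln_realpow)
    finally have A: "(\<Sum>p\<in>A. ln (real p)) \<le> 2 * real n * ln 2" .
    have "{p. prime p \<and> p \<le> 2 * n} = {p. prime p \<and> p \<le> n} \<union> A" by (auto simp: A_def)
    then have "\<theta> (2 * n) = \<theta> n + (\<Sum>p\<in>A. ln (real p))"
      unfolding \<theta>_def using fin finite_primes_upto by (simp add: sum.union_disjoint A_def disjoint_iff)
    with A show ?thesis by simp
  qed
  have pow: "\<theta> (2 ^ k) \<le> 2 * 2 ^ k * ln 2" for k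
  proof (induction k)
    case 0
    have e: "{p :: nat. prime p \<and> p \<le> 2 ^ 0} = {}" by (auto dest: prime_gt_1_nat)
    show ?case unfolding \<theta>_def e by simp
  next
    case (Suc k)
    then show ?case using step[of "2 ^ k"] by simp
  qed
  obtain k where k: "2 ^ k \<le> N" "N < 2 ^ (k + 1)"
    using ex_power_ivl1[of 2 N] False by auto
  have "\<theta> N \<le> \<theta> (2 ^ (k + 1))"
    unfolding \<theta>_def using k finite_primes_upto by (intro sum_mono2) (auto simp: prime_ge_1_nat)
  also have "\<dots> \<le> 2 * 2 ^ (k + 1) * ln 2" by (rule pow)
  also have "\<dots> \<le> 4 * 2 ^ k * 1" using ln_2_less_1 by simp
  also have "\<dots> \<le> 4 * real N" using of_nat_mono[OF k(1), where 'a = real] by simp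
  finally show ?thesis unfolding \<theta>_def .
qed (auto simp: prime_gt_0_nat)

lemma card_multiples_upto:
  assumes "l > 0"
  shows "card {n \<in> {1..N}. l dvd n} = N div l"
proof -
  have "{n \<in> {1..N}. l dvd n} = (\<lambda>k. l * k) ` {1..N div l}"
    using assms by (auto simp: dvd_def image_def less_eq_div_iff_mult_less_eq mult.commute)
  then show ?thesis using assms by (simp add: card_image inj_on_def)
qed

lemma ln_Suc_minus_ln_bounds:
  assumes "n > 0"
  shows "1 / real (Suc n) \<le> ln (real (Suc n)) - ln (real n)"
    and "ln (real (Suc n)) - ln (real n) \<le> 1 / real n"
proof -
  have "ln (real n / real (Suc n)) \<le> real n / real (Suc n) - 1"
    using assms by (intro ln_le_minus_one) auto
  moreover have "ln (real n / real (Suc n)) = ln (real n) - ln (real (Suc n))"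
    using assms by (simp add: ln_div)
  moreover have "real n / real (Suc n) - 1 = - (1 / real (Suc n))"
    by (simp add: field_simps)
  ultimately show "1 / real (Suc n) \<le> ln (real (Suc n)) - ln (real n)" by linarith
  have "ln (real (Suc n) / real n) \<le> real (Suc n) / real n - 1"
    using assms by (intro ln_le_minus_one) auto
  moreover have "ln (real (Suc n) / real n) = ln (real (Suc n)) - ln (real n)"
    using assms by (simp add: ln_div)
  moreover have "real (Suc n) / real n - 1 = 1 / real n"
    using assms by (simp add: field_simps)
  ultimately show "ln (real (Suc n)) - ln (real n) \<le> 1 / real n" by linarith
qed

lemma sum_ln_upto_bounds:
  assumes "N > 0"
  shows "real N * ln (real N) - real N \<le> (\<Sum>n\<in>{1..N}. ln (real n))"
    and "(\<Sum>n\<in>{1..N}. ln (real n)) \<le> real N * ln (real N)"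
proof -
  show "real N * ln (real N) - real N \<le> (\<Sum>n\<in>{1..N}. ln (real n))"
    using assms
  proof (induction N rule: nat_induct_non_zero)
    case (Suc n)
    have "ln (real n + 1) - ln (real n) \<le> 1 / real n"
      using ln_Suc_minus_ln_bounds(2)[of n] Suc by (simp add: add.commute)
    then have "real n * (ln (real n + 1) - ln (real n)) \<le> real n * (1 / real n)"
      by (intro mult_left_mono) auto
    then have "real n * ln (real n + 1) - real n * ln (real n) \<le> 1"
      using Suc by (simp add: algebra_simps)
    then show ?case using Suc by (simp add: algebra_simps)
  qed simp
  have "(\<Sum>n\<in>{1..N}. ln (real n)) \<le> (\<Sum>n\<in>{1..N}. ln (real N))"
    by (intro sum_mono) auto
  then show "(\<Sum>n\<in>{1..N}. ln (real n)) \<le> real N * ln (real N)" by simp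
qed

lemma ln_eq_sum_prime_powers:
  assumes "n > 0" "n \<le> N"
  shows "ln (real n) = (\<Sum>p | prime p \<and> p \<le> N. \<Sum>k\<in>{1..N}. if p ^ k dvd n then ln (real p) else 0)"
proof -
  have "real n = (\<Prod>p\<in>prime_factors n. real p ^ multiplicity p n)"
    using assms prod_prime_factors[of n] by (simp flip: of_nat_power of_nat_prod)
  then have "ln (real n) = (\<Sum>p\<in>prime_factors n. real (multiplicity p n) * ln (real p))"
    by (simp only:, subst ln_prod) (auto simp: ln_realpow in_prime_factors_iff prime_gt_0_nat)
  also have "\<dots> = (\<Sum>p | prime p \<and> p \<le> N. real (multiplicity p n) * ln (real p))"
  proof (rule sum.mono_neutral_left[OF finite_primes_upto])
    show "prime_factors n \<subseteq> {p. prime p \<and> p \<le> N}"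
    proof
      fix p assume "p \<in> prime_factors n"
      then have "prime p" "p dvd n" by (auto simp: in_prime_factors_iff)
      then show "p \<in> {p. prime p \<and> p \<le> N}"
        using assms dvd_imp_le[of p n] by simp
    qed
    show "\<forall>p\<in>{p. prime p \<and> p \<le> N} - prime_factors n. real (multiplicity p n) * ln (real p) = 0"
      using assms by (auto simp: in_prime_factors_iff not_dvd_imp_multiplicity_0)
  qed
  also have "\<dots> = (\<Sum>p | prime p \<and> p \<le> N. \<Sum>k\<in>{1..N}. if p ^ k dvd n then ln (real p) else 0)"
  proof (intro sum.cong refl)
    fix p assume "p \<in> {p. prime p \<and> p \<le> N}"
    then have p: "prime p" by simp
    have "multiplicity p n < p ^ multiplicity p n"
      using prime_gt_1_nat[OF p] by (simp add: power_gt_expt)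
    also have "\<dots> \<le> n" using assms by (intro dvd_imp_le multiplicity_dvd) auto
    finally have m: "multiplicity p n \<le> N" using assms by simp
    have eq: "{k \<in> {1..N}. p ^ k dvd n} = {1..multiplicity p n}"
    proof -
      have e: "p ^ k dvd n \<longleftrightarrow> k \<le> multiplicity p n" for k
        using power_dvd_iff_le_multiplicity[of n p k] assms p not_prime_unit[of p] by blast
      show ?thesis unfolding e using m by auto
    qed
    have "(\<Sum>k\<in>{1..N}. if p ^ k dvd n then ln (real p) else 0) = (\<Sum>k\<in>{k \<in> {1..N}. p ^ k dvd n}. ln (real p))"
      by (rule sum.inter_filter[symmetric]) simp
    then show "real (multiplicity p n) * ln (real p) = (\<Sum>k\<in>{1..N}. if p ^ k dvd n then ln (real p) else 0)"
      unfolding eq by simp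
  qed
  finally show ?thesis .
qed

lemma sum_ln_upto_eq:
  shows "(\<Sum>n\<in>{1..N}. ln (real n)) = (\<Sum>p | prime p \<and> p \<le> N. \<Sum>k\<in>{1..N}. ln (real p) * real (N div p ^ k))"
proof -
  have "(\<Sum>n\<in>{1..N}. ln (real n)) = (\<Sum>n\<in>{1..N}. \<Sum>p | prime p \<and> p \<le> N. \<Sum>k\<in>{1..N}. if p ^ k dvd n then ln (real p) else 0)"
    by (intro sum.cong refl ln_eq_sum_prime_powers) auto
  also have "\<dots> = (\<Sum>p | prime p \<and> p \<le> N. \<Sum>k\<in>{1..N}. \<Sum>n\<in>{1..N}. if p ^ k dvd n then ln (real p) else 0)"
    by (subst sum.swap, rule sum.cong[OF refl], rule sum.swap)
  also have "\<dots> = (\<Sum>p | prime p \<and> p \<le> N. \<Sum>k\<in>{1..N}. ln (real p) * real (N div p ^ k))"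
  proof (intro sum.cong refl)
    fix p k assume "p \<in> {p. prime p \<and> p \<le> N}"
    then have p: "p ^ k > 0" by (auto simp: prime_gt_0_nat)
    have "(\<Sum>n\<in>{1..N}. if p ^ k dvd n then ln (real p) else 0) = (\<Sum>n\<in>{n \<in> {1..N}. p ^ k dvd n}. ln (real p))"
      by (rule sum.inter_filter[symmetric]) simp
    then show "(\<Sum>n\<in>{1..N}. if p ^ k dvd n then ln (real p) else 0) = ln (real p) * real (N div p ^ k)"
      unfolding sum_constant card_multiples_upto[OF p] by (simp only: mult.commute)
  qed
  finally show ?thesis .
qed

lemma summable_ln_div_square: "summable (\<lambda>n. ln (real n) / (real n * (real n - 1)))"
proof (rule summable_comparison_test_ev)
  show "eventually (\<lambda>n. norm (ln (real n) / (real n * (real n - 1))) \<le> real n powr (-3/2)) sequentially"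
    unfolding real_norm_def by real_asymp
  show "summable (\<lambda>n. real n powr (-3/2))" by (subst summable_real_powr_iff) auto
qed

text \<open>
The sum of \<open>ln n\<close> for \<open>n \<le> N\<close> is \<open>N * ln N + O(N)\<close>; it is also the sum of \<open>ln p * (N div p ^ k)\<close> over the prime
powers. The terms with \<open>k \<ge> 2\<close> contribute \<open>O(N)\<close>, and by Chebyshev's estimate rounding \<open>N / p\<close> down costs \<open>O(N)\<close>.
\<close>
lemma mertens_first: "\<exists>C. \<forall>N>0. \<bar>(\<Sum>p | prime p \<and> p \<le> N. ln (real p) / real p) - ln (real N)\<bar> \<le> C"
proof -
  define C where "C = (\<Sum>n. ln (real n) / (real n * (real n - 1)))"
  have "\<bar>(\<Sum>p | prime p \<and> p \<le> N. ln (real p) / real p) - ln (real N)\<bar> \<le> \<bar>C\<bar> + 4" if N: "N > 0" for N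
  proof -
    define P where "P = (\<Sum>p | prime p \<and> p \<le> N. ln (real p) / real p)"
    have lnp: "ln (real p) \<ge> 0" if "prime p" for p using prime_ge_1_nat[OF that] by simp
    \<comment> \<open>Upper bound: keep the exponent \<open>k = 1\<close> only.\<close>
    have "real N * P - 4 * real N \<le> (\<Sum>p | prime p \<and> p \<le> N. real N * (ln (real p) / real p) - ln (real p))"
      unfolding P_def using chebyshev_theta_le[of N] by (simp add: sum_subtractf sum_distrib_left)
    also have "\<dots> \<le> (\<Sum>p | prime p \<and> p \<le> N. \<Sum>k\<in>{1}. ln (real p) * real (N div p ^ k))"
    proof (rule sum_mono)
      fix p assume "p \<in> {p. prime p \<and> p \<le> N}"
      then have p: "prime p" by simp
      have "real N / real p - 1 \<le> real (N div p)"
        using floor_divide_of_nat_eq[of N p, where ?'a = real] by linarith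
      then have "ln (real p) * (real N / real p - 1) \<le> ln (real p) * real (N div p)"
        using lnp[OF p] by (intro mult_left_mono) auto
      then show "real N * (ln (real p) / real p) - ln (real p) \<le> (\<Sum>k\<in>{1}. ln (real p) * real (N div p ^ k))"
        by (simp add: algebra_simps)
    qed
    also have "\<dots> \<le> (\<Sum>p | prime p \<and> p \<le> N. \<Sum>k\<in>{1..N}. ln (real p) * real (N div p ^ k))"
      using N lnp by (intro sum_mono sum_mono2) auto
    also have "\<dots> \<le> real N * ln (real N)"
      unfolding sum_ln_upto_eq[symmetric] using N by (rule sum_ln_upto_bounds)
    finally have "real N * (P - 4) \<le> real N * ln (real N)" by (simp add: algebra_simps)
    then have up: "P - 4 \<le> ln (real N)" using N by simp
    have "real N * ln (real N) - real N \<le> (\<Sum>p | prime p \<and> p \<le> N. \<Sum>k\<in>{1..N}. ln (real p) * real (N div p ^ k))"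
      unfolding sum_ln_upto_eq[symmetric] using N by (rule sum_ln_upto_bounds)
    also have "\<dots> \<le> (\<Sum>p | prime p \<and> p \<le> N. real N * (ln (real p) / real p + ln (real p) / (real p * (real p - 1))))"
    proof (rule sum_mono)
      fix p assume "p \<in> {p. prime p \<and> p \<le> N}"
      then have p: "prime p" by simp
      have p2: "real p \<ge> 2" using prime_ge_2_nat[OF p] by simp
      have "(\<Sum>k\<in>{1..N}. real (N div p ^ k)) \<le> (\<Sum>k\<in>{1..N}. real N * (1 / real p) ^ k)"
        by (intro sum_mono) (metis of_nat_div_le_of_nat of_nat_power power_one_over times_divide_eq_right mult.right_neutral)
      also have "\<dots> = real N * (\<Sum>k\<in>{1..N}. (1 / real p) ^ k)" by (simp add: sum_distrib_left)
      also have "(\<Sum>k\<in>{1..N}. (1 / real p) ^ k) \<le> 1 / (real p - 1)"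
      proof -
        have "(\<Sum>k\<in>{1..N}. (1 / real p) ^ k) = (\<Sum>k\<in>{1..N}. ((1 / real p) ^ (k - 1) - (1 / real p) ^ k) / (real p - 1))"
        proof (intro sum.cong refl)
          fix k assume "k \<in> {1..N}"
          then obtain j where "k = Suc j" by (cases k) auto
          then show "(1 / real p) ^ k = ((1 / real p) ^ (k - 1) - (1 / real p) ^ k) / (real p - 1)"
            using p2 by (simp add: field_simps)
        qed
        also have "\<dots> = (\<Sum>k\<in>{1..N}. (1 / real p) ^ (k - 1) - (1 / real p) ^ k) / (real p - 1)"
          by (simp add: sum_divide_distrib)
        also have "(\<Sum>k\<in>{1..N}. (1 / real p) ^ (k - 1) - (1 / real p) ^ k) = 1 - (1 / real p) ^ N"
          by (induction N) auto
        also have "(1 - (1 / real p) ^ N) / (real p - 1) \<le> 1 / (real p - 1)"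
          using p2 by (intro divide_right_mono) auto
        finally show ?thesis .
      qed
      finally have "(\<Sum>k\<in>{1..N}. real (N div p ^ k)) \<le> real N * (1 / (real p - 1))"
        by (simp add: mult_left_mono)
      then have "ln (real p) * (\<Sum>k\<in>{1..N}. real (N div p ^ k)) \<le> ln (real p) * (real N * (1 / (real p - 1)))"
        using lnp[OF p] by (intro mult_left_mono) auto
      also have "\<dots> = real N * (ln (real p) / real p + ln (real p) / (real p * (real p - 1)))"
        using p2 by (simp add: field_simps)
      finally show "(\<Sum>k\<in>{1..N}. ln (real p) * real (N div p ^ k)) \<le> \<dots>"
        by (simp add: sum_distrib_left)
    qed
    also have "\<dots> = real N * (P + (\<Sum>p | prime p \<and> p \<le> N. ln (real p) / (real p * (real p - 1))))"
      unfolding P_def sum.distrib[symmetric] sum_distrib_left ..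
    also have "(\<Sum>p | prime p \<and> p \<le> N. ln (real p) / (real p * (real p - 1))) \<le> C"
      unfolding C_def
    proof (rule sum_le_suminf[OF summable_ln_div_square finite_primes_upto])
      fix n :: nat
      show "0 \<le> ln (real n) / (real n * (real n - 1))" by (cases "n = 0") auto
    qed
    finally have "real N * (ln (real N) - 1) \<le> real N * (P + C)"
      using N by (simp add: algebra_simps)
    then have "ln (real N) - 1 \<le> P + C" using N by simp
    with up show ?thesis unfolding P_def by linarith
  qed
  then show ?thesis by blast
qed

lemma ln_harm_bounds: "N > 0 \<Longrightarrow> \<bar>(\<Sum>n\<in>{1..N}. 1 / real n) - ln (real N)\<bar> \<le> 1"
proof -
  assume N: "N > 0"
  have "(\<Sum>n\<in>{1..N}. 1 / real n) = harm N" by (simp add: harm_def inverse_eq_divide)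
  moreover have "ln (real N) \<le> harm N" using ln_le_harm[of N] N
    by (smt (verit) ln_le_cancel_iff of_nat_0_less_iff)
  moreover have "harm N \<le> ln (real N) + 1" using N
  proof (induction N rule: nat_induct_non_zero)
    case 1
    then show ?case by (simp add: harm_def)
  next
    case (Suc n)
    have "1 / (real n + 1) \<le> ln (real n + 1) - ln (real n)"
      using ln_Suc_minus_ln_bounds(1)[of n] Suc by (simp add: add.commute)
    then show ?case using Suc by (simp add: harm_Suc inverse_eq_divide add.commute)
  qed
  ultimately show ?thesis by simp
qed

text \<open>
The weights \<open>ln p / p\<close> on the primes and \<open>1 / n\<close> on the integers have partial sums that differ boundedly.
Summation by parts against this difference replaces a sum over primes by a sum over integers.
\<close>
definition prime_harm_diff :: "nat \<Rightarrow> real" where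
  "prime_harm_diff n = (if prime n then ln (real n) / real n else 0) - 1 / real n"

lemma sum_primes_indicator:
  fixes h :: "nat \<Rightarrow> 'a :: comm_monoid_add"
  shows "(\<Sum>p | prime p \<and> M < p \<and> p \<le> N. h p) = (\<Sum>n\<in>{M<..N}. if prime n then h n else 0)"
  by (subst sum.inter_filter[symmetric]) (auto intro!: sum.cong)

lemma prime_harm_diff_partial_sums_bounded: "\<exists>D. \<forall>M N. \<bar>\<Sum>n\<in>{M<..N}. prime_harm_diff n\<bar> \<le> D"
proof -
  obtain C where C: "\<And>N. N > 0 \<Longrightarrow> \<bar>(\<Sum>p | prime p \<and> p \<le> N. ln (real p) / real p) - ln (real N)\<bar> \<le> C"
    using mertens_first by blast
  have C0: "C \<ge> 0" using C[of 1] by linarith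
  have 0: "\<bar>\<Sum>n\<in>{0<..N}. prime_harm_diff n\<bar> \<le> C + 1" for N
  proof (cases "N = 0")
    case False
    have e: "{p. prime p \<and> 0 < p \<and> p \<le> N} = {p. prime p \<and> p \<le> N}"
      by (auto simp: prime_gt_0_nat)
    have "(\<Sum>n\<in>{0<..N}. prime_harm_diff n)
        = (\<Sum>n\<in>{0<..N}. if prime n then ln (real n) / real n else 0) - (\<Sum>n\<in>{0<..N}. 1 / real n)"
      unfolding prime_harm_diff_def by (rule sum_subtractf)
    also have "\<dots> = (\<Sum>p | prime p \<and> p \<le> N. ln (real p) / real p) - (\<Sum>n\<in>{1..N}. 1 / real n)"
      unfolding sum_primes_indicator[symmetric] e by (simp add: atLeastSucAtMost_greaterThanAtMost[symmetric])
    finally show ?thesis using C[of N] ln_harm_bounds[of N] False by linarith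
  qed (use C0 in auto)
  have "\<bar>\<Sum>n\<in>{M<..N}. prime_harm_diff n\<bar> \<le> 2 * (C + 1)" for M N
  proof (cases "M \<le> N")
    case True
    then have "{0<..N} = {0<..M} \<union> {M<..N}" by auto
    then have "(\<Sum>n\<in>{0<..N}. prime_harm_diff n) = (\<Sum>n\<in>{0<..M}. prime_harm_diff n) + (\<Sum>n\<in>{M<..N}. prime_harm_diff n)"
      by (simp add: sum.union_disjoint disjoint_iff)
    then have "(\<Sum>n\<in>{M<..N}. prime_harm_diff n) = (\<Sum>n\<in>{0<..N}. prime_harm_diff n) - (\<Sum>n\<in>{0<..M}. prime_harm_diff n)"
      by simp
    also have "\<bar>\<dots>\<bar> \<le> \<bar>\<Sum>n\<in>{0<..N}. prime_harm_diff n\<bar> + \<bar>\<Sum>n\<in>{0<..M}. prime_harm_diff n\<bar>"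
      by (rule abs_triangle_ineq4)
    also have "\<dots> \<le> (C + 1) + (C + 1)" by (intro add_mono 0)
    finally show ?thesis by simp
  qed (use C0 in auto)
  then show ?thesis by blast
qed

text \<open>
This is \<open>1 - u / v \<le> ln (v / u)\<close> for \<open>u = ln n\<close> and \<open>v = ln (Suc n)\<close>.
\<close>
lemma inverse_n_ln_n_le:
  assumes "n \<ge> 2"
  shows "1 / (real (Suc n) * ln (real (Suc n))) \<le> ln (ln (real (Suc n))) - ln (ln (real n))"
proof -
  define u v where "u = ln (real n)" and "v = ln (real (Suc n))"
  have uv: "u > 0" "v > 0" using assms by (auto simp: u_def v_def)
  have "1 / (real (Suc n) * v) = (1 / real (Suc n)) / v" by simp
  also have "\<dots> \<le> (v - u) / v"
    using ln_Suc_minus_ln_bounds(1)[of n] assms uv unfolding u_def v_def by (intro divide_right_mono) auto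
  also have "\<dots> = - (u / v - 1)" using uv by (simp add: field_simps)
  also have "\<dots> \<le> - ln (u / v)" using ln_le_minus_one[of "u / v"] uv by simp
  also have "\<dots> = ln v - ln u" using uv by (simp add: ln_div)
  finally show ?thesis unfolding u_def v_def .
qed

lemma sum_inverse_n_ln_n_le:
  assumes "N \<ge> 2"
  shows "(\<Sum>n\<in>{1<..N}. 1 / (real n * ln (real n))) \<le> ln (ln (real N)) - ln (ln 2) + 1 / (2 * ln 2)"
  using assms
proof (induction N rule: dec_induct)
  case base
  have "{1<..2::nat} = {2}" by auto
  then show ?case by simp
next
  case (step n)
  have "{1<..Suc n} = insert (Suc n) {1<..n}" using step by auto
  then show ?case using step inverse_n_ln_n_le[of n] by simp
qed

lemma sum_telescope_greaterThanLessThan: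
  fixes G :: "nat \<Rightarrow> real"
  assumes "M < N"
  shows "(\<Sum>n\<in>{M<..<N}. G n - G (Suc n)) = G (Suc M) - G N"
proof -
  have "Suc M \<le> N" using assms by simp
  then show ?thesis
  proof (induction N rule: dec_induct)
    case base
    have "{M<..<Suc M} = {}" by auto
    then show ?case by simp
  next
    case (step n)
    have "{M<..<Suc n} = insert n {M<..<n}" using step by auto
    then show ?case using step by simp
  qed
qed

lemma inverse_ln_decreasing:
  assumes "n \<ge> 2"
  shows "1 / ln (real (Suc n)) \<le> 1 / ln (real n)"
  using assms by (intro divide_left_mono) auto

lemma mertens_second_upper: "\<exists>C. \<forall>N\<ge>2. (\<Sum>p | prime p \<and> p \<le> N. 1 / real p) \<le> ln (ln (real N)) + C"
proof -
  obtain D where D: "\<And>M N. \<bar>\<Sum>n\<in>{M<..N}. prime_harm_diff n\<bar> \<le> D"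
    using prime_harm_diff_partial_sums_bounded by blast
  have "(\<Sum>p | prime p \<and> p \<le> N. 1 / real p) \<le> ln (ln (real N)) + (D * (1 / ln 2) - ln (ln 2) + 1 / (2 * ln 2))"
    if N: "N \<ge> 2" for N
  proof -
    have e: "{p. prime p \<and> p \<le> N} = {p. prime p \<and> 1 < p \<and> p \<le> N}"
      by (auto simp: prime_gt_Suc_0_nat)
    have "(\<Sum>p | prime p \<and> p \<le> N. 1 / real p) = (\<Sum>n\<in>{1<..N}. if prime n then 1 / real n else 0)"
      unfolding e by (rule sum_primes_indicator)
    also have "\<dots> = (\<Sum>n\<in>{1<..N}. prime_harm_diff n * (1 / ln (real n)) + 1 / (real n * ln (real n)))"
      by (intro sum.cong refl) (auto simp: prime_harm_diff_def field_simps)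
    also have "\<dots> = (\<Sum>n\<in>{1<..N}. prime_harm_diff n * (1 / ln (real n))) + (\<Sum>n\<in>{1<..N}. 1 / (real n * ln (real n)))"
      by (rule sum.distrib)
    also have "(\<Sum>n\<in>{1<..N}. prime_harm_diff n * (1 / ln (real n))) \<le>
       D * (\<bar>1 / ln (real N)\<bar> + (\<Sum>n\<in>{1<..<N}. \<bar>1 / ln (real (Suc n)) - 1 / ln (real n)\<bar>))"
      using abel_summation_bound[of 1 N prime_harm_diff D "\<lambda>n. 1 / ln (real n)"] D N by fastforce
    also have "(\<Sum>n\<in>{1<..<N}. \<bar>1 / ln (real (Suc n)) - 1 / ln (real n)\<bar>) = (\<Sum>n\<in>{1<..<N}. 1 / ln (real n) - 1 / ln (real (Suc n)))"
    proof (intro sum.cong refl)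
      fix n assume "n \<in> {1<..<N}"
      then have "1 / ln (real (Suc n)) \<le> 1 / ln (real n)" by (intro inverse_ln_decreasing) auto
      then show "\<bar>1 / ln (real (Suc n)) - 1 / ln (real n)\<bar> = 1 / ln (real n) - 1 / ln (real (Suc n))"
        by linarith
    qed
    also have "\<dots> = 1 / ln (real (Suc 1)) - 1 / ln (real N)"
      using N by (intro sum_telescope_greaterThanLessThan) auto
    also have "\<bar>1 / ln (real N)\<bar> + (1 / ln (real (Suc 1)) - 1 / ln (real N)) = 1 / ln 2"
      using N by simp
    also have "(\<Sum>n\<in>{1<..N}. 1 / (real n * ln (real n))) \<le> ln (ln (real N)) - ln (ln 2) + 1 / (2 * ln 2)"
      using N by (rule sum_inverse_n_ln_n_le)
    finally show ?thesis by simp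
  qed
  then show ?thesis by blast
qed

section \<open>Cosine sums over primes\<close>

lemma abs_cos_diff_le: "\<bar>cos x - cos y\<bar> \<le> \<bar>x - y\<bar>" for x y :: real
proof -
  have "\<bar>cos u - cos v\<bar> \<le> v - u" if uv: "u < v" for u v :: real
  proof -
    have "\<exists>z. u < z \<and> z < v \<and> cos v - cos u = (v - u) * (- sin z)"
      using uv by (intro MVT2) (auto intro!: derivative_eq_intros)
    then obtain z where "cos v - cos u = (v - u) * (- sin z)" by blast
    then have "cos u - cos v = (v - u) * sin z" by simp
    then have "\<bar>cos u - cos v\<bar> = (v - u) * \<bar>sin z\<bar>" using uv by (simp add: abs_mult)
    also have "\<dots> \<le> (v - u) * 1" using uv by (intro mult_left_mono) auto
    finally show ?thesis by simp
  qed
  from this[of x y] this[of y x] show ?thesis by (cases x y rule: linorder_cases) auto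
qed

text \<open>
The summand is, up to \<open>O(1 / (\<phi> * n ^ 2))\<close>, the increment of \<open>sin (\<phi> * ln n) / \<phi>\<close>.
\<close>
lemma sum_cos_ln_div_bounded:
  assumes \<phi>: "0 < \<phi>" "\<phi> \<le> 2"
  shows "\<bar>\<Sum>n\<in>{M<..N}. cos (\<phi> * ln (real n)) / real n\<bar> \<le> 14 / \<phi>"
proof (cases "M < N")
  case True
  define e where "e = (\<lambda>n. cos (\<phi> * ln (real n)) / real n)"
  define S where "S = (\<lambda>n. sin (\<phi> * ln (real n)))"
  have step: "\<bar>\<phi> * e n - (S (Suc n) - S n)\<bar> \<le> 6 * (1 / (real n)\<^sup>2)" if n: "n > 0" for n
  proof -
    have "\<exists>z. real n < z \<and> z < real (Suc n) \<and>
       sin (\<phi> * ln (real (Suc n))) - sin (\<phi> * ln (real n)) = (real (Suc n) - real n) * (cos (\<phi> * ln z) * (\<phi> / z))"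
      using n by (intro MVT2) (auto intro!: derivative_eq_intros)
    then obtain z where z: "real n < z" "z < real n + 1" "S (Suc n) - S n = \<phi> * (cos (\<phi> * ln z) / z)"
      unfolding S_def by auto
    have z0: "z > 0" using z n by simp
    have d: "\<bar>1 / real n - 1 / z\<bar> \<le> 1 / (real n)\<^sup>2"
    proof -
      have "\<bar>1 / real n - 1 / z\<bar> = (z - real n) / (real n * z)"
        using z n by (simp add: field_simps abs_if)
      also have "\<dots> \<le> 1 / (real n * real n)"
        using z n by (intro frac_le mult_left_mono) auto
      finally show ?thesis by (simp add: power2_eq_square)
    qed
    have "\<bar>cos (\<phi> * ln (real n)) - cos (\<phi> * ln z)\<bar> \<le> \<bar>\<phi> * ln (real n) - \<phi> * ln z\<bar>"
      by (rule abs_cos_diff_le)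
    also have "\<dots> = \<phi> * (ln z - ln (real n))"
      using \<phi> z n by (simp add: abs_if right_diff_distrib)
    also have "\<dots> \<le> 2 * (1 / real n)"
    proof (intro mult_mono)
      have "ln z \<le> ln (real (Suc n))" using z z0 by simp
      then show "ln z - ln (real n) \<le> 1 / real n" using ln_Suc_minus_ln_bounds(2)[OF n] by linarith
    qed (use \<phi> z n in auto)
    finally have c: "\<bar>cos (\<phi> * ln (real n)) - cos (\<phi> * ln z)\<bar> \<le> 2 * (1 / real n)" .
    have "e n - cos (\<phi> * ln z) / z = cos (\<phi> * ln (real n)) * (1 / real n - 1 / z) + (cos (\<phi> * ln (real n)) - cos (\<phi> * ln z)) * (1 / z)"
      unfolding e_def using n z0 by (simp add: field_simps)
    also have "\<bar>\<dots>\<bar> \<le> \<bar>cos (\<phi> * ln (real n))\<bar> * \<bar>1 / real n - 1 / z\<bar> + \<bar>cos (\<phi> * ln (real n)) - cos (\<phi> * ln z)\<bar> * \<bar>1 / z\<bar>"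
      unfolding abs_mult[symmetric] by (rule abs_triangle_ineq)
    also have "\<dots> \<le> 1 * (1 / (real n)\<^sup>2) + 2 * (1 / real n) * (1 / real n)"
      using z z0 n d c by (intro add_mono mult_mono) (auto intro!: divide_left_mono)
    also have "\<dots> = 3 * (1 / (real n)\<^sup>2)" by (simp add: power2_eq_square)
    finally have "\<bar>e n - cos (\<phi> * ln z) / z\<bar> \<le> 3 * (1 / (real n)\<^sup>2)" .
    then have "\<phi> * \<bar>e n - cos (\<phi> * ln z) / z\<bar> \<le> 2 * (3 * (1 / (real n)\<^sup>2))"
      using \<phi> by (intro mult_mono) auto
    moreover have "\<bar>\<phi> * e n - (S (Suc n) - S n)\<bar> = \<phi> * \<bar>e n - cos (\<phi> * ln z) / z\<bar>"
      unfolding z(3) right_diff_distrib[symmetric] abs_mult using \<phi> by simp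
    ultimately show ?thesis by simp
  qed
  have "\<phi> * (\<Sum>n\<in>{M<..N}. e n) = (\<Sum>n\<in>{M<..N}. \<phi> * e n - (S (Suc n) - S n)) - (\<Sum>n\<in>{M<..<Suc N}. S n - S (Suc n))"
  proof -
    have "{M<..<Suc N} = {M<..N}" by auto
    then show ?thesis by (simp add: sum_distrib_left sum_subtractf)
  qed
  also have "(\<Sum>n\<in>{M<..<Suc N}. S n - S (Suc n)) = S (Suc M) - S (Suc N)"
    using True by (intro sum_telescope_greaterThanLessThan) auto
  also have "\<bar>(\<Sum>n\<in>{M<..N}. \<phi> * e n - (S (Suc n) - S n)) - (S (Suc M) - S (Suc N))\<bar>
      \<le> (\<Sum>n\<in>{M<..N}. \<bar>\<phi> * e n - (S (Suc n) - S n)\<bar>) + (1 + 1)"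
  proof -
    have "\<bar>\<Sum>n\<in>{M<..N}. \<phi> * e n - (S (Suc n) - S n)\<bar> \<le> (\<Sum>n\<in>{M<..N}. \<bar>\<phi> * e n - (S (Suc n) - S n)\<bar>)"
      by (rule sum_abs)
    moreover have "\<bar>S (Suc M)\<bar> \<le> 1" "\<bar>S (Suc N)\<bar> \<le> 1" by (simp_all add: S_def)
    ultimately show ?thesis by linarith
  qed
  also have "(\<Sum>n\<in>{M<..N}. \<bar>\<phi> * e n - (S (Suc n) - S n)\<bar>) \<le> (\<Sum>n\<in>{M<..N}. 6 * (1 / (real n)\<^sup>2))"
    by (intro sum_mono step) auto
  also have "\<dots> = 6 * (\<Sum>n\<in>{M<..N}. 1 / (real n)\<^sup>2)" by (simp add: sum_distrib_left)
  also have "\<dots> \<le> 6 * 2" by (intro mult_left_mono sum_inverse_squares_le) auto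
  finally have "\<phi> * \<bar>\<Sum>n\<in>{M<..N}. e n\<bar> \<le> 14" using \<phi> by (simp add: abs_mult)
  then show ?thesis using \<phi> unfolding e_def by (simp add: field_simps)
qed (use \<phi> in auto)


text \<open>
Replacing the primes by the integers costs the total variation of \<open>cos (\<phi> * ln n) / ln n\<close>, which is
\<open>O(1 + \<phi> * ln (ln N))\<close>. The remaining sum of \<open>cos (\<phi> * ln n) / (n * ln n)\<close> is
\<open>O(1 / (\<phi> * ln (Suc M)))\<close> by a second summation by parts.
\<close>
lemma sum_primes_cos_bounded:
  "\<exists>C. \<forall>\<phi> M N. 0 < \<phi> \<longrightarrow> \<phi> \<le> 2 \<longrightarrow> M \<ge> 1 \<longrightarrow> N \<ge> 2 \<longrightarrow> 1 \<le> \<phi> * ln (real (Suc M)) \<longrightarrow> \<phi> * ln (ln (real N)) \<le> 8 \<longrightarrow>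
     \<bar>\<Sum>p | prime p \<and> M < p \<and> p \<le> N. cos (\<phi> * ln (real p)) / real p\<bar> \<le> C"
proof -
  obtain D where D: "\<And>M N. \<bar>\<Sum>n\<in>{M<..N}. prime_harm_diff n\<bar> \<le> D"
    using prime_harm_diff_partial_sums_bounded by blast
  have D0: "D \<ge> 0" using D[of 0 0] by simp
  define E where "E = \<bar>1 / (2 * ln (2::real)) - ln (ln 2)\<bar>"
  define C where "C = D * (1 / ln 2 + 8 + 2 * E) + 14"
  have "\<bar>\<Sum>p | prime p \<and> M < p \<and> p \<le> N. cos (\<phi> * ln (real p)) / real p\<bar> \<le> C"
    if \<phi>: "0 < \<phi>" "\<phi> \<le> 2" and M: "M \<ge> 1" and N2: "N \<ge> 2" and low: "1 \<le> \<phi> * ln (real (Suc M))"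
      and up: "\<phi> * ln (ln (real N)) \<le> 8" for \<phi> M N
  proof (cases "M < N")
    case False
    then have e: "{p. prime p \<and> M < p \<and> p \<le> N} = {}" by auto
    have "C \<ge> 0" unfolding C_def E_def using D0 by (intro add_nonneg_nonneg mult_nonneg_nonneg) auto
    then show ?thesis unfolding e by simp
  next
    case MN: True
    define G where "G = (\<lambda>n. 1 / ln (real n))"
    define c where "c = (\<lambda>n. cos (\<phi> * ln (real n)))"
    have Gpos: "G n > 0" if "n > M" for n unfolding G_def using that M by simp
    have Gdec: "G (Suc n) \<le> G n" if "n > M" for n
      unfolding G_def using inverse_ln_decreasing[of n] that M by simp
    have Gtel: "(\<Sum>n\<in>{M<..<N}. G n - G (Suc n)) = G (Suc M) - G N"
      using MN by (rule sum_telescope_greaterThanLessThan)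
    have GM: "G (Suc M) \<le> 1 / ln 2"
      unfolding G_def using M by (intro divide_left_mono) auto
    have cle: "\<bar>c n\<bar> \<le> 1" for n unfolding c_def by simp
    have "(\<Sum>p | prime p \<and> M < p \<and> p \<le> N. cos (\<phi> * ln (real p)) / real p)
        = (\<Sum>n\<in>{M<..N}. if prime n then c n / real n else 0)"
      unfolding c_def by (rule sum_primes_indicator)
    also have "\<dots> = (\<Sum>n\<in>{M<..N}. prime_harm_diff n * (c n * G n) + (c n / real n) * G n)"
    proof (intro sum.cong refl)
      fix n assume "n \<in> {M<..N}"
      then have "ln (real n) > 0" "real n > 0" using M by auto
      then show "(if prime n then c n / real n else 0) = prime_harm_diff n * (c n * G n) + (c n / real n) * G n"
        unfolding prime_harm_diff_def G_def by (simp add: field_simps)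
    qed
    also have "\<dots> = (\<Sum>n\<in>{M<..N}. prime_harm_diff n * (c n * G n)) + (\<Sum>n\<in>{M<..N}. (c n / real n) * G n)"
      by (rule sum.distrib)
    also have "\<bar>\<dots>\<bar> \<le> D * (1 / ln 2 + 8 + 2 * E) + 14"
    proof (rule order.trans[OF abs_triangle_ineq add_mono])
      have "\<bar>\<Sum>n\<in>{M<..N}. prime_harm_diff n * (c n * G n)\<bar>
         \<le> D * (\<bar>c N * G N\<bar> + (\<Sum>n\<in>{M<..<N}. \<bar>c (Suc n) * G (Suc n) - c n * G n\<bar>))"
        using MN D by (rule abel_summation_bound)
      also have "\<dots> \<le> D * (1 / ln 2 + 8 + 2 * E)"
      proof (rule mult_left_mono[OF _ D0])
        have "\<bar>c N * G N\<bar> \<le> 1 * G N"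
          unfolding abs_mult using cle Gpos[OF MN] by (intro mult_mono) auto
        moreover have "(\<Sum>n\<in>{M<..<N}. \<bar>c (Suc n) * G (Suc n) - c n * G n\<bar>)
           \<le> (\<Sum>n\<in>{M<..<N}. (G n - G (Suc n)) + \<phi> * (1 / (real n * ln (real n))))"
        proof (rule sum_mono)
          fix n assume "n \<in> {M<..<N}"
          then have n: "n > M" "n > 0" "n \<ge> 2" using M by auto
          have "c (Suc n) * G (Suc n) - c n * G n = c (Suc n) * (G (Suc n) - G n) + (c (Suc n) - c n) * G n"
            by (simp add: algebra_simps)
          also have "\<bar>\<dots>\<bar> \<le> \<bar>c (Suc n)\<bar> * \<bar>G (Suc n) - G n\<bar> + \<bar>c (Suc n) - c n\<bar> * \<bar>G n\<bar>"
            unfolding abs_mult[symmetric] by (rule abs_triangle_ineq)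
          also have "\<dots> \<le> 1 * (G n - G (Suc n)) + (\<phi> * (1 / real n)) * G n"
          proof (intro add_mono mult_mono)
            have "\<bar>c (Suc n) - c n\<bar> \<le> \<bar>\<phi> * ln (real (Suc n)) - \<phi> * ln (real n)\<bar>"
              unfolding c_def by (rule abs_cos_diff_le)
            also have "\<dots> = \<phi> * \<bar>ln (real (Suc n)) - ln (real n)\<bar>"
              unfolding right_diff_distrib[symmetric] abs_mult using \<phi> by simp
            also have "\<dots> \<le> \<phi> * (1 / real n)"
              using ln_Suc_minus_ln_bounds(2)[OF n(2)] n \<phi> by (intro mult_left_mono) auto
            finally show "\<bar>c (Suc n) - c n\<bar> \<le> \<phi> * (1 / real n)" .
          qed (use cle Gdec[OF n(1)] Gpos[OF n(1)] \<phi> in auto)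
          finally show "\<bar>c (Suc n) * G (Suc n) - c n * G n\<bar> \<le> (G n - G (Suc n)) + \<phi> * (1 / (real n * ln (real n)))"
            by (simp add: G_def)
        qed
        moreover have "\<dots> = (G (Suc M) - G N) + \<phi> * (\<Sum>n\<in>{M<..<N}. 1 / (real n * ln (real n)))"
          unfolding sum.distrib Gtel by (simp add: sum_distrib_left)
        moreover have "\<phi> * (\<Sum>n\<in>{M<..<N}. 1 / (real n * ln (real n))) \<le> 8 + 2 * E"
        proof -
          have "(\<Sum>n\<in>{M<..<N}. 1 / (real n * ln (real n))) \<le> (\<Sum>n\<in>{1<..N}. 1 / (real n * ln (real n)))"
            using M by (intro sum_mono2) auto
          also have "\<dots> \<le> ln (ln (real N)) - ln (ln 2) + 1 / (2 * ln 2)"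
            using N2 by (rule sum_inverse_n_ln_n_le)
          also have "\<dots> \<le> ln (ln (real N)) + E" unfolding E_def by linarith
          finally have "\<phi> * (\<Sum>n\<in>{M<..<N}. 1 / (real n * ln (real n))) \<le> \<phi> * (ln (ln (real N)) + E)"
            using \<phi> by (intro mult_left_mono) auto
          also have "\<dots> \<le> 8 + 2 * E"
            unfolding distrib_left using up \<phi> by (intro add_mono mult_right_mono) (auto simp: E_def)
          finally show ?thesis .
        qed
        ultimately show "\<bar>c N * G N\<bar> + (\<Sum>n\<in>{M<..<N}. \<bar>c (Suc n) * G (Suc n) - c n * G n\<bar>) \<le> 1 / ln 2 + 8 + 2 * E"
          using GM by linarith
      qed
      finally show "\<bar>\<Sum>n\<in>{M<..N}. prime_harm_diff n * (c n * G n)\<bar> \<le> D * (1 / ln 2 + 8 + 2 * E)" .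
      have "\<bar>\<Sum>n\<in>{M<..N}. c n / real n * G n\<bar> \<le> 14 / \<phi> * (\<bar>G N\<bar> + (\<Sum>n\<in>{M<..<N}. \<bar>G (Suc n) - G n\<bar>))"
        using MN sum_cos_ln_div_bounded[OF \<phi>] unfolding c_def by (intro abel_summation_bound) auto
      also have "(\<Sum>n\<in>{M<..<N}. \<bar>G (Suc n) - G n\<bar>) = (\<Sum>n\<in>{M<..<N}. G n - G (Suc n))"
      proof (intro sum.cong refl)
        fix n assume "n \<in> {M<..<N}"
        then have "G (Suc n) \<le> G n" by (intro Gdec) auto
        then show "\<bar>G (Suc n) - G n\<bar> = G n - G (Suc n)" by linarith
      qed
      also have "\<bar>G N\<bar> + (\<Sum>n\<in>{M<..<N}. G n - G (Suc n)) = G (Suc M)"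
        unfolding Gtel using Gpos[OF MN] by simp
      also have "14 / \<phi> * G (Suc M) \<le> 14"
        unfolding G_def using low \<phi> M by (simp add: field_simps)
      finally show "\<bar>\<Sum>n\<in>{M<..N}. c n / real n * G n\<bar> \<le> 14" .
    qed
    finally show ?thesis unfolding C_def .
  qed
  then show ?thesis by blast
qed

text \<open>
The triangle inequality reduces the claim to \<open>m = 1\<close>. With \<open>u = \<bar>1 + cis \<phi>\<bar>\<close> the right-hand side is then the
quadratic polynomial in \<open>u ^ 2\<close> that equals \<open>u\<close> at \<open>u = 2\<close> and touches \<open>u\<close> at \<open>u = 1\<close>. Its mean over \<open>\<phi>\<close> is
\<open>4/3\<close>, while that of \<open>u\<close> is \<open>4/\<pi>\<close>.
\<close>
lemma norm_one_plus_cis_le: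
  "norm (1 + of_nat m * cis \<phi>) \<le> (real m + 1 / 3) + (7 * cos \<phi> - cos (2 * \<phi>)) / 9" if "m \<ge> 1"
proof -
  define c where "c = cos \<phi>"
  have c: "-1 \<le> c" "c \<le> 1" by (simp_all add: c_def)
  have c2: "cos (2 * \<phi>) = 2 * c\<^sup>2 - 1" unfolding c_def by (rule cos_double_cos)
  have "(norm (1 + cis \<phi>))\<^sup>2 = (1 + cos \<phi>)\<^sup>2 + (sin \<phi>)\<^sup>2"
    by (simp add: cmod_power2)
  also have "\<dots> = 2 + 2 * c"
    unfolding c_def using sin_cos_squared_add[of \<phi>] by (simp add: power2_eq_square algebra_simps)
  finally have n: "(norm (1 + cis \<phi>))\<^sup>2 = 2 + 2 * c" .
  \<comment> \<open>The difference of the squares of both sides factors: \<open>c = - 1/2\<close> is the point of contact.\<close>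
  have "0 \<le> (2 * c + 1)\<^sup>2 * ((1 - c) * (7 - c))"
    using c by (intro mult_nonneg_nonneg) auto
  also have "\<dots> = (13 + 7 * c - 2 * c\<^sup>2)\<^sup>2 - 81 * (2 + 2 * c)"
    by (simp add: power2_eq_square algebra_simps)
  finally have "(norm (1 + cis \<phi>))\<^sup>2 \<le> ((13 + 7 * c - 2 * c\<^sup>2) / 9)\<^sup>2"
    unfolding n by (simp add: power_divide)
  moreover have "0 \<le> (13 + 7 * c - 2 * c\<^sup>2) / 9"
  proof -
    have "c\<^sup>2 \<le> 1" using c by (simp add: abs_square_le_1)
    then show ?thesis using c by simp
  qed
  ultimately have "norm (1 + cis \<phi>) \<le> (13 + 7 * c - 2 * c\<^sup>2) / 9"
    by (rule power2_le_imp_le)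
  moreover have "1 + of_nat m * cis \<phi> = (1 + cis \<phi>) + of_nat (m - 1) * cis \<phi>"
    using that by (simp add: of_nat_diff algebra_simps)
  then have "norm (1 + of_nat m * cis \<phi>) \<le> norm (1 + cis \<phi>) + norm (of_nat (m - 1) * cis \<phi>)"
    by (simp only: norm_triangle_ineq)
  moreover have "norm (of_nat (m - 1) * cis \<phi>) = real m - 1"
  proof -
    have "norm (of_nat (m - 1) * cis \<phi>) = real (m - 1)"
      by (simp only: norm_mult norm_cis norm_of_nat mult_1_right)
    then show ?thesis using that by (simp add: of_nat_diff)
  qed
  ultimately show ?thesis unfolding c2 c_def[symmetric] by (simp add: field_simps)
qed

lemma norm_one_plus_cis_trivial: "norm (1 + of_nat m * cis \<phi>) \<le> real m + 1"
proof -
  have "norm (1 + of_nat m * cis \<phi>) \<le> norm (1 :: complex) + norm (of_nat m * cis \<phi>)" by (rule norm_triangle_ineq)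
  then show ?thesis by (simp add: norm_mult)
qed

text \<open>
Up to \<open>exp (1 / \<theta>)\<close> the trivial bound \<open>m + 1\<close> is used; beyond, the cosines in \<open>norm_one_plus_cis_le\<close> contribute
\<open>O(1)\<close> and only the mean \<open>m + 1/3\<close> remains. The excess \<open>2/3\<close> on the first range produces \<open>2/3 * ln (1 / \<theta>)\<close>.
\<close>
lemma sum_primes_norm_twist_bounds:
  assumes m: "m \<ge> 1"
  shows "\<exists>C. \<forall>N \<theta>. N \<ge> 2 \<longrightarrow>
    (\<Sum>p | prime p \<and> p \<le> N. norm (1 + of_nat m * cis (\<theta> * ln (real p))) / real p) \<le> (real m + 1) * ln (ln (real N)) + C \<and>
    (0 < \<theta> \<longrightarrow> \<theta> \<le> 1 \<longrightarrow> \<theta> * ln (ln (real N)) \<le> 4 \<longrightarrow>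
     (\<Sum>p | prime p \<and> p \<le> N. norm (1 + of_nat m * cis (\<theta> * ln (real p))) / real p)
       \<le> (real m + 1 / 3) * ln (ln (real N)) + 2 / 3 * ln (1 / \<theta>) + C)"
proof -
  obtain C1 where C1: "\<And>N. N \<ge> 2 \<Longrightarrow> (\<Sum>p | prime p \<and> p \<le> N. 1 / real p) \<le> ln (ln (real N)) + C1"
    using mertens_second_upper by blast
  obtain C2 where C2: "\<And>\<phi> M N. 0 < \<phi> \<Longrightarrow> \<phi> \<le> 2 \<Longrightarrow> M \<ge> 1 \<Longrightarrow> N \<ge> 2 \<Longrightarrow> 1 \<le> \<phi> * ln (real (Suc M)) \<Longrightarrow> \<phi> * ln (ln (real N)) \<le> 8 \<Longrightarrow>
     \<bar>\<Sum>p | prime p \<and> M < p \<and> p \<le> N. cos (\<phi> * ln (real p)) / real p\<bar> \<le> C2"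
    using sum_primes_cos_bounded by blast
  define C where "C = (real m + 2) * \<bar>C1\<bar> + \<bar>C2\<bar>"
  have triv: "(\<Sum>p | prime p \<and> p \<le> N. norm (1 + of_nat m * cis (\<theta> * ln (real p))) / real p) \<le> (real m + 1) * ln (ln (real N)) + C"
    if N: "N \<ge> 2" for N \<theta>
  proof -
    have "(\<Sum>p | prime p \<and> p \<le> N. norm (1 + of_nat m * cis (\<theta> * ln (real p))) / real p) \<le> (\<Sum>p | prime p \<and> p \<le> N. (real m + 1) * (1 / real p))"
      by (rule sum_mono) (simp add: divide_right_mono norm_one_plus_cis_trivial)
    also have "\<dots> = (real m + 1) * (\<Sum>p | prime p \<and> p \<le> N. 1 / real p)"
      by (simp add: sum_distrib_left)
    also have "\<dots> \<le> (real m + 1) * (ln (ln (real N)) + \<bar>C1\<bar>)"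
      using C1[OF N] by (intro mult_left_mono) auto
    also have "\<dots> \<le> (real m + 1) * ln (ln (real N)) + C"
      unfolding C_def by (simp add: algebra_simps)
    finally show ?thesis .
  qed
  have "(\<Sum>p | prime p \<and> p \<le> N. norm (1 + of_nat m * cis (\<theta> * ln (real p))) / real p)
       \<le> (real m + 1 / 3) * ln (ln (real N)) + 2 / 3 * ln (1 / \<theta>) + C"
    if N: "N \<ge> 2" and \<theta>: "0 < \<theta>" "\<theta> \<le> 1" "\<theta> * ln (ln (real N)) \<le> 4" for N \<theta>
  proof (cases "ln (real N) \<le> 1 / \<theta>")
    case True
    moreover have "ln (real N) > 0" using N by simp
    ultimately have "ln (ln (real N)) \<le> ln (1 / \<theta>)" using \<theta> by (subst ln_le_cancel_iff) auto
    then have "(real m + 1) * ln (ln (real N)) \<le> (real m + 1 / 3) * ln (ln (real N)) + 2 / 3 * ln (1 / \<theta>)"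
      by (simp add: algebra_simps)
    with triv[OF N, of \<theta>] show ?thesis by linarith
  next
    case False
    define W where "W = nat \<lfloor>exp (1 / \<theta>)\<rfloor>"
    have "1 + 1 \<le> 1 / \<theta> + 1" using \<theta> by (simp add: field_simps)
    also have "\<dots> \<le> exp (1 / \<theta>)" by (simp add: add.commute)
    finally have e2: "2 \<le> exp (1 / \<theta>)" by simp
    then have W: "W \<ge> 2" "real W \<le> exp (1 / \<theta>)" "exp (1 / \<theta>) < real (Suc W)"
      unfolding W_def by linarith+
    have lnW: "ln (real W) \<le> 1 / \<theta>" "1 / \<theta> < ln (real (Suc W))"
    proof -
      have "ln (real W) \<le> ln (exp (1 / \<theta>))" using W by (subst ln_le_cancel_iff) auto
      then show "ln (real W) \<le> 1 / \<theta>" by simp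
      have "ln (exp (1 / \<theta>)) < ln (real (Suc W))" using W by (subst ln_less_cancel_iff) auto
      then show "1 / \<theta> < ln (real (Suc W))" by simp
    qed
    have "exp (1 / \<theta>) < real N"
    proof -
      have "exp (1 / \<theta>) < exp (ln (real N))" using False by simp
      then show ?thesis using N by simp
    qed
    then have WN: "W \<le> N" using W by linarith
    define T where "T = (\<lambda>p. (7 * cos (\<theta> * ln (real p)) - cos (2 * (\<theta> * ln (real p)))) / 9)"
    have T6: "T p \<le> 2 / 3" for p
    proof -
      define c where "c = cos (\<theta> * ln (real p))"
      have c: "c \<le> 1" "-1 \<le> c" by (simp_all add: c_def)
      have "0 \<le> (1 - c) * (5 - 2 * c)" using c by (intro mult_nonneg_nonneg) auto
      then have "7 * c - (2 * c\<^sup>2 - 1) \<le> 6" by (simp add: power2_eq_square algebra_simps)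
      then show ?thesis unfolding T_def cos_double_cos c_def[symmetric] by simp
    qed
    have "(\<Sum>p | prime p \<and> p \<le> N. norm (1 + of_nat m * cis (\<theta> * ln (real p))) / real p)
       \<le> (\<Sum>p | prime p \<and> p \<le> N. (real m + 1 / 3) * (1 / real p) + T p / real p)"
    proof (rule sum_mono)
      fix p
      have "norm (1 + of_nat m * cis (\<theta> * ln (real p))) / real p \<le> ((real m + 1 / 3) + T p) / real p"
        unfolding T_def using m by (intro divide_right_mono norm_one_plus_cis_le) auto
      then show "norm (1 + of_nat m * cis (\<theta> * ln (real p))) / real p \<le> (real m + 1 / 3) * (1 / real p) + T p / real p"
        by (simp add: add_divide_distrib)
    qed
    also have "\<dots> = (real m + 1 / 3) * (\<Sum>p | prime p \<and> p \<le> N. 1 / real p) + (\<Sum>p | prime p \<and> p \<le> N. T p / real p)"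
      by (simp add: sum.distrib sum_distrib_left)
    also have "{p. prime p \<and> p \<le> N} = {p. prime p \<and> p \<le> W} \<union> {p. prime p \<and> W < p \<and> p \<le> N}"
      using WN by auto
    also have "(\<Sum>p\<in>\<dots>. T p / real p) = (\<Sum>p | prime p \<and> p \<le> W. T p / real p) + (\<Sum>p | prime p \<and> W < p \<and> p \<le> N. T p / real p)"
    proof (rule sum.union_disjoint)
      show "finite {p. prime p \<and> W < p \<and> p \<le> N}"
        by (rule finite_subset[OF _ finite_primes_upto[of N]]) auto
    qed (auto simp: finite_primes_upto)
    also have "{p. prime p \<and> p \<le> W} \<union> {p. prime p \<and> W < p \<and> p \<le> N} = {p. prime p \<and> p \<le> N}"
      using WN by auto
    also have "(real m + 1 / 3) * (\<Sum>p | prime p \<and> p \<le> N. 1 / real p) \<le> (real m + 1 / 3) * (ln (ln (real N)) + \<bar>C1\<bar>)"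
      using C1[OF N] by (intro mult_left_mono) auto
    also have "(\<Sum>p | prime p \<and> p \<le> W. T p / real p) \<le> 2 / 3 * (ln (1 / \<theta>) + \<bar>C1\<bar>)"
    proof -
      have "(\<Sum>p | prime p \<and> p \<le> W. T p / real p) \<le> (\<Sum>p | prime p \<and> p \<le> W. 2 / 3 * (1 / real p))"
      proof (rule sum_mono)
        fix p
        have "T p / real p \<le> (2 / 3) / real p" by (intro divide_right_mono T6) auto
        then show "T p / real p \<le> 2 / 3 * (1 / real p)" by simp
      qed
      also have "\<dots> = 2 / 3 * (\<Sum>p | prime p \<and> p \<le> W. 1 / real p)" by (simp add: sum_distrib_left)
      also have "\<dots> \<le> 2 / 3 * (ln (ln (real W)) + \<bar>C1\<bar>)"
        using C1[OF W(1)] by (intro mult_left_mono) auto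
      also have "\<dots> \<le> 2 / 3 * (ln (1 / \<theta>) + \<bar>C1\<bar>)"
      proof -
        have "0 < ln (real W)" using W(1) by simp
        then have "ln (ln (real W)) \<le> ln (1 / \<theta>)" using lnW(1) \<theta> by (subst ln_le_cancel_iff) auto
        then show ?thesis by simp
      qed
      finally show ?thesis .
    qed
    also have "(\<Sum>p | prime p \<and> W < p \<and> p \<le> N. T p / real p) \<le> \<bar>C2\<bar>"
    proof -
      have w: "1 \<le> \<theta> * ln (real (Suc W))" using lnW(2) \<theta>(1) by (simp add: field_simps)
      have a: "\<bar>\<Sum>p | prime p \<and> W < p \<and> p \<le> N. cos (\<theta> * ln (real p)) / real p\<bar> \<le> C2"
        using W(1) N \<theta> w by (intro C2) auto
      have b: "\<bar>\<Sum>p | prime p \<and> W < p \<and> p \<le> N. cos ((2 * \<theta>) * ln (real p)) / real p\<bar> \<le> C2"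
        using W(1) N \<theta> w by (intro C2) auto
      have "(\<Sum>p | prime p \<and> W < p \<and> p \<le> N. T p / real p)
          = 7 / 9 * (\<Sum>p | prime p \<and> W < p \<and> p \<le> N. cos (\<theta> * ln (real p)) / real p)
            - 1 / 9 * (\<Sum>p | prime p \<and> W < p \<and> p \<le> N. cos ((2 * \<theta>) * ln (real p)) / real p)"
        unfolding sum_distrib_left sum_subtractf[symmetric] T_def
        by (intro sum.cong refl) (simp add: field_simps)
      then show ?thesis using a b by linarith
    qed
    finally have "(\<Sum>p | prime p \<and> p \<le> N. norm (1 + of_nat m * cis (\<theta> * ln (real p))) / real p)
      \<le> (real m + 1 / 3) * (ln (ln (real N)) + \<bar>C1\<bar>) + (2 / 3 * (ln (1 / \<theta>) + \<bar>C1\<bar>) + \<bar>C2\<bar>)"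
      by this simp_all
    moreover have "(real m + 1 / 3) * (ln (ln (real N)) + \<bar>C1\<bar>) + (2 / 3 * (ln (1 / \<theta>) + \<bar>C1\<bar>) + \<bar>C2\<bar>) + \<bar>C1\<bar>
      = (real m + 1 / 3) * ln (ln (real N)) + 2 / 3 * ln (1 / \<theta>) + C"
      unfolding C_def by (simp add: field_simps)
    ultimately show ?thesis by linarith
  qed
  with triv show ?thesis by blast
qed

section \<open>Divisors in a window and twisted divisor sums\<close>

definition tau_window :: "nat \<Rightarrow> nat \<Rightarrow> real \<Rightarrow> real \<Rightarrow> real" where
  "tau_window m n u v = (\<Sum>d | d dvd n \<and> u < real d \<and> real d \<le> v. real (piltz_tau m d))"

text \<open>
This is the modulus of the sum of \<open>\<tau>\<^sub>m(d) * d powr (\<i> * \<theta>)\<close> over the divisors of \<open>n\<close>.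
\<close>
definition twisted_tau :: "nat \<Rightarrow> real \<Rightarrow> nat \<Rightarrow> real" where
  "twisted_tau m \<theta> n = norm (\<Sum>d | d dvd n. of_nat (piltz_tau m d) * cis (\<theta> * ln (real d)))"

lemma tau_window_le:
  assumes "n > 0"
  shows "tau_window m n u v \<le> real (piltz_tau (Suc m) n)"
proof -
  have "tau_window m n u v \<le> (\<Sum>d | d dvd n. real (piltz_tau m d))"
    unfolding tau_window_def using assms by (intro sum_mono2) auto
  then show ?thesis using assms by (simp add: piltz_tau_Suc)
qed

text \<open>
A divisor of \<open>a * b\<close> in the window is \<open>d * e\<close> with \<open>e dvd b\<close>; for fixed \<open>e\<close> the factor \<open>d dvd a\<close> lies in the
window shifted by \<open>e\<close>.
\<close>
lemma tau_window_mult_le: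
  assumes ab: "a > 0" "b > 0"
    and W: "\<And>e. e dvd b \<Longrightarrow> tau_window m a (u / real e) (v / real e) \<le> W"
  shows "tau_window m (a * b) u v \<le> real (piltz_tau (Suc m) b) * W"
proof -
  have "tau_window m (a * b) u v
     \<le> (\<Sum>e | e dvd b. \<Sum>d | d dvd a \<and> (u < real (d * e) \<and> real (d * e) \<le> v). real (piltz_tau m (d * e)))"
    unfolding tau_window_def using ab by (rule sum_divisors_mult_le) simp
  also have "\<dots> \<le> (\<Sum>e | e dvd b. real (piltz_tau m e) * W)"
  proof (rule sum_mono)
    fix e assume "e \<in> {e. e dvd b}"
    then have e: "e dvd b" "e > 0" using ab by (auto intro: dvd_pos_nat)
    have "(\<Sum>d | d dvd a \<and> (u < real (d * e) \<and> real (d * e) \<le> v). real (piltz_tau m (d * e)))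
      \<le> (\<Sum>d | d dvd a \<and> (u < real (d * e) \<and> real (d * e) \<le> v). real (piltz_tau m e) * real (piltz_tau m d))"
    proof (rule sum_mono)
      fix d assume "d \<in> {d. d dvd a \<and> (u < real (d * e) \<and> real (d * e) \<le> v)}"
      then have "d > 0" using ab by (auto intro: dvd_pos_nat)
      then have "piltz_tau m (d * e) \<le> piltz_tau m e * piltz_tau m d"
        using piltz_tau_submult[of d e m] e by (simp add: mult.commute)
      then show "real (piltz_tau m (d * e)) \<le> real (piltz_tau m e) * real (piltz_tau m d)"
        by (metis of_nat_mono of_nat_mult)
    qed
    also have "(\<Sum>d | d dvd a \<and> (u < real (d * e) \<and> real (d * e) \<le> v). real (piltz_tau m e) * real (piltz_tau m d))
      = real (piltz_tau m e) * tau_window m a (u / real e) (v / real e)"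
    proof -
      have eq: "{d. d dvd a \<and> (u < real (d * e) \<and> real (d * e) \<le> v)} = {d. d dvd a \<and> u / real e < real d \<and> real d \<le> v / real e}"
        using e by (auto simp: field_simps)
      show ?thesis unfolding tau_window_def eq by (simp add: sum_distrib_left)
    qed
    also have "\<dots> \<le> real (piltz_tau m e) * W"
      using W[OF e(1)] by (intro mult_left_mono) auto
    finally show "(\<Sum>d | d dvd a \<and> (u < real (d * e) \<and> real (d * e) \<le> v). real (piltz_tau m (d * e))) \<le> real (piltz_tau m e) * W" .
  qed
  also have "\<dots> = real (piltz_tau (Suc m) b) * W"
    using ab by (simp add: piltz_tau_Suc sum_distrib_right)
  finally show ?thesis .
qed

text \<open>
All summands have real part at least \<open>cos 1 \<ge> 1/2\<close>.
\<close>
lemma fejer_kernel_lower: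
  fixes J :: nat
  assumes "J > 0" "\<And>j. j < J \<Longrightarrow> \<bar>real j * t\<bar> \<le> 1"
  shows "1 / 4 \<le> (norm (\<Sum>j<J. cis (real j * t)))\<^sup>2 / (real J)\<^sup>2"
proof -
  have "real J * (1 / 2) = (\<Sum>j<J. 1 / 2)" by simp
  also have "\<dots> \<le> (\<Sum>j<J. cos (real j * t))"
  proof (rule sum_mono)
    fix j assume "j \<in> {..<J}"
    then have "\<bar>real j * t\<bar> \<le> 1" using assms by auto
    moreover have "(1::real) \<le> pi / 3" using pi_gt3 by simp
    ultimately have "cos (pi / 3) \<le> cos \<bar>real j * t\<bar>"
      by (intro cos_monotone_0_pi_le) auto
    then show "1 / 2 \<le> cos (real j * t)" by (simp add: cos_60)
  qed
  also have "\<dots> = Re (\<Sum>j<J. cis (real j * t))" by simp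
  also have "\<dots> \<le> norm (\<Sum>j<J. cis (real j * t))" by (rule complex_Re_le_cmod)
  finally have "(real J * (1 / 2))\<^sup>2 \<le> (norm (\<Sum>j<J. cis (real j * t)))\<^sup>2"
    by (intro power_mono) auto
  then show ?thesis using assms(1) by (simp add: field_simps power2_eq_square)
qed

lemma twisted_tau_neg: "twisted_tau m (- \<theta>) n = twisted_tau m \<theta> n"
proof -
  have "(\<Sum>d | d dvd n. of_nat (piltz_tau m d) * cis (- \<theta> * ln (real d)))
      = cnj (\<Sum>d | d dvd n. of_nat (piltz_tau m d) * cis (\<theta> * ln (real d)))"
    by (simp add: cis_cnj)
  then show ?thesis unfolding twisted_tau_def by (simp only: complex_mod_cnj)
qed

lemma twisted_tau_nonneg: "0 \<le> twisted_tau m \<theta> n"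
  unfolding twisted_tau_def by simp

lemma twisted_tau_le:
  assumes "n > 0"
  shows "twisted_tau m \<theta> n \<le> real (piltz_tau (Suc m) n)"
proof -
  have "twisted_tau m \<theta> n \<le> (\<Sum>d | d dvd n. norm (of_nat (piltz_tau m d) * cis (\<theta> * ln (real d))))"
    unfolding twisted_tau_def by (rule norm_sum)
  also have "\<dots> = real (piltz_tau (Suc m) n)"
    using assms by (simp add: norm_mult piltz_tau_Suc)
  finally show ?thesis .
qed

lemma twisted_tau_1: "twisted_tau m \<theta> 1 = 1"
  unfolding twisted_tau_def by (simp add: piltz_tau_1)

lemma twisted_tau_mult_coprime:
  assumes ab: "a > 0" "b > 0" "coprime a b"
  shows "twisted_tau m \<theta> (a * b) = twisted_tau m \<theta> a * twisted_tau m \<theta> b"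
proof -
  define h where "h = (\<lambda>d. of_nat (piltz_tau m d) * cis (\<theta> * ln (real d)))"
  have "(\<Sum>d | d dvd a * b. h d) = (\<Sum>d | d dvd a. \<Sum>e | e dvd b. h (d * e))"
    using ab by (rule sum_divisors_coprime)
  also have "\<dots> = (\<Sum>d | d dvd a. \<Sum>e | e dvd b. h d * h e)"
  proof (intro sum.cong refl)
    fix d e assume "d \<in> {d. d dvd a}" "e \<in> {e. e dvd b}"
    then have de: "d > 0" "e > 0" "coprime d e"
      using ab dvd_pos_nat[of a d] dvd_pos_nat[of b e] coprime_divisors[of d a e b] by auto
    then have "piltz_tau m (d * e) = piltz_tau m d * piltz_tau m e"
      by (rule piltz_tau_mult_coprime)
    moreover have "\<theta> * ln (real (d * e)) = \<theta> * ln (real d) + \<theta> * ln (real e)"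
      using de by (simp add: ln_mult algebra_simps)
    ultimately show "h (d * e) = h d * h e"
      unfolding h_def by (simp add: cis_mult[symmetric])
  qed
  also have "\<dots> = (\<Sum>d | d dvd a. h d) * (\<Sum>e | e dvd b. h e)"
    by (simp add: sum_product)
  finally show ?thesis unfolding twisted_tau_def h_def by (simp add: norm_mult)
qed

lemma twisted_tau_prime:
  assumes "prime p"
  shows "twisted_tau m \<theta> p = norm (1 + of_nat m * cis (\<theta> * ln (real p)))"
proof -
  have "(\<Sum>d | d dvd p ^ 1. of_nat (piltz_tau m d) * cis (\<theta> * ln (real d)))
     = (\<Sum>i\<le>1. of_nat (piltz_tau m (p ^ i)) * cis (\<theta> * ln (real (p ^ i))))"
    using assms by (rule sum_divisors_prime_power)
  then show ?thesis unfolding twisted_tau_def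
    using assms by (simp add: piltz_tau_prime piltz_tau_1)
qed

text \<open>
The Fejer kernel \<open>\<bar>\<Sum>j<J. cis (j * t)\<bar> ^ 2 / J ^ 2\<close> at \<open>t = (ln d - ln u) / (J * L)\<close> is nonnegative everywhere and at
least \<open>1/4\<close> in the window. Expanding the square turns the sum over \<open>d\<close> into twisted divisor sums; the
position \<open>u\<close> of the window enters through factors of modulus 1 only, so the bound does not depend on it.
\<close>
lemma tau_window_le_twisted_tau:
  assumes J: "J > 0" and L: "L > 0" and n: "n > 0" and u: "0 < u" and v: "v \<le> u * exp L"
  shows "tau_window m n u v \<le> 8 / real J * (\<Sum>j<J. twisted_tau m (real j / (real J * L)) n)"
proof -
  define \<eta> where "\<eta> = 1 / (real J * L)"
  have \<eta>: "\<eta> > 0" unfolding \<eta>_def using J L by simp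
  define D where "D = (\<lambda>t. \<Sum>j<J. cis (real j * t))"
  define t where "t = (\<lambda>d. \<eta> * (ln (real d) - ln u))"
  have "tau_window m n u v \<le> (\<Sum>d | d dvd n \<and> u < real d \<and> real d \<le> v. real (piltz_tau m d) * (4 * ((norm (D (t d)))\<^sup>2 / (real J)\<^sup>2)))"
    unfolding tau_window_def
  proof (rule sum_mono)
    fix d assume "d \<in> {d. d dvd n \<and> u < real d \<and> real d \<le> v}"
    then have d: "u < real d" "real d \<le> u * exp L" using v by auto
    have l1: "0 \<le> ln (real d) - ln u" using d u by simp
    have "ln (real d) \<le> ln (u * exp L)" using d u by (subst ln_le_cancel_iff) auto
    then have l2: "ln (real d) - ln u \<le> L" using u by (simp add: ln_mult)
    have "1 / 4 \<le> (norm (D (t d)))\<^sup>2 / (real J)\<^sup>2"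
      unfolding D_def
    proof (rule fejer_kernel_lower[OF J])
      fix j assume "j < J"
      then have "real j * (\<eta> * (ln (real d) - ln u)) \<le> real J * (\<eta> * L)"
        using l1 l2 \<eta> by (intro mult_mono) auto
      also have "\<dots> = 1" unfolding \<eta>_def using J L by simp
      finally show "\<bar>real j * t d\<bar> \<le> 1"
        unfolding t_def using l1 \<eta> by (simp add: abs_mult)
    qed
    then have "real (piltz_tau m d) * 1 \<le> real (piltz_tau m d) * (4 * ((norm (D (t d)))\<^sup>2 / (real J)\<^sup>2))"
      by (intro mult_left_mono) (auto simp: mult.commute)
    then show "real (piltz_tau m d) \<le> real (piltz_tau m d) * (4 * ((norm (D (t d)))\<^sup>2 / (real J)\<^sup>2))" by simp
  qed
  also have "\<dots> \<le> (\<Sum>d | d dvd n. real (piltz_tau m d) * (4 * ((norm (D (t d)))\<^sup>2 / (real J)\<^sup>2)))"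
    using n by (intro sum_mono2) auto
  also have "\<dots> = 4 / (real J)\<^sup>2 * (\<Sum>d | d dvd n. real (piltz_tau m d) * (norm (D (t d)))\<^sup>2)"
    by (simp add: sum_distrib_left mult_ac)
  also have "(\<Sum>d | d dvd n. real (piltz_tau m d) * (norm (D (t d)))\<^sup>2)
     \<le> (\<Sum>j<J. \<Sum>k<J. twisted_tau m ((real j - real k) * \<eta>) n)"
  proof -
    define X where "X = (\<Sum>d | d dvd n. of_nat (piltz_tau m d) * (D (t d) * cnj (D (t d))))"
    have "X = complex_of_real (\<Sum>d | d dvd n. real (piltz_tau m d) * (norm (D (t d)))\<^sup>2)"
      unfolding X_def by (simp add: complex_norm_square[symmetric])
    then have "norm X = \<bar>\<Sum>d | d dvd n. real (piltz_tau m d) * (norm (D (t d)))\<^sup>2\<bar>"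
      by (simp only: norm_of_real)
    then have "(\<Sum>d | d dvd n. real (piltz_tau m d) * (norm (D (t d)))\<^sup>2) \<le> norm X"
      by linarith
    also have "X = (\<Sum>d | d dvd n. \<Sum>j<J. \<Sum>k<J. of_nat (piltz_tau m d) * cis ((real j - real k) * t d))"
    proof -
      have "D x * cnj (D x) = (\<Sum>j<J. \<Sum>k<J. cis ((real j - real k) * x))" for x
        unfolding D_def cnj_sum sum_product
        by (intro sum.cong refl) (simp add: cis_cnj cis_mult algebra_simps)
      then show ?thesis unfolding X_def by (simp only: sum_distrib_left)
    qed
    also have "\<dots> = (\<Sum>j<J. \<Sum>k<J. \<Sum>d | d dvd n. of_nat (piltz_tau m d) * cis ((real j - real k) * t d))"
      by (rule trans[OF sum.swap sum.cong[OF refl sum.swap]])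
    also have "\<dots> = (\<Sum>j<J. \<Sum>k<J. cis (- ((real j - real k) * \<eta> * ln u)) *
         (\<Sum>d | d dvd n. of_nat (piltz_tau m d) * cis ((real j - real k) * \<eta> * ln (real d))))"
      unfolding sum_distrib_left t_def by (intro sum.cong refl) (simp add: cis_mult algebra_simps)
    also have "norm \<dots> \<le> (\<Sum>j<J. \<Sum>k<J. norm (cis (- ((real j - real k) * \<eta> * ln u)) *
         (\<Sum>d | d dvd n. of_nat (piltz_tau m d) * cis ((real j - real k) * \<eta> * ln (real d)))))"
      by (rule order.trans[OF norm_sum sum_mono[OF norm_sum]])
    also have "\<dots> = (\<Sum>j<J. \<Sum>k<J. twisted_tau m ((real j - real k) * \<eta>) n)"
      unfolding twisted_tau_def by (simp add: norm_mult)
    finally show ?thesis .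
  qed
  \<comment> \<open>Each frequency \<open>j - k\<close> is matched, up to sign, at most twice for fixed \<open>j\<close>.\<close>
  also have "(\<Sum>j<J. \<Sum>k<J. twisted_tau m ((real j - real k) * \<eta>) n)
     \<le> (\<Sum>j<J. 2 * (\<Sum>i<J. twisted_tau m (real i * \<eta>) n))"
  proof (rule sum_mono)
    fix j assume j: "j \<in> {..<J}"
    define w where "w = (\<lambda>i. twisted_tau m (real i * \<eta>) n)"
    have w0: "0 \<le> w i" for i unfolding w_def by (rule twisted_tau_nonneg)
    have "(\<Sum>k<J. twisted_tau m ((real j - real k) * \<eta>) n) \<le> (\<Sum>k\<in>{..j} \<union> {j..<J}. twisted_tau m ((real j - real k) * \<eta>) n)"
      by (intro sum_mono2) (auto simp: twisted_tau_nonneg)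
    also have "\<dots> \<le> (\<Sum>k\<in>{..j}. twisted_tau m ((real j - real k) * \<eta>) n) + (\<Sum>k\<in>{j..<J}. twisted_tau m ((real j - real k) * \<eta>) n)"
      by (subst sum_Un) (auto intro!: sum_nonneg twisted_tau_nonneg)
    also have "(\<Sum>k\<in>{..j}. twisted_tau m ((real j - real k) * \<eta>) n) = (\<Sum>k\<in>{..j}. w (j - k))"
      unfolding w_def by (intro sum.cong refl) (simp add: of_nat_diff)
    also have "\<dots> = sum w {..j}"
      by (rule sum.reindex_bij_witness[of _ "\<lambda>k. j - k" "\<lambda>k. j - k"]) auto
    also have "\<dots> \<le> sum w {..<J}" using j w0 by (intro sum_mono2) auto
    also have "(\<Sum>k\<in>{j..<J}. twisted_tau m ((real j - real k) * \<eta>) n) = (\<Sum>k\<in>{j..<J}. w (k - j))"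
    proof (intro sum.cong refl)
      fix k assume "k \<in> {j..<J}"
      then have "(real j - real k) * \<eta> = - (real (k - j) * \<eta>)" by (simp add: of_nat_diff algebra_simps)
      then show "twisted_tau m ((real j - real k) * \<eta>) n = w (k - j)"
        unfolding w_def by (simp only: twisted_tau_neg)
    qed
    also have "\<dots> = sum w {..<J - j}"
      by (rule sum.reindex_bij_witness[of _ "\<lambda>k. k + j" "\<lambda>k. k - j"]) auto
    also have "\<dots> \<le> sum w {..<J}" using w0 by (intro sum_mono2) auto
    finally show "(\<Sum>k<J. twisted_tau m ((real j - real k) * \<eta>) n) \<le> 2 * (\<Sum>i<J. twisted_tau m (real i * \<eta>) n)"
      unfolding w_def by simp
  qed
  also have "4 / (real J)\<^sup>2 * (\<Sum>j<J. 2 * (\<Sum>i<J. twisted_tau m (real i * \<eta>) n))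
     = 8 / real J * (\<Sum>i<J. twisted_tau m (real i * \<eta>) n)"
    using J by (simp add: power2_eq_square)
  finally show ?thesis using J by (simp add: \<eta>_def mult_left_mono divide_right_mono)
qed

text \<open>
Take the largest \<open>a \<le> Z\<close> among the divisors of \<open>n\<close> none of whose primes exceeds a prime of the cofactor, and the least
prime \<open>q\<close> of the cofactor: \<open>a * q\<close> is again such a divisor unless it exceeds \<open>Z\<close>.
\<close>
lemma smooth_rough_decomposition:
  fixes Z :: real
  assumes n: "n > 0" "real n > Z" and Z: "Z \<ge> 1"
  shows "\<exists>a b q. n = a * b \<and> a > 0 \<and> b > 0 \<and> real a \<le> Z \<and> prime q \<and> Z < real a * real q \<and>
    (\<forall>p. prime p \<longrightarrow> p dvd a \<longrightarrow> p \<le> q) \<and> (\<forall>p. prime p \<longrightarrow> p dvd b \<longrightarrow> q \<le> p)"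
proof -
  define S where "S = {a. a dvd n \<and> real a \<le> Z \<and> (\<forall>p q. prime p \<longrightarrow> prime q \<longrightarrow> p dvd a \<longrightarrow> q dvd n div a \<longrightarrow> p \<le> q)}"
  have fin: "finite S" unfolding S_def using n by (intro finite_subset[OF _ finite_divisors_nat[of n]]) auto
  have "1 \<in> S"
    using Z n by (auto simp: S_def not_prime_unit)
  define a where "a = Max S"
  have a: "a \<in> S" unfolding a_def using fin \<open>1 \<in> S\<close> by (intro Max_in) auto
  then have a_dvd: "a dvd n" and aZ: "real a \<le> Z"
    and sep: "\<And>p q. prime p \<Longrightarrow> prime q \<Longrightarrow> p dvd a \<Longrightarrow> q dvd n div a \<Longrightarrow> p \<le> q"
    unfolding S_def by blast+
  define b where "b = n div a"
  have nab: "n = a * b" unfolding b_def using a_dvd by simp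
  have pos: "a > 0" "b > 0" using n nab by (auto intro: Nat.gr0I)
  have "b \<noteq> 1" using nab aZ n by auto
  then have ex: "\<exists>q. prime q \<and> q dvd b" using prime_factor_nat by blast
  define q where "q = (LEAST q. prime q \<and> q dvd b)"
  have q: "prime q" "q dvd b" using LeastI_ex[OF ex] unfolding q_def by auto
  have q_le: "q \<le> p" if "prime p" "p dvd b" for p
    unfolding q_def using that by (intro Least_le) auto
  have q_ge: "p \<le> q" if "prime p" "p dvd a" for p
    using sep[OF that(1) q(1) that(2)] q(2) by (simp add: b_def)
  have "Z < real a * real q"
  proof (rule ccontr)
    assume "\<not> Z < real a * real q"
    then have le: "real (a * q) \<le> Z" by simp
    obtain c where c: "b = q * c" using q(2) by (auto simp: dvd_def)
    have q0: "q > 0" using q(1) by (rule prime_gt_0_nat)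
    have div: "n div (a * q) = c" unfolding nab c using pos q0 by simp
    have "a * q \<in> S"
      unfolding S_def
    proof (intro CollectI conjI allI impI)
      show "a * q dvd n" unfolding nab c by simp
      show "real (a * q) \<le> Z" by (rule le)
      fix p r assume p: "prime p" "p dvd a * q" and r: "prime r" "r dvd n div (a * q)"
      have "r dvd b" using r(2) unfolding div c by simp
      then have "q \<le> r" using r(1) q_le by blast
      moreover have "p \<le> q"
      proof -
        have "p dvd a \<or> p dvd q" using p by (simp add: prime_dvd_mult_iff)
        then show ?thesis
        proof
          assume "p dvd q"
          then show ?thesis using q0 by (rule dvd_imp_le)
        qed (use q_ge p in blast)
      qed
      ultimately show "p \<le> r" by simp
    qed
    then have "a * q \<le> a" unfolding a_def using fin by (intro Max_ge)
    moreover have "q \<ge> 2" using q(1) by (rule prime_ge_2_nat)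
    ultimately show False using pos by simp
  qed
  then show ?thesis using nab pos aZ q q_le q_ge by blast
qed

section \<open>Smooth numbers and Rankin's method\<close>

lemma poly_le_exp_bound:
  fixes \<eta> :: real
  assumes "\<eta> > 0"
  shows "\<exists>C\<ge>1. \<forall>k. (real k + 1) ^ M \<le> C * 2 powr (\<eta> * real k)"
proof -
  have "(\<lambda>k. (real k + 1) ^ M / 2 powr (\<eta> * real k)) \<longlonglongrightarrow> 0"
    using assms by real_asymp
  then have "Bseq (\<lambda>k. (real k + 1) ^ M / 2 powr (\<eta> * real k))"
    by (intro convergent_imp_Bseq convergentI)
  then obtain C where C: "\<And>k. norm ((real k + 1) ^ M / 2 powr (\<eta> * real k)) \<le> C"
    by (auto simp: Bseq_def)
  have "(real k + 1) ^ M \<le> max C 1 * 2 powr (\<eta> * real k)" for k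
  proof -
    have "(real k + 1) ^ M / 2 powr (\<eta> * real k) \<le> max C 1"
      using C[of k] by simp
    then show ?thesis by (simp add: field_simps)
  qed
  then show ?thesis by (intro exI[of _ "max C 1"]) auto
qed

text \<open>
Primes that are large in terms of \<open>M\<close> and \<open>\<eta>\<close> are covered by \<open>piltz_tau_le_rough\<close> with constant 1; each of
the finitely many others costs a constant factor.
\<close>
lemma piltz_tau_bound:
  fixes \<eta> :: real
  assumes "\<eta> > 0" "M > 0"
  shows "\<exists>C\<ge>0. \<forall>n>0. real (piltz_tau M n) \<le> C * real n powr \<eta>"
proof -
  \<comment> \<open>The 1 makes \<open>z > 1\<close> also for \<open>M = 1\<close>.\<close>
  define z where "z = exp (ln (real M) / \<eta> + 1)"
  have lnM: "ln (real M) \<ge> 0" using assms by simp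
  have z1: "z > 1" unfolding z_def using lnM assms by (simp add: add_nonneg_pos)
  obtain C1 where C1: "C1 \<ge> 1" "\<And>k. (real k + 1) ^ M \<le> C1 * 2 powr (\<eta> * real k)"
    using poly_le_exp_bound[OF assms(1)] by blast
  have key: "\<exists>C\<ge>0. \<forall>n>0. (\<forall>p. prime p \<longrightarrow> p dvd n \<longrightarrow> p \<in> P \<or> z \<le> real p) \<longrightarrow> real (piltz_tau M n) \<le> C * real n powr \<eta>"
    if "finite P" "\<And>p. p \<in> P \<Longrightarrow> prime p" for P
    using that
  proof (induction P rule: finite_induct)
    case empty
    have "real (piltz_tau M n) \<le> 1 * real n powr \<eta>"
      if n: "n > 0" and r: "\<And>p. prime p \<Longrightarrow> p dvd n \<Longrightarrow> z \<le> real p" for n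
    proof -
      have "real (piltz_tau M n) \<le> real n powr (ln (real M) / ln z)"
        using n z1 assms(2) r by (rule piltz_tau_le_rough)
      also have "\<dots> \<le> real n powr \<eta>"
      proof (rule powr_mono)
        have "ln (real M) \<le> \<eta> * (ln (real M) / \<eta> + 1)" using assms by (simp add: field_simps)
        then have "ln (real M) \<le> \<eta> * ln z" by (simp add: z_def)
        moreover have "ln z > 0" using z1 by simp
        ultimately show "ln (real M) / ln z \<le> \<eta>" by (simp add: field_simps)
      qed (use n in simp)
      finally show ?thesis by simp
    qed
    then show ?case by (intro exI[of _ 1]) auto
  next
    case (insert p P)
    then obtain C where C: "C \<ge> 0" "\<And>n. n > 0 \<Longrightarrow> (\<forall>p. prime p \<longrightarrow> p dvd n \<longrightarrow> p \<in> P \<or> z \<le> real p) \<Longrightarrow> real (piltz_tau M n) \<le> C * real n powr \<eta>"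
      by auto
    have p: "prime p" using insert by auto
    have p2: "real p \<ge> 2" using prime_ge_2_nat[OF p] by simp
    have "real (piltz_tau M n) \<le> (C1 * C) * real n powr \<eta>"
      if n: "n > 0" and r: "\<And>q. prime q \<Longrightarrow> q dvd n \<Longrightarrow> q \<in> insert p P \<or> z \<le> real q" for n
    proof -
      have "n \<noteq> 0" "\<not> is_unit p" using n not_prime_unit[of p] p by auto
      then obtain s where s: "n = p ^ multiplicity p n * s" "\<not> p dvd s"
        by (rule multiplicity_decompose')
      define k where "k = multiplicity p n"
      have ns: "n = p ^ k * s" using s(1) by (simp only: k_def)
      have s0: "s > 0" using n ns by (cases s) auto
      have pk: "p ^ k > 0" using p2 by simp
      have "real (piltz_tau M s) \<le> C * real s powr \<eta>"
      proof (rule C(2)[OF s0], intro allI impI)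
        fix q assume q: "prime q" "q dvd s"
        then have "q dvd n" unfolding ns by simp
        moreover have "q \<noteq> p" using q s(2) by auto
        ultimately show "q \<in> P \<or> z \<le> real q" using r[OF q(1)] by blast
      qed
      moreover have "real (piltz_tau M (p ^ k)) \<le> C1 * real (p ^ k) powr \<eta>"
      proof -
        have "real (piltz_tau M (p ^ k)) \<le> real ((k + 1) ^ M)"
          using piltz_tau_prime_power_le[OF p] by (rule of_nat_mono)
        also have "\<dots> \<le> C1 * 2 powr (\<eta> * real k)" using C1(2)[of k] by (simp add: add.commute)
        also have "\<dots> \<le> C1 * real p powr (\<eta> * real k)"
          using C1(1) p2 assms(1) by (intro mult_left_mono powr_mono2) auto
        also have "real p powr (\<eta> * real k) = real (p ^ k) powr \<eta>"
          using p2 by (simp add: powr_realpow[symmetric] powr_powr mult.commute)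
        finally show ?thesis .
      qed
      ultimately have "real (piltz_tau M (p ^ k)) * real (piltz_tau M s) \<le> (C1 * real (p ^ k) powr \<eta>) * (C * real s powr \<eta>)"
        using C1(1) by (intro mult_mono) auto
      also have "\<dots> = (C1 * C) * real n powr \<eta>"
        unfolding ns by (simp add: powr_mult)
      finally have "real (piltz_tau M (p ^ k)) * real (piltz_tau M s) \<le> (C1 * C) * real n powr \<eta>" .
      moreover have "real (piltz_tau M n) \<le> real (piltz_tau M (p ^ k)) * real (piltz_tau M s)"
        unfolding of_nat_mult[symmetric] ns using piltz_tau_submult[OF pk s0] by (rule of_nat_mono)
      ultimately show ?thesis by linarith
    qed
    then show ?case using C1(1) C(1) by (intro exI[of _ "C1 * C"]) auto
  qed
  have "\<exists>C\<ge>0. \<forall>n>0. (\<forall>p. prime p \<longrightarrow> p dvd n \<longrightarrow> p \<in> {p. prime p \<and> p \<le> nat \<lceil>z\<rceil>} \<or> z \<le> real p) \<longrightarrow> real (piltz_tau M n) \<le> C * real n powr \<eta>"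
    by (rule key[OF finite_primes_upto]) auto
  moreover have "p \<in> {p. prime p \<and> p \<le> nat \<lceil>z\<rceil>} \<or> z \<le> real p" if "prime p" for p
    using that by simp linarith
  ultimately show ?thesis by blast
qed

lemma prime_powr_half_le: "real p powr (-1/2) \<le> 3 / 4" if "prime p"
proof -
  have "real p powr (-1/2) \<le> 2 powr (-1/2)"
    using prime_ge_2_nat[OF that] by (intro powr_mono2') auto
  also have "\<dots> = 1 / sqrt 2" by (simp add: powr_minus powr_half_sqrt divide_simps)
  also have "\<dots> \<le> 3 / 4"
  proof -
    have "4 / 3 \<le> sqrt 2" by (rule real_le_rsqrt) (simp add: power2_eq_square)
    then show ?thesis by (simp add: field_simps)
  qed
  finally show ?thesis .
qed

lemma geometric_sum_le:
  fixes r :: real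
  assumes "0 \<le> r" "r \<le> 3 / 4" "finite K"
  shows "(\<Sum>k\<in>K. r ^ k) \<le> 4"
proof -
  have s: "summable (\<lambda>k. r ^ k)" using assms by (intro summable_geometric) auto
  have "(\<Sum>k\<in>K. r ^ k) \<le> (\<Sum>k. r ^ k)"
    using assms by (intro sum_le_suminf[OF s]) auto
  also have "\<dots> = 1 / (1 - r)" using assms by (intro suminf_geometric) auto
  also have "\<dots> \<le> 1 / (1 / 4)" using assms by (intro divide_left_mono) auto
  finally show ?thesis by simp
qed

lemma smooth_sum_powr_half_le:
  assumes "finite P" "\<And>p. p \<in> P \<Longrightarrow> prime p"
  shows "(\<Sum>a | 0 < a \<and> a \<le> N \<and> prime_factors a \<subseteq> P. real a powr (-1/2)) \<le> 4 ^ card P"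
proof -
  have "(\<Sum>a | 0 < a \<and> a \<le> N \<and> prime_factors a \<subseteq> P. real a powr (-1/2)) \<le> (\<Prod>p\<in>P. \<Sum>k\<le>N. real (p ^ k) powr (-1/2))"
    using assms by (intro euler_product_le) (auto simp: powr_mult)
  also have "\<dots> \<le> (\<Prod>p\<in>P. 4)"
  proof (intro prod_mono conjI sum_nonneg)
    fix p assume "p \<in> P"
    then have p: "prime p" using assms by auto
    have "(\<Sum>k\<le>N. real (p ^ k) powr (-1/2)) = (\<Sum>k\<le>N. (real p powr (-1/2)) ^ k)"
      using prime_gt_0_nat[OF p] by (intro sum.cong refl) (simp add: powr_realpow[symmetric] powr_powr mult.commute)
    also have "\<dots> \<le> 4" using prime_powr_half_le[OF p] by (intro geometric_sum_le) auto
    finally show "(\<Sum>k\<le>N. real (p ^ k) powr (-1/2)) \<le> 4" .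
  qed auto
  finally show ?thesis by simp
qed

text \<open>
In the Euler product the terms from squares of primes on are \<open>O(p powr (- 3/2))\<close> by the divisor bound and contribute a constant.
\<close>
lemma twisted_tau_rankin_sum:
  "\<exists>C>0. \<forall>\<theta> \<beta> N P. 0 \<le> \<beta> \<longrightarrow> \<beta> \<le> 1 / 8 \<longrightarrow> finite P \<longrightarrow> (\<forall>p\<in>P. prime p) \<longrightarrow>
     (\<Sum>a | 0 < a \<and> a \<le> N \<and> prime_factors a \<subseteq> P. twisted_tau m \<theta> a * real a powr (\<beta> - 1))
       \<le> C * exp (\<Sum>p\<in>P. twisted_tau m \<theta> p * real p powr (\<beta> - 1))"
proof -
  obtain C1 where C1: "C1 \<ge> 0" "\<And>n. n > 0 \<Longrightarrow> real (piltz_tau (Suc m) n) \<le> C1 * real n powr (1 / 8)"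
    using piltz_tau_bound[of "1 / 8" "Suc m"] by auto
  have summ: "summable (\<lambda>n. real n powr (-3/2))" by (subst summable_real_powr_iff) auto
  define S where "S = (\<Sum>n. real n powr (-3/2))"
  have "(\<Sum>a | 0 < a \<and> a \<le> N \<and> prime_factors a \<subseteq> P. twisted_tau m \<theta> a * real a powr (\<beta> - 1))
       \<le> exp (4 * C1 * S) * exp (\<Sum>p\<in>P. twisted_tau m \<theta> p * real p powr (\<beta> - 1))"
    if \<beta>: "0 \<le> \<beta>" "\<beta> \<le> 1 / 8" and P: "finite P" "\<forall>p\<in>P. prime p" for \<theta> \<beta> N P
  proof -
    define w where "w = (\<lambda>a. twisted_tau m \<theta> a * real a powr (\<beta> - 1))"
    have w0: "0 \<le> w a" for a unfolding w_def by (simp add: twisted_tau_nonneg)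
    have "(\<Sum>a | 0 < a \<and> a \<le> N \<and> prime_factors a \<subseteq> P. w a) \<le> (\<Prod>p\<in>P. \<Sum>k\<le>N. w (p ^ k))"
    proof (rule euler_product_le[OF P(1)])
      show "w 1 \<le> 1" unfolding w_def twisted_tau_1 by simp
      show "w (a * b) \<le> w a * w b" if "a > 0" "b > 0" "coprime a b" for a b
        unfolding w_def twisted_tau_mult_coprime[OF that] by (simp add: powr_mult)
    qed (use P w0 in auto)
    also have "\<dots> \<le> (\<Prod>p\<in>P. exp (w p + 4 * C1 * real p powr (-3/2)))"
    proof (intro prod_mono conjI sum_nonneg w0)
      fix p assume "p \<in> P"
      then have p: "prime p" using P by auto
      have p0: "real p > 0" using prime_gt_0_nat[OF p] by simp
      define r where "r = real p powr (-3/4)"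
      have r: "0 \<le> r" "r \<le> 3 / 4"
      proof -
        have "r \<le> real p powr (-1/2)" unfolding r_def using prime_ge_1_nat[OF p] by (intro powr_mono) auto
        then show "r \<le> 3 / 4" using prime_powr_half_le[OF p] by linarith
      qed (simp add: r_def)
      have wk: "w (p ^ k) \<le> C1 * r ^ k" for k
      proof -
        have pk: "p ^ k > 0" using prime_gt_0_nat[OF p] by simp
        have "w (p ^ k) \<le> (C1 * real (p ^ k) powr (1 / 8)) * real (p ^ k) powr (\<beta> - 1)"
          unfolding w_def using order.trans[OF twisted_tau_le[OF pk] C1(2)[OF pk]] by (intro mult_right_mono) auto
        also have "\<dots> = C1 * real (p ^ k) powr (1 / 8 + (\<beta> - 1))" by (simp only: powr_add mult.assoc)
        also have "\<dots> \<le> C1 * real (p ^ k) powr (-3/4)"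
        proof -
          have "1 \<le> real (p ^ k)" using pk by linarith
          then show ?thesis using \<beta> C1(1) by (intro mult_left_mono powr_mono) auto
        qed
        also have "real (p ^ k) powr (-3/4) = r ^ k"
          unfolding r_def using p0 by (simp add: powr_realpow[symmetric] powr_powr mult.commute)
        finally show ?thesis .
      qed
      have "(\<Sum>k\<le>N. w (p ^ k)) \<le> (\<Sum>k\<in>{0, 1} \<union> {2..N}. w (p ^ k))"
        using w0 by (intro sum_mono2) auto
      also have "\<dots> = (\<Sum>k\<in>{0, 1}. w (p ^ k)) + (\<Sum>k\<in>{2..N}. w (p ^ k))"
        by (rule sum.union_disjoint) auto
      also have "(\<Sum>k\<in>{0, 1}. w (p ^ k)) = 1 + w p"
        using twisted_tau_1[of m \<theta>] by (simp add: w_def)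
      also have "(\<Sum>k\<in>{2..N}. w (p ^ k)) \<le> (\<Sum>k\<in>{2..N}. C1 * r\<^sup>2 * r ^ (k - 2))"
      proof (rule sum_mono)
        fix k assume "k \<in> {2..N}"
        then have "2 + (k - 2) = k" by (intro le_add_diff_inverse) auto
        then have "r ^ k = r\<^sup>2 * r ^ (k - 2)" by (metis power_add)
        then show "w (p ^ k) \<le> C1 * r\<^sup>2 * r ^ (k - 2)" using wk[of k] by simp
      qed
      also have "\<dots> = C1 * r\<^sup>2 * (\<Sum>k\<in>{2..N}. r ^ (k - 2))" by (simp add: sum_distrib_left)
      also have "(\<Sum>k\<in>{2..N}. r ^ (k - 2)) = (\<Sum>k\<in>(\<lambda>k. k - 2) ` {2..N}. r ^ k)"
        by (subst sum.reindex) (auto simp: inj_on_def)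
      also have "C1 * r\<^sup>2 * \<dots> \<le> C1 * r\<^sup>2 * 4"
        using r C1(1) by (intro mult_left_mono geometric_sum_le) auto
      also have "r\<^sup>2 = real p powr (-3/2)"
        unfolding r_def using p0 by (simp add: powr_realpow[symmetric] powr_powr flip: powr_numeral)
      finally have "(\<Sum>k\<le>N. w (p ^ k)) \<le> 1 + (w p + 4 * C1 * real p powr (-3/2))" by (simp add: algebra_simps)
      also have "\<dots> \<le> exp (w p + 4 * C1 * real p powr (-3/2))" by (rule exp_ge_add_one_self)
      finally show "(\<Sum>k\<le>N. w (p ^ k)) \<le> exp (w p + 4 * C1 * real p powr (-3/2))" .
    qed
    also have "\<dots> = exp (\<Sum>p\<in>P. w p + 4 * C1 * real p powr (-3/2))"
      using P(1) by (simp add: exp_sum)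
    also have "\<dots> = exp ((\<Sum>p\<in>P. w p) + 4 * C1 * (\<Sum>p\<in>P. real p powr (-3/2)))"
      by (simp add: sum.distrib sum_distrib_left)
    also have "\<dots> \<le> exp ((\<Sum>p\<in>P. w p) + 4 * C1 * S)"
    proof -
      have "(\<Sum>p\<in>P. real p powr (-3/2)) \<le> S"
        unfolding S_def by (intro sum_le_suminf[OF summ P(1)]) auto
      then have "4 * C1 * (\<Sum>p\<in>P. real p powr (-3/2)) \<le> 4 * C1 * S"
        using C1(1) by (intro mult_left_mono) auto
      then show ?thesis by simp
    qed
    also have "\<dots> = exp (4 * C1 * S) * exp (\<Sum>p\<in>P. w p)" by (simp add: exp_add)
    finally show ?thesis unfolding w_def .
  qed
  then show ?thesis by (intro exI[of _ "exp (4 * C1 * S)"]) auto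
qed

lemma twisted_tau_prime_le: "prime p \<Longrightarrow> twisted_tau m \<theta> p \<le> real m + 1"
  by (simp only: twisted_tau_prime norm_one_plus_cis_trivial)

text \<open>
The numbers \<open>a\<close> summed over are \<open>q\<close>-smooth with \<open>q ^ s \<le> Z\<close>, but exceed \<open>Z / q\<close>, which is at least \<open>Z powr (1 - 1 / s)\<close> if \<open>s \<ge> 1\<close>; such numbers
become rare as \<open>s\<close> grows. Rankin's trick inserts the factor
\<open>a powr \<beta> * exp (- c * (s - 1)) \<ge> 1\<close> with \<open>\<beta> = c * s / ln Z\<close>. On primes with \<open>p ^ s \<le> Z\<close> one has
\<open>p powr \<beta> \<le> exp c\<close>, so by Mertens the Euler product changes by a constant factor only.
\<close>
lemma rankin_smooth_prefix_sum:
  fixes c :: real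
  assumes c: "c > 0"
  shows "\<exists>C>0. \<forall>\<theta> Z s N. Z > 1 \<longrightarrow> 8 * c * real s \<le> ln Z \<longrightarrow> Z \<le> real N \<longrightarrow>
    (\<Sum>a | 0 < a \<and> real a \<le> Z \<and> (\<exists>q>0. real s * ln q \<le> ln Z \<and> Z < real a * q \<and> (\<forall>p. prime p \<longrightarrow> p dvd a \<longrightarrow> real p \<le> q)).
        twisted_tau m \<theta> a / real a)
     \<le> C * exp (- c * (real s - 1)) * exp (\<Sum>p | prime p \<and> p \<le> N. twisted_tau m \<theta> p / real p)"
proof -
  obtain C1 where C1: "C1 > 0" "\<And>\<theta> \<beta> N P. 0 \<le> \<beta> \<Longrightarrow> \<beta> \<le> 1 / 8 \<Longrightarrow> finite P \<Longrightarrow> (\<forall>p\<in>P. prime p) \<Longrightarrow>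
     (\<Sum>a | 0 < a \<and> a \<le> N \<and> prime_factors a \<subseteq> P. twisted_tau m \<theta> a * real a powr (\<beta> - 1))
       \<le> C1 * exp (\<Sum>p\<in>P. twisted_tau m \<theta> p * real p powr (\<beta> - 1))"
    using twisted_tau_rankin_sum[of m] by blast
  obtain C2 where C2: "\<And>N. N > 0 \<Longrightarrow> \<bar>(\<Sum>p | prime p \<and> p \<le> N. ln (real p) / real p) - ln (real N)\<bar> \<le> C2"
    using mertens_first by blast
  have C20: "C2 \<ge> 0" using C2[of 1] by linarith
  \<comment> \<open>\<open>exp R\<close> bounds the cost of replacing \<open>p powr \<beta>\<close> by 1 in the Euler product.\<close>
  define R where "R = (real m + 1) * exp c * (c + C2)"
  have "(\<Sum>a | 0 < a \<and> real a \<le> Z \<and> (\<exists>q>0. real s * ln q \<le> ln Z \<and> Z < real a * q \<and> (\<forall>p. prime p \<longrightarrow> p dvd a \<longrightarrow> real p \<le> q)).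
        twisted_tau m \<theta> a / real a)
     \<le> (C1 * exp R) * exp (- c * (real s - 1)) * exp (\<Sum>p | prime p \<and> p \<le> N. twisted_tau m \<theta> p / real p)"
    if Z: "Z > 1" and s: "8 * c * real s \<le> ln Z" and N: "Z \<le> real N" for \<theta> Z s N
  proof -
    have lnZ: "ln Z > 0" using Z by simp
    define \<beta> where "\<beta> = c * real s / ln Z"
    have \<beta>: "0 \<le> \<beta>" "\<beta> \<le> 1 / 8" unfolding \<beta>_def using c s lnZ by (auto simp: field_simps)
    define P where "P = {p. prime p \<and> real p \<le> Z \<and> real s * ln (real p) \<le> ln Z}"
    have PN: "P \<subseteq> {p. prime p \<and> p \<le> N}" unfolding P_def using N by auto
    then have finP: "finite P" by (rule finite_subset) (rule finite_primes_upto)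
    define A where "A = {a. 0 < a \<and> real a \<le> Z \<and> (\<exists>q>0. real s * ln q \<le> ln Z \<and> Z < real a * q \<and> (\<forall>p. prime p \<longrightarrow> p dvd a \<longrightarrow> real p \<le> q))}"
    have AP: "A \<subseteq> {a. 0 < a \<and> a \<le> N \<and> prime_factors a \<subseteq> P}"
    proof
      fix a assume "a \<in> A"
      then obtain q where a: "0 < a" "real a \<le> Z" and q: "q > 0" "real s * ln q \<le> ln Z" "\<And>p. prime p \<Longrightarrow> p dvd a \<Longrightarrow> real p \<le> q"
        unfolding A_def by blast
      have "p \<in> P" if "p \<in> prime_factors a" for p
      proof -
        have p: "prime p" "p dvd a" using that by (auto simp: in_prime_factors_iff)
        have "p \<le> a" using p(2) a(1) by (rule dvd_imp_le)
        then have "real p \<le> Z" using a(2) by linarith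
        moreover have "ln (real p) \<le> ln q" using q(3)[OF p] q(1) prime_gt_0_nat[OF p(1)] by simp
        then have "real s * ln (real p) \<le> ln Z" using q(2) mult_left_mono[of "ln (real p)" "ln q" "real s"] by linarith
        ultimately show ?thesis using p(1) unfolding P_def by simp
      qed
      moreover have "a \<le> N" using a(2) N by linarith
      ultimately show "a \<in> {a. 0 < a \<and> a \<le> N \<and> prime_factors a \<subseteq> P}" using a(1) by blast
    qed
    have finA: "finite {a. 0 < a \<and> a \<le> N \<and> prime_factors a \<subseteq> P}" by (rule finite_subset[of _ "{..N}"]) auto
    have "(\<Sum>a\<in>A. twisted_tau m \<theta> a / real a) \<le> (\<Sum>a\<in>A. exp (- c * (real s - 1)) * (twisted_tau m \<theta> a * real a powr (\<beta> - 1)))"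
    proof (rule sum_mono)
      fix a assume "a \<in> A"
      then obtain q where a: "0 < a" and q: "q > 0" "real s * ln q \<le> ln Z" "Z < real a * q"
        unfolding A_def by blast
      have "ln Z \<le> ln (real a * q)" using q a Z by (subst ln_le_cancel_iff) auto
      also have "\<dots> = ln (real a) + ln q" using a q by (simp add: ln_mult)
      finally have "real s * ln Z \<le> real s * (ln (real a) + ln q)" by (intro mult_left_mono) auto
      then have "(real s - 1) * ln Z \<le> real s * ln (real a)" using q(2) by (simp add: algebra_simps)
      then have "c * ((real s - 1) * ln Z) \<le> c * (real s * ln (real a))" using c by (intro mult_left_mono) auto
      then have "c * (real s - 1) \<le> \<beta> * ln (real a)"
        unfolding \<beta>_def using lnZ by (simp add: field_simps)
      then have "exp (c * (real s - 1)) \<le> real a powr \<beta>" using a by (simp add: powr_def)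
      then have "exp (- c * (real s - 1)) * exp (c * (real s - 1)) \<le> exp (- c * (real s - 1)) * real a powr \<beta>"
        by (intro mult_left_mono) auto
      then have "1 \<le> exp (- c * (real s - 1)) * real a powr \<beta>" by (simp flip: exp_add)
      then have "twisted_tau m \<theta> a / real a * 1 \<le> twisted_tau m \<theta> a / real a * (exp (- c * (real s - 1)) * real a powr \<beta>)"
        by (intro mult_left_mono) (auto simp: twisted_tau_nonneg)
      also have "\<dots> = exp (- c * (real s - 1)) * (twisted_tau m \<theta> a * real a powr (\<beta> - 1))"
        using a by (simp add: powr_diff)
      finally show "twisted_tau m \<theta> a / real a \<le> \<dots>" by simp
    qed
    also have "\<dots> = exp (- c * (real s - 1)) * (\<Sum>a\<in>A. twisted_tau m \<theta> a * real a powr (\<beta> - 1))"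
      by (simp add: sum_distrib_left)
    also have "(\<Sum>a\<in>A. twisted_tau m \<theta> a * real a powr (\<beta> - 1))
        \<le> (\<Sum>a | 0 < a \<and> a \<le> N \<and> prime_factors a \<subseteq> P. twisted_tau m \<theta> a * real a powr (\<beta> - 1))"
      using finA AP by (intro sum_mono2) (auto simp: twisted_tau_nonneg)
    also have "\<dots> \<le> C1 * exp (\<Sum>p\<in>P. twisted_tau m \<theta> p * real p powr (\<beta> - 1))"
      using \<beta> finP by (intro C1) (auto simp: P_def)
    also have "(\<Sum>p\<in>P. twisted_tau m \<theta> p * real p powr (\<beta> - 1)) \<le> (\<Sum>p | prime p \<and> p \<le> N. twisted_tau m \<theta> p / real p) + R"
    proof -
      have "(\<Sum>p\<in>P. twisted_tau m \<theta> p * real p powr (\<beta> - 1))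
         \<le> (\<Sum>p\<in>P. twisted_tau m \<theta> p / real p + (real m + 1) * exp c * \<beta> * (ln (real p) / real p))"
      proof (rule sum_mono)
        fix p assume "p \<in> P"
        then have p: "prime p" "real s * ln (real p) \<le> ln Z" by (auto simp: P_def)
        have p1: "real p \<ge> 1" using prime_ge_1_nat[OF p(1)] by simp
        define t where "t = \<beta> * ln (real p)"
        have "c * (real s * ln (real p)) \<le> c * ln Z" using p(2) c by (intro mult_left_mono) auto
        then have "t \<le> c" unfolding t_def \<beta>_def using lnZ by (simp add: field_simps)
        moreover have "0 \<le> t" unfolding t_def using \<beta> p1 by (intro mult_nonneg_nonneg) auto
        ultimately have t: "0 \<le> t" "t \<le> c" by auto
        have "1 + (- t) \<le> exp (- t)" by (rule exp_ge_add_one_self)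
        then have "exp t * (1 - t) \<le> exp t * exp (- t)" by (intro mult_left_mono) auto
        then have "exp t - 1 \<le> exp t * t" by (simp add: exp_minus algebra_simps)
        also have "\<dots> \<le> exp c * t" using t by (intro mult_right_mono) auto
        finally have "exp t - 1 \<le> exp c * t" .
        then have "twisted_tau m \<theta> p * (exp t - 1) \<le> (real m + 1) * (exp c * t)"
          using twisted_tau_prime_le[OF p(1), of m \<theta>] t by (intro mult_mono) auto
        then have "twisted_tau m \<theta> p * exp t / real p \<le> (twisted_tau m \<theta> p + (real m + 1) * (exp c * t)) / real p"
          using p1 by (intro divide_right_mono) (auto simp: algebra_simps)
        moreover have "real p powr (\<beta> - 1) = exp t / real p"
          unfolding t_def using p1 by (simp add: powr_diff) (simp add: powr_def)
        ultimately show "twisted_tau m \<theta> p * real p powr (\<beta> - 1) \<le> twisted_tau m \<theta> p / real p + (real m + 1) * exp c * \<beta> * (ln (real p) / real p)"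
          by (simp add: t_def add_divide_distrib mult_ac)
      qed
      also have "\<dots> = (\<Sum>p\<in>P. twisted_tau m \<theta> p / real p) + (real m + 1) * exp c * (\<beta> * (\<Sum>p\<in>P. ln (real p) / real p))"
        by (simp add: sum.distrib sum_distrib_left mult_ac)
      also have "(\<Sum>p\<in>P. twisted_tau m \<theta> p / real p) \<le> (\<Sum>p | prime p \<and> p \<le> N. twisted_tau m \<theta> p / real p)"
        using PN finite_primes_upto by (intro sum_mono2) (auto simp: twisted_tau_nonneg)
      also have "\<beta> * (\<Sum>p\<in>P. ln (real p) / real p) \<le> c + C2"
      proof (cases "s = 0")
        case True
        then show ?thesis using c C20 by (simp add: \<beta>_def)
      next
        case False
        define W where "W = nat \<lfloor>exp (ln Z / real s)\<rfloor>"
        have "exp (ln Z / real s) \<ge> 1" using lnZ by simp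
        then have W: "W > 0" "real W \<le> exp (ln Z / real s)" unfolding W_def by linarith+
        have "P \<subseteq> {p. prime p \<and> p \<le> W}"
        proof
          fix p assume "p \<in> P"
          then have p: "prime p" "real s * ln (real p) \<le> ln Z" by (auto simp: P_def)
          then have "ln (real p) \<le> ln Z / real s" using False by (simp add: field_simps)
          then have "exp (ln (real p)) \<le> exp (ln Z / real s)" by simp
          then have "real p \<le> exp (ln Z / real s)" using prime_gt_0_nat[OF p(1)] by simp
          then have "p \<le> W" unfolding W_def by (rule le_nat_floor)
          with p show "p \<in> {p. prime p \<and> p \<le> W}" by simp
        qed
        then have "(\<Sum>p\<in>P. ln (real p) / real p) \<le> (\<Sum>p | prime p \<and> p \<le> W. ln (real p) / real p)"
          using finite_primes_upto by (intro sum_mono2) (auto simp: prime_gt_0_nat Suc_le_eq)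
        also have "\<dots> \<le> ln (real W) + C2" using C2[OF W(1)] by linarith
        also have "ln (real W) \<le> ln (exp (ln Z / real s))" using W by (subst ln_le_cancel_iff) auto
        finally have "(\<Sum>p\<in>P. ln (real p) / real p) \<le> ln Z / real s + C2" by simp
        then have "\<beta> * (\<Sum>p\<in>P. ln (real p) / real p) \<le> \<beta> * (ln Z / real s + C2)"
          using \<beta> by (intro mult_left_mono) auto
        also have "\<dots> = c + \<beta> * C2" unfolding \<beta>_def using lnZ False by (simp add: field_simps)
        also have "\<dots> \<le> c + 1 * C2" using \<beta> C20 by (intro add_left_mono mult_right_mono) auto
        finally show ?thesis by simp
      qed
      finally show ?thesis unfolding R_def using c C20 by (simp add: mult_left_mono)
    qed
    finally have "(\<Sum>a\<in>A. twisted_tau m \<theta> a / real a)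
       \<le> exp (- c * (real s - 1)) * (C1 * exp ((\<Sum>p | prime p \<and> p \<le> N. twisted_tau m \<theta> p / real p) + R))"
      using C1(1) by simp
    then show ?thesis unfolding A_def by (simp add: exp_add mult_ac)
  qed
  moreover have "C1 * exp R > 0" using C1(1) by simp
  ultimately show ?thesis by blast
qed

section \<open>Averaging over the twist\<close>

lemma sum_powr_neg_le:
  fixes \<kappa> :: real
  assumes \<kappa>: "0 \<le> \<kappa>" "\<kappa> < 1"
  shows "(\<Sum>j\<in>{1..n}. real j powr (- \<kappa>)) \<le> real n powr (1 - \<kappa>) / (1 - \<kappa>)"
proof (induction n)
  case (Suc n)
  have "real (Suc n) powr (- \<kappa>) \<le> real (Suc n) powr (1 - \<kappa>) / (1 - \<kappa>) - real n powr (1 - \<kappa>) / (1 - \<kappa>)"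
  proof (cases "n = 0")
    case False
    have "\<exists>z. real n < z \<and> z < real (Suc n) \<and>
       real (Suc n) powr (1 - \<kappa>) / (1 - \<kappa>) - real n powr (1 - \<kappa>) / (1 - \<kappa>) = (real (Suc n) - real n) * (z powr (- \<kappa>))"
    proof (rule MVT2)
      fix x :: real assume "real n \<le> x"
      then have "x > 0" using False by linarith
      then have "((\<lambda>x. x powr (1 - \<kappa>)) has_real_derivative (1 - \<kappa>) * x powr (1 - \<kappa> - 1)) (at x)"
        by (rule has_real_derivative_powr)
      then have "((\<lambda>x. x powr (1 - \<kappa>) / (1 - \<kappa>)) has_real_derivative (1 - \<kappa>) * x powr (1 - \<kappa> - 1) / (1 - \<kappa>)) (at x)"
        by (rule DERIV_cdivide)
      then show "((\<lambda>x. x powr (1 - \<kappa>) / (1 - \<kappa>)) has_real_derivative x powr (- \<kappa>)) (at x)"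
        using \<kappa> by simp
    qed simp
    then obtain z where z: "real n < z" "z < real (Suc n)"
      "real (Suc n) powr (1 - \<kappa>) / (1 - \<kappa>) - real n powr (1 - \<kappa>) / (1 - \<kappa>) = z powr (- \<kappa>)" by auto
    have "real (Suc n) powr (- \<kappa>) \<le> z powr (- \<kappa>)" using z \<kappa> by (intro powr_mono2') auto
    with z(3) show ?thesis by simp
  qed (use \<kappa> in simp)
  with Suc show ?case by simp
qed simp

lemma ln_ln_le: "1 \<le> u \<Longrightarrow> ln u \<le> 4 * u powr (1/4)" for u :: real
  using ln_powr_bound[of u "1/4"] by simp

text \<open>
At \<open>\<theta> = j / (J * L)\<close> with \<open>L = (ln x) powr (1/4)\<close> and \<open>j \<ge> 1\<close>, the exponential is
\<open>O((ln x) powr (m + 1/3) * \<theta> powr (- 2/3))\<close>. The average of \<open>\<theta> powr (- 2/3)\<close> is \<open>O(L powr (2/3))\<close>, that is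
\<open>O((ln x) powr (1/6))\<close>. For \<open>j = 0\<close> the bound \<open>(ln x) powr (m + 1)\<close> is affordable because of the factor
\<open>1 / J \<le> 1 / ln x\<close>.
\<close>
lemma twisted_tau_average_bound:
  assumes m: "m \<ge> 1"
  shows "\<exists>C\<ge>0. \<forall>x J. x \<ge> exp 1 \<longrightarrow> ln x \<le> real J \<longrightarrow>
    8 / real J * (\<Sum>j<J. exp (\<Sum>p | prime p \<and> p \<le> nat \<lfloor>x\<rfloor>. twisted_tau m (real j / (real J * ln x powr (1/4))) p / real p))
     \<le> C * ln x powr (real m + 1/2)"
proof -
  obtain C where C: "\<And>N \<theta>. N \<ge> 2 \<Longrightarrow> (\<Sum>p | prime p \<and> p \<le> N. norm (1 + of_nat m * cis (\<theta> * ln (real p))) / real p) \<le> (real m + 1) * ln (ln (real N)) + C"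
    "\<And>N \<theta>. N \<ge> 2 \<Longrightarrow> 0 < \<theta> \<Longrightarrow> \<theta> \<le> 1 \<Longrightarrow> \<theta> * ln (ln (real N)) \<le> 4 \<Longrightarrow>
     (\<Sum>p | prime p \<and> p \<le> N. norm (1 + of_nat m * cis (\<theta> * ln (real p))) / real p)
       \<le> (real m + 1 / 3) * ln (ln (real N)) + 2 / 3 * ln (1 / \<theta>) + C"
    using sum_primes_norm_twist_bounds[OF m] by blast
  have "8 / real J * (\<Sum>j<J. exp (\<Sum>p | prime p \<and> p \<le> nat \<lfloor>x\<rfloor>. twisted_tau m (real j / (real J * ln x powr (1/4))) p / real p))
     \<le> (32 * exp C) * ln x powr (real m + 1/2)" if x: "x \<ge> exp 1" and J: "ln x \<le> real J" for x J
  proof -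
    define N where "N = nat \<lfloor>x\<rfloor>"
    define l where "l = ln x"
    define L where "L = l powr (1/4)"
    define \<theta> where "\<theta> = (\<lambda>j. real j / (real J * L))"
    define E where "E = (\<lambda>j. exp (\<Sum>p | prime p \<and> p \<le> N. twisted_tau m (\<theta> j) p / real p))"
    have "x \<ge> 2" using x exp_ge_add_one_self[of "1::real"] by linarith
    then have N: "N \<ge> 2" "real N \<le> x" unfolding N_def by linarith+
    have "ln (exp 1) \<le> ln x" using x \<open>x \<ge> 2\<close> by (subst ln_le_cancel_iff) auto
    then have l1: "l \<ge> 1" unfolding l_def by simp
    have L1: "L \<ge> 1" unfolding L_def using l1 by (intro ge_one_powr_ge_zero) auto
    have J0: "real J \<ge> 1" using J l1 unfolding l_def by linarith
    have lnN: "0 < ln (real N)" "ln (real N) \<le> l"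
      unfolding l_def using N by auto
    have lln: "ln (ln (real N)) \<le> ln l" using lnN l1 by (subst ln_le_cancel_iff) auto
    have sum_eq: "(\<Sum>p | prime p \<and> p \<le> N. twisted_tau m t p / real p) = (\<Sum>p | prime p \<and> p \<le> N. norm (1 + of_nat m * cis (t * ln (real p))) / real p)" for t
      by (intro sum.cong refl) (simp add: twisted_tau_prime)
    have E0: "E 0 \<le> exp C * l powr (real m + 1)"
    proof -
      have "(\<Sum>p | prime p \<and> p \<le> N. twisted_tau m (\<theta> 0) p / real p) \<le> (real m + 1) * ln (ln (real N)) + C"
        unfolding sum_eq using N(1) by (rule C(1))
      also have "\<dots> \<le> (real m + 1) * ln l + C" using lln by (intro add_mono mult_left_mono) auto
      finally have "E 0 \<le> exp ((real m + 1) * ln l + C)" unfolding E_def by simp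
      also have "\<dots> = exp C * l powr (real m + 1)" using l1 by (simp add: exp_add powr_def mult.commute)
      finally show ?thesis .
    qed
    have Ej: "E j \<le> exp C * l powr (real m + 1/3) * (real J * L) powr (2/3) * real j powr (-2/3)" if j: "j \<in> {1..J}" for j
    proof -
      have JL: "real J * L > 0" using J0 L1 by (intro mult_pos_pos) auto
      have \<theta>0: "0 < \<theta> j" unfolding \<theta>_def using j JL by simp
      have "\<theta> j \<le> real J / (real J * L)" unfolding \<theta>_def using j JL by (intro divide_right_mono) auto
      also have "\<dots> = 1 / L" using J0 by simp
      finally have \<theta>L: "\<theta> j \<le> 1 / L" .
      also have "1 / L \<le> 1" using L1 by simp
      finally have \<theta>1: "\<theta> j \<le> 1" .
      have \<theta>4: "\<theta> j * ln (ln (real N)) \<le> 4"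
      proof -
        have "\<theta> j * ln (ln (real N)) \<le> \<theta> j * ln l" using lln \<theta>0 by (intro mult_left_mono) auto
        also have "\<dots> \<le> 1 / L * (4 * L)" unfolding L_def
          using \<theta>L ln_ln_le[OF l1] l1 \<theta>0 unfolding L_def by (intro mult_mono) auto
        also have "\<dots> = 4" using L1 by simp
        finally show ?thesis .
      qed
      have "(\<Sum>p | prime p \<and> p \<le> N. twisted_tau m (\<theta> j) p / real p) \<le> (real m + 1/3) * ln (ln (real N)) + 2 / 3 * ln (1 / \<theta> j) + C"
        unfolding sum_eq using N(1) \<theta>0 \<theta>1 \<theta>4 by (rule C(2))
      also have "\<dots> \<le> (real m + 1/3) * ln l + 2 / 3 * ln (1 / \<theta> j) + C" using lln by (intro add_mono mult_left_mono) auto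
      finally have "E j \<le> exp ((real m + 1/3) * ln l + 2 / 3 * ln (1 / \<theta> j) + C)" unfolding E_def by simp
      also have "\<dots> = exp C * l powr (real m + 1/3) * (1 / \<theta> j) powr (2/3)"
        using l1 \<theta>0 by (simp add: exp_add powr_def mult.commute)
      also have "(1 / \<theta> j) powr (2/3) = (real J * L) powr (2/3) * real j powr (-2/3)"
      proof -
        have "1 / \<theta> j = (real J * L) * (1 / real j)" unfolding \<theta>_def by simp
        then have "(1 / \<theta> j) powr (2/3) = (real J * L) powr (2/3) * (1 / real j) powr (2/3)"
          using JL by (simp only: powr_mult)
        moreover have "(1 / real j) powr (2/3) = real j powr (-2/3)"
          using j by (simp add: powr_minus powr_divide field_simps)
        ultimately show ?thesis by simp
      qed
      finally show ?thesis by simp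
    qed
    have "(\<Sum>j<J. E j) \<le> (\<Sum>j\<in>insert 0 {1..J}. E j)" by (intro sum_mono2) (auto simp: E_def)
    also have "\<dots> = E 0 + (\<Sum>j\<in>{1..J}. E j)" by simp
    also have "\<dots> \<le> exp C * l powr (real m + 1) + (\<Sum>j\<in>{1..J}. exp C * l powr (real m + 1/3) * (real J * L) powr (2/3) * real j powr (-2/3))"
      by (intro add_mono E0 sum_mono Ej)
    also have "(\<Sum>j\<in>{1..J}. exp C * l powr (real m + 1/3) * (real J * L) powr (2/3) * real j powr (-2/3))
       = exp C * l powr (real m + 1/3) * (real J * L) powr (2/3) * (\<Sum>j\<in>{1..J}. real j powr (-2/3))"
      by (simp add: sum_distrib_left)
    also have "\<dots> \<le> exp C * l powr (real m + 1/3) * (real J * L) powr (2/3) * (3 * real J powr (1/3))"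
      using sum_powr_neg_le[of "2/3" J] by (intro mult_left_mono) auto
    also have "\<dots> = 3 * exp C * real J * l powr (real m + 1/2)"
    proof -
      have "(real J * L) powr (2/3) * real J powr (1/3) = real J powr (2/3 + 1/3) * L powr (2/3)"
        by (simp only: powr_mult powr_add mult_ac)
      also have "\<dots> = real J * l powr (1/6)" unfolding L_def using J0 by (simp add: powr_powr)
      finally have 1: "(real J * L) powr (2/3) * real J powr (1/3) = real J * l powr (1/6)" .
      have e: "real m + 1/2 = (real m + 1/3) + 1/6" by simp
      have 2: "l powr (real m + 1/2) = l powr (real m + 1/3) * l powr (1/6)"
        by (subst e) (rule powr_add)
      have "exp C * l powr (real m + 1/3) * (real J * L) powr (2/3) * (3 * real J powr (1/3))
          = 3 * exp C * l powr (real m + 1/3) * ((real J * L) powr (2/3) * real J powr (1/3))" by simp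
      then show ?thesis unfolding 1 2 by simp
    qed
    also have "exp C * l powr (real m + 1) \<le> exp C * (real J * l powr (real m + 1/2))"
    proof -
      have "l powr (real m + 1) = l powr (real m) * l" using l1 by (simp add: powr_add)
      also have "\<dots> \<le> l powr (real m + 1/2) * real J"
        using l1 J unfolding l_def[symmetric] by (intro mult_mono powr_mono) auto
      finally show ?thesis by (simp add: mult.commute)
    qed
    finally have "(\<Sum>j<J. E j) \<le> 4 * exp C * real J * l powr (real m + 1/2)" by (simp add: mult_ac)
    then have "8 / real J * (\<Sum>j<J. E j) \<le> 8 / real J * (4 * exp C * real J * l powr (real m + 1/2))"
      using J0 by (intro mult_left_mono) auto
    also have "\<dots> = 32 * exp C * l powr (real m + 1/2)" using J0 by simp
    finally show ?thesis unfolding E_def \<theta>_def L_def l_def N_def .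
  qed
  then show ?thesis by (intro exI[of _ "32 * exp C"]) auto
qed

section \<open>Windowed divisor sums over short intervals\<close>

lemma card_interval_multiples_le:
  fixes x y :: real
  assumes "x \<ge> 0" "a > 0" "real a \<le> y"
  shows "real (card {n. x < real n \<and> real n \<le> x + y \<and> a dvd n}) \<le> 2 * y / real a"
proof -
  have "\<bar>real (card {n. x < real n \<and> real n \<le> x + y \<and> a dvd n}) - y / real a\<bar> \<le> 1"
    using assms by (intro card_multiples_interval) auto
  moreover have "1 \<le> y / real a" using assms by simp
  ultimately show ?thesis by linarith
qed

lemma finite_real_interval: "finite {n. x < real n \<and> real n \<le> w}"
  by (rule finite_subset[of _ "{..nat \<lfloor>w\<rfloor>}"]) (auto simp: le_nat_floor)

text \<open>
Divisors without primes above a constant \<open>Q\<close> are so sparse that those larger than \<open>Z / Q\<close> have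
a reciprocal sum of order at most \<open>Z powr (- 1/2)\<close>, by comparison with the sum of \<open>a powr (- 1/2)\<close>.
\<close>
lemma card_smooth_divisor_le:
  fixes x y Z Q :: real
  assumes x: "x \<ge> 0" and Z: "Z \<ge> 1" "Z \<le> y" and Q: "Q > 0"
    and N: "N \<subseteq> {n. x < real n \<and> real n \<le> x + y}"
    and div: "\<And>n. n \<in> N \<Longrightarrow> \<exists>a. a dvd n \<and> a > 0 \<and> real a \<le> Z \<and> Z < real a * Q \<and> (\<forall>p. prime p \<longrightarrow> p dvd a \<longrightarrow> real p \<le> Q)"
  shows "real (card N) \<le> 2 * y * (Q / Z) powr (1/2) * 4 ^ card {p. prime p \<and> p \<le> nat \<lfloor>Q\<rfloor>}"
proof -
  define P where "P = {p. prime p \<and> p \<le> nat \<lfloor>Q\<rfloor>}"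
  define M where "M = nat \<lfloor>Z\<rfloor>"
  define B where "B = {a. 0 < a \<and> a \<le> M \<and> prime_factors a \<subseteq> P}"
  define A where "A = {a \<in> B. Z < real a * Q}"
  have finB: "finite B" unfolding B_def by (rule finite_subset[of _ "{..M}"]) auto
  then have finA: "finite A" unfolding A_def by simp
  have finI: "finite {n. x < real n \<and> real n \<le> x + y \<and> a dvd n}" for a
    by (rule finite_subset[OF _ finite_real_interval[of x "x + y"]]) auto
  have "N \<subseteq> (\<Union>a\<in>A. {n. x < real n \<and> real n \<le> x + y \<and> a dvd n})"
  proof
    fix n assume n: "n \<in> N"
    then obtain a where a: "a dvd n" "a > 0" "real a \<le> Z" "Z < real a * Q" "\<And>p. prime p \<Longrightarrow> p dvd a \<Longrightarrow> real p \<le> Q"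
      using div by blast
    have "p \<in> P" if "p \<in> prime_factors a" for p
    proof -
      have "prime p" "p dvd a" using that by (auto simp: in_prime_factors_iff)
      then show ?thesis unfolding P_def using a(5) by (simp add: le_nat_floor)
    qed
    then have "a \<in> A" unfolding A_def B_def M_def using a by (auto simp: le_nat_floor)
    then show "n \<in> (\<Union>a\<in>A. {n. x < real n \<and> real n \<le> x + y \<and> a dvd n})" using n N a(1) by auto
  qed
  then have "card N \<le> card (\<Union>a\<in>A. {n. x < real n \<and> real n \<le> x + y \<and> a dvd n})"
    using finA finI by (intro card_mono) auto
  also have "\<dots> \<le> (\<Sum>a\<in>A. card {n. x < real n \<and> real n \<le> x + y \<and> a dvd n})"
    using finA by (rule card_UN_le)
  finally have "real (card N) \<le> (\<Sum>a\<in>A. real (card {n. x < real n \<and> real n \<le> x + y \<and> a dvd n}))"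
    unfolding of_nat_sum[symmetric] by (rule of_nat_mono)
  also have "\<dots> \<le> (\<Sum>a\<in>A. 2 * y * (Q / Z) powr (1/2) * real a powr (-1/2))"
  proof (rule sum_mono)
    fix a assume a: "a \<in> A"
    then have a0: "a > 0" "a \<le> M" "Z < real a * Q" by (auto simp: A_def B_def)
    have "real M \<le> Z" unfolding M_def using Z by linarith
    then have aZ: "real a \<le> y" using a0(2) Z by linarith
    have "real (card {n. x < real n \<and> real n \<le> x + y \<and> a dvd n}) \<le> 2 * y / real a"
      using x a0(1) aZ by (rule card_interval_multiples_le)
    also have "2 * y / real a \<le> 2 * y * ((Q / Z) powr (1/2) * real a powr (-1/2))"
    proof -
      have "1 / real a = (1 / real a) powr (1/2) * (1 / real a) powr (1/2)"
        using a0 by (simp flip: powr_add)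
      also have "\<dots> \<le> (Q / Z) powr (1/2) * (1 / real a) powr (1/2)"
        using a0 Z Q by (intro mult_right_mono powr_mono2) (auto simp: field_simps)
      also have "(1 / real a) powr (1/2) = real a powr (-1/2)"
        using a0 by (simp add: powr_minus powr_divide field_simps)
      finally have "2 * y * (1 / real a) \<le> 2 * y * ((Q / Z) powr (1/2) * real a powr (-1/2))"
        using Z by (intro mult_left_mono) auto
      then show ?thesis by simp
    qed
    finally show "real (card {n. x < real n \<and> real n \<le> x + y \<and> a dvd n}) \<le> 2 * y * (Q / Z) powr (1/2) * real a powr (-1/2)"
      by (simp add: mult.assoc)
  qed
  also have "\<dots> = 2 * y * (Q / Z) powr (1/2) * (\<Sum>a\<in>A. real a powr (-1/2))" by (simp add: sum_distrib_left)
  also have "\<dots> \<le> 2 * y * (Q / Z) powr (1/2) * 4 ^ card P"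
  proof (rule mult_left_mono)
    have "(\<Sum>a\<in>A. real a powr (-1/2)) \<le> (\<Sum>a\<in>B. real a powr (-1/2))"
      using finB by (intro sum_mono2) (auto simp: A_def)
    also have "\<dots> \<le> 4 ^ card P" unfolding B_def P_def
      using finite_primes_upto by (intro smooth_sum_powr_half_le) auto
    finally show "(\<Sum>a\<in>A. real a powr (-1/2)) \<le> 4 ^ card P" .
  qed (use Z in auto)
  finally show ?thesis unfolding P_def .
qed

text \<open>
The possible smooth parts \<open>a\<close> in \<open>smooth_rough_decomposition\<close> whose limiting prime \<open>q\<close> satisfies
\<open>q ^ s \<le> Z\<close>, written with logarithms.
\<close>
definition prefix_class :: "real \<Rightarrow> nat \<Rightarrow> nat set" where
  "prefix_class Z s = {a. 0 < a \<and> real a \<le> Z \<and>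
     (\<exists>q>0. real s * ln q \<le> ln Z \<and> Z < real a * q \<and> (\<forall>p. prime p \<longrightarrow> p dvd a \<longrightarrow> real p \<le> q))}"

lemma finite_prefix_class: "finite (prefix_class Z s)"
  by (rule finite_subset[of _ "{..nat \<lfloor>Z\<rfloor>}"]) (auto simp: prefix_class_def le_nat_floor)

text \<open>
The sieve level \<open>z\<close> is at most \<open>x powr (1/50)\<close> and the length of the interval at least
\<open>x powr (2/5 - 1/50)\<close>, so the main term absorbs the sieve error \<open>z ^ 4\<close>.
\<close>
lemma rough_count_le:
  fixes x y :: real
  assumes x: "x \<ge> exp 1" and y: "x powr (2/5) \<le> y" and a: "a > 0" "real a \<le> x powr (1/50)"
  shows "real (card {b. x / real a < real b \<and> real b \<le> x / real a + y / real a \<and>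
            (\<forall>p. prime p \<longrightarrow> p dvd b \<longrightarrow> exp (ln x / (50 * (real s + 1))) < real p)})
     \<le> 150 * (real s + 1) / ln x * (y / real a)"
proof -
  have x1: "x > 1" using x exp_gt_one[of "1::real"] by linarith
  have "ln (exp 1) \<le> ln x" using x x1 by (subst ln_le_cancel_iff) auto
  then have l1: "ln x \<ge> 1" by simp
  define z where "z = exp (ln x / (50 * (real s + 1)))"
  define Y where "Y = y / real a"
  have lnz: "ln z = ln x / (50 * (real s + 1))" "ln z > 0" unfolding z_def using l1 by auto
  have z1: "z > 1" unfolding z_def using l1 by simp
  have "0 < x powr (2/5)" using x1 by simp
  then have y0: "y > 0" using y by linarith
  have "real (card {b. x / real a < real b \<and> real b \<le> x / real a + Y \<and> (\<forall>p. prime p \<longrightarrow> p dvd b \<longrightarrow> z < real p)})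
     \<le> 2 * Y / ln z + z ^ 4"
    unfolding Y_def using x1 y0 a z1 by (intro selberg_sieve) auto
  also have "z ^ 4 \<le> Y / ln z"
  proof -
    have "z \<le> x powr (1/50)"
    proof -
      have "ln x / (50 * (real s + 1)) \<le> ln x / 50" using l1 by (intro divide_left_mono) auto
      then show ?thesis unfolding z_def powr_def using x1 by simp
    qed
    then have "z ^ 4 \<le> (x powr (1/50)) ^ 4" using z1 by (intro power_mono) auto
    also have "\<dots> = x powr (4/50)" using x1 by (simp add: powr_realpow[symmetric] powr_powr)
    finally have z4: "z ^ 4 \<le> x powr (4/50)" .
    have "ln z \<le> ln x / 50" unfolding lnz using l1 by (intro divide_left_mono) auto
    also have "\<dots> \<le> x powr (3/10) / (3/10) / 50" using x1 by (intro divide_right_mono ln_powr_bound) auto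
    also have "\<dots> \<le> x powr (3/10)" by simp
    finally have "z ^ 4 * ln z \<le> x powr (4/50) * x powr (3/10)"
      using z4 z1 lnz(2) by (intro mult_mono) auto
    also have "\<dots> = x powr (2/5 - 1/50)" by (simp flip: powr_add)
    also have "\<dots> = x powr (2/5) / x powr (1/50)" by (rule powr_diff)
    also have "\<dots> \<le> y / real a" using y a y0 x1 by (intro frac_le) auto
    finally show ?thesis using lnz(2) by (simp only: Y_def pos_le_divide_eq)
  qed
  also have "2 * Y / ln z + Y / ln z = 150 * (real s + 1) / ln x * Y"
    unfolding lnz(1) using l1 by (simp add: field_simps)
  finally show ?thesis unfolding Y_def z_def by simp
qed

text \<open>
The rough part \<open>b\<close> has all its primes above \<open>x powr (1 / (50 * (s + 1)))\<close> and is at most \<open>x ^ 2\<close>, so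
it has fewer than \<open>100 * (s + 1)\<close> prime factors, which bounds \<open>\<tau>\<close> at \<open>b\<close>. For a given smooth part \<open>a\<close> the numbers \<open>b\<close>
are counted by the sieve, and the window is replaced by twisted divisor sums at \<open>a\<close>.
\<close>
lemma prefix_class_contribution:
  fixes x y u v L :: real
  assumes x: "x \<ge> exp 1" and y: "x powr (2/5) \<le> y" "y \<le> x"
    and Z: "Z = x powr (1/50)" and J: "J > 0" and L: "L > 0" and u: "u > 0" and v: "v \<le> u * exp L"
    and N: "N \<subseteq> {n. x < real n \<and> real n \<le> x + y}"
    and dec: "\<And>n. n \<in> N \<Longrightarrow> \<exists>a b. n = a * b \<and> b > 0 \<and> a \<in> prefix_class Z s \<and>
        (\<forall>p. prime p \<longrightarrow> p dvd b \<longrightarrow> exp (ln x / (50 * (real s + 1))) < real p)"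
  shows "(\<Sum>n\<in>N. tau_window m n u v) \<le> exp (100 * (real s + 1) * ln (real (Suc m))) * (150 * (real s + 1) / ln x * y) *
     (8 / real J * (\<Sum>j<J. \<Sum>a\<in>prefix_class Z s. twisted_tau m (real j / (real J * L)) a / real a))"
proof -
  have x1: "x > 1" using x exp_gt_one[of "1::real"] by linarith
  have x2: "x \<ge> 2" using x exp_ge_add_one_self[of "1::real"] by linarith
  have "ln (exp 1) \<le> ln x" using x x1 by (subst ln_le_cancel_iff) auto
  then have l1: "ln x \<ge> 1" by simp
  have "0 < x powr (2/5)" using x1 by simp
  then have y0: "y > 0" using y by linarith
  define z where "z = exp (ln x / (50 * (real s + 1)))"
  define F where "F = exp (100 * (real s + 1) * ln (real (Suc m)))"
  define h where "h = (\<lambda>a. 8 / real J * (\<Sum>j<J. twisted_tau m (real j / (real J * L)) a))"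
  have h0: "h a \<ge> 0" for a unfolding h_def by (intro mult_nonneg_nonneg sum_nonneg twisted_tau_nonneg) auto
  define G where "G = 150 * (real s + 1) / ln x * y"
  have finN: "finite N" using N finite_real_interval by (rule finite_subset)
  obtain f where f: "\<And>n. n \<in> N \<Longrightarrow> \<exists>b. n = f n * b \<and> b > 0 \<and> f n \<in> prefix_class Z s \<and> (\<forall>p. prime p \<longrightarrow> p dvd b \<longrightarrow> z < real p)"
    using dec unfolding z_def[symmetric] by metis
  have tw: "tau_window m n u v \<le> F * h (f n)" if n: "n \<in> N" for n
  proof -
    obtain b where b: "n = f n * b" "b > 0" "f n \<in> prefix_class Z s" "\<And>p. prime p \<Longrightarrow> p dvd b \<Longrightarrow> z < real p"
      using f[OF n] by blast
    have a0: "f n > 0" using b(3) by (simp add: prefix_class_def)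
    have "tau_window m (f n * b) u v \<le> real (piltz_tau (Suc m) b) * h (f n)"
    proof (rule tau_window_mult_le[OF a0 b(2)])
      fix e assume "e dvd b"
      then have e: "real e > 0" using b(2) by (auto intro: dvd_pos_nat)
      show "tau_window m (f n) (u / real e) (v / real e) \<le> h (f n)"
        unfolding h_def using e u v by (intro tau_window_le_twisted_tau J L a0) (auto simp: field_simps)
    qed
    also have "real (piltz_tau (Suc m) b) \<le> F"
    proof -
      have z1: "z > 1" unfolding z_def using l1 by simp
      have "b \<le> n" using a0 by (subst b(1)) simp
      moreover have "real n \<le> x + y" using n N by auto
      ultimately have "real b \<le> x * x" using y(2) x2 mult_right_mono[of 2 x x] by linarith
      then have "ln (real b) \<le> ln (x * x)" using b(2) x1 by (subst ln_le_cancel_iff) auto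
      then have lnb: "ln (real b) \<le> 2 * ln x" using x1 by (simp add: ln_mult)
      have "real (piltz_tau (Suc m) b) \<le> real b powr (ln (real (Suc m)) / ln z)"
        using b(2) z1 b(4) by (intro piltz_tau_le_rough) (auto intro: less_imp_le)
      also have "\<dots> = exp (ln (real (Suc m)) / ln z * ln (real b))" using b(2) by (simp add: powr_def)
      also have "\<dots> \<le> exp (ln (real (Suc m)) / ln z * (2 * ln x))"
        unfolding exp_le_cancel_iff using lnb z1 by (intro mult_left_mono divide_nonneg_nonneg) auto
      also have "ln (real (Suc m)) / ln z * (2 * ln x) = 100 * (real s + 1) * ln (real (Suc m))"
        unfolding z_def using l1 by (simp add: field_simps)
      finally show ?thesis unfolding F_def .
    qed
    finally show ?thesis using b(1) h0[of "f n"] by (simp add: mult_right_mono)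
  qed
  have "(\<Sum>n\<in>N. tau_window m n u v) \<le> (\<Sum>n\<in>N. F * h (f n))" by (intro sum_mono tw)
  also have "\<dots> = (\<Sum>a\<in>prefix_class Z s. \<Sum>n\<in>{n \<in> N. f n = a}. F * h (f n))"
    by (rule sum.group[symmetric]) (use finN finite_prefix_class f in auto)
  also have "\<dots> = (\<Sum>a\<in>prefix_class Z s. real (card {n \<in> N. f n = a}) * (F * h a))"
    by (intro sum.cong refl) simp
  also have "\<dots> \<le> (\<Sum>a\<in>prefix_class Z s. G / real a * (F * h a))"
  proof (intro sum_mono mult_right_mono)
    fix a assume "a \<in> prefix_class Z s"
    then have a: "a > 0" "real a \<le> x powr (1/50)" unfolding prefix_class_def Z by auto
    let ?B = "{b. x / real a < real b \<and> real b \<le> x / real a + y / real a \<and> (\<forall>p. prime p \<longrightarrow> p dvd b \<longrightarrow> z < real p)}"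
    have "card {n \<in> N. f n = a} \<le> card ?B"
    proof (rule card_inj_on_le[of "\<lambda>n. n div a"])
      show "inj_on (\<lambda>n. n div a) {n \<in> N. f n = a}"
      proof (rule inj_onI)
        fix n n' assume n: "n \<in> {n \<in> N. f n = a}" "n' \<in> {n \<in> N. f n = a}" "n div a = n' div a"
        then have "a dvd n" "a dvd n'" using f[of n] f[of n'] by (auto simp: dvd_def)
        then show "n = n'" using n(3) by (metis dvd_mult_div_cancel)
      qed
      show "(\<lambda>n. n div a) ` {n \<in> N. f n = a} \<subseteq> ?B"
      proof
        fix b assume "b \<in> (\<lambda>n. n div a) ` {n \<in> N. f n = a}"
        then obtain n where n: "n \<in> N" "f n = a" "b = n div a" by auto
        obtain b' where b': "n = f n * b'" "\<And>p. prime p \<Longrightarrow> p dvd b' \<Longrightarrow> z < real p"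
          using f[OF n(1)] by blast
        have nb: "n = a * b'" using b'(1) n(2) by simp
        have bb: "b = b'" using n(3) a(1) unfolding nb by simp
        have "x < real a * real b'" "real a * real b' \<le> x + y" using n(1) N unfolding nb by auto
        then have "x / real a < real b'" "real b' \<le> x / real a + y / real a"
          using a(1) by (auto simp: field_simps)
        then show "b \<in> ?B" unfolding bb using b'(2) by blast
      qed
      show "finite ?B" by (rule finite_subset[OF _ finite_real_interval[of "x / real a" "x / real a + y / real a"]]) auto
    qed
    then have "real (card {n \<in> N. f n = a}) \<le> real (card ?B)" by (rule of_nat_mono)
    also have "\<dots> \<le> 150 * (real s + 1) / ln x * (y / real a)"
      unfolding z_def using x y(1) a by (rule rough_count_le)
    finally show "real (card {n \<in> N. f n = a}) \<le> G / real a" unfolding G_def by simp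
  qed (auto simp: F_def h0)
  also have "\<dots> = F * G * (\<Sum>a\<in>prefix_class Z s. h a / real a)"
    by (simp add: sum_distrib_left mult_ac)
  also have "(\<Sum>a\<in>prefix_class Z s. h a / real a) = 8 / real J * (\<Sum>j<J. \<Sum>a\<in>prefix_class Z s. twisted_tau m (real j / (real J * L)) a / real a)"
  proof -
    have "(\<Sum>a\<in>prefix_class Z s. h a / real a) = (\<Sum>a\<in>prefix_class Z s. \<Sum>j<J. 8 / real J * (twisted_tau m (real j / (real J * L)) a / real a))"
      unfolding h_def by (intro sum.cong refl) (simp add: sum_distrib_left sum_divide_distrib)
    also have "\<dots> = (\<Sum>j<J. \<Sum>a\<in>prefix_class Z s. 8 / real J * (twisted_tau m (real j / (real J * L)) a / real a))"
      by (rule sum.swap)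
    finally show ?thesis by (simp add: sum_distrib_left)
  qed
  finally show ?thesis unfolding F_def G_def .
qed

text \<open>
With \<open>q\<close> the limiting prime of the decomposition \<open>n = a * b\<close> at \<open>Z = x powr (1/50)\<close>, the integers are
classified by \<open>s = \<lfloor>ln Z / ln q\<rfloor>\<close>. Large \<open>s\<close> means that \<open>b\<close> may have many prime factors, at a cost
\<open>exp (O(s))\<close>, but the smooth part is then rare: Rankin's saving \<open>exp (- c * s)\<close> wins for a suitable \<open>c\<close>, and the series over
\<open>s\<close> converges. If \<open>q\<close> is below a constant \<open>Q\<close>, this argument breaks down, but so few \<open>n\<close>
are left that the bound \<open>\<tau>(n) = O(n powr (1/200))\<close> suffices.
\<close>
theorem short_sum_tau_window:
  assumes m: "m \<ge> 1"
  shows "\<exists>C\<ge>0. \<forall>x y u v. x \<ge> exp 1 \<longrightarrow> x powr (2/5) \<le> y \<longrightarrow> y \<le> x \<longrightarrow> 0 < u \<longrightarrow> v \<le> u * exp (ln x powr (1/4)) \<longrightarrow>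
     (\<Sum>n | x < real n \<and> real n \<le> x + y. tau_window m n u v) \<le> C * y * ln x powr (real m - 1/2)"
proof -
  define lM where "lM = ln (real (Suc m))"
  have lM0: "lM \<ge> 0" unfolding lM_def by simp
  \<comment> \<open>The divisor function at the rough part costs \<open>exp (100 * (s + 1) * lM)\<close>; the 2 leaves \<open>exp (- s)\<close> after
    the factor \<open>s + 1\<close> from the sieve.\<close>
  define c where "c = 100 * lM + 2"
  have c0: "c > 0" unfolding c_def using lM0 by simp
  \<comment> \<open>For \<open>q > Q\<close> the Rankin exponent \<open>c * s / ln Z\<close> is at most \<open>1/8\<close>.\<close>
  define Q where "Q = exp (8 * c)"
  define K where "K = (4::real) ^ card {p. prime p \<and> p \<le> nat \<lfloor>Q\<rfloor>}"
  obtain C1 where C1: "C1 \<ge> 0" "\<And>n. n > 0 \<Longrightarrow> real (piltz_tau (Suc m) n) \<le> C1 * real n powr (1/200)"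
    using piltz_tau_bound[of "1/200" "Suc m"] by auto
  obtain C2 where C2: "C2 > 0" "\<And>\<theta> Z s N. Z > 1 \<Longrightarrow> 8 * c * real s \<le> ln Z \<Longrightarrow> Z \<le> real N \<Longrightarrow>
    (\<Sum>a\<in>prefix_class Z s. twisted_tau m \<theta> a / real a)
     \<le> C2 * exp (- c * (real s - 1)) * exp (\<Sum>p | prime p \<and> p \<le> N. twisted_tau m \<theta> p / real p)"
    using rankin_smooth_prefix_sum[OF c0, of m] unfolding prefix_class_def by blast
  obtain C3 where C3: "C3 \<ge> 0" "\<And>x J. x \<ge> exp 1 \<Longrightarrow> ln x \<le> real J \<Longrightarrow>
    8 / real J * (\<Sum>j<J. exp (\<Sum>p | prime p \<and> p \<le> nat \<lfloor>x\<rfloor>. twisted_tau m (real j / (real J * ln x powr (1/4))) p / real p))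
     \<le> C3 * ln x powr (real m + 1/2)"
    using twisted_tau_average_bound[OF m] by blast
  define C4 where "C4 = 4 * C1 * Q powr (1/2) * K"
  define C5 where "C5 = 300 * exp (200 * lM + 2) * C2 * C3"
  have C40: "C4 \<ge> 0" unfolding C4_def K_def using C1 by simp
  have "(\<Sum>n | x < real n \<and> real n \<le> x + y. tau_window m n u v) \<le> (C4 + C5) * y * ln x powr (real m - 1/2)"
    if x: "x \<ge> exp 1" and y: "x powr (2/5) \<le> y" "y \<le> x" and u: "0 < u" and v: "v \<le> u * exp (ln x powr (1/4))" for x y u v :: real
  proof -
    define I where "I = {n. x < real n \<and> real n \<le> x + y}"
    define Z where "Z = x powr (1/50)"
    define l where "l = ln x"
    have x1: "x > 1" using x exp_gt_one[of "1::real"] by linarith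
    have "ln (exp 1) \<le> ln x" using x x1 by (subst ln_le_cancel_iff) auto
    then have l1: "l \<ge> 1" unfolding l_def by simp
    have "0 < x powr (2/5)" using x1 by simp
    then have y0: "y > 0" using y by linarith
    have lnZ: "ln Z = l / 50" unfolding Z_def l_def using x1 by (simp add: ln_powr)
    have Z1: "Z > 1" unfolding Z_def using x1 by simp
    have Zy: "Z \<le> y" unfolding Z_def 
    proof -
      have "x powr (1/50) \<le> x powr (2/5)" using x1 by (intro powr_mono) auto
      with y(1) show "x powr (1/50) \<le> y" by linarith
    qed
    have Zx: "Z \<le> x" using Zy y by simp
    have finI: "finite I" unfolding I_def by (rule finite_real_interval)
    have "\<exists>q. \<exists>a b. n = a * b \<and> a > 0 \<and> b > 0 \<and> real a \<le> Z \<and> prime q \<and> Z < real a * real q \<and>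
        (\<forall>p. prime p \<longrightarrow> p dvd a \<longrightarrow> p \<le> q) \<and> (\<forall>p. prime p \<longrightarrow> p dvd b \<longrightarrow> q \<le> p)" if "n \<in> I" for n
    proof -
      have n: "real n > x" using that by (simp add: I_def)
      then have "real n > Z" "n > 0" using Zx x1 by (auto intro: Nat.gr0I)
      then show ?thesis using smooth_rough_decomposition[of n Z] Z1 by auto
    qed
    then obtain q where q: "\<And>n. n \<in> I \<Longrightarrow> \<exists>a b. n = a * b \<and> a > 0 \<and> b > 0 \<and> real a \<le> Z \<and> prime (q n) \<and> Z < real a * real (q n) \<and>
        (\<forall>p. prime p \<longrightarrow> p dvd a \<longrightarrow> p \<le> q n) \<and> (\<forall>p. prime p \<longrightarrow> p dvd b \<longrightarrow> q n \<le> p)"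
      by metis
    define A where "A = {n \<in> I. real (q n) \<le> Q}"
    define B where "B = {n \<in> I. real (q n) > Q}"
    have AB: "I = A \<union> B" "A \<inter> B = {}" "A \<subseteq> I" "B \<subseteq> I" "finite A" "finite B"
      using finI by (auto simp: A_def B_def)
    have lpow: "l powr (real m - 1/2) \<ge> 1" using l1 m by (intro ge_one_powr_ge_zero) auto
    have sumA: "(\<Sum>n\<in>A. tau_window m n u v) \<le> C4 * y * l powr (real m - 1/2)"
    proof -
      have "(\<Sum>n\<in>A. tau_window m n u v) \<le> (\<Sum>n\<in>A. C1 * (2 * x powr (1/200)))"
      proof (rule sum_mono)
        fix n assume "n \<in> A"
        then have n: "x < real n" "real n \<le> 2 * x" using y(2) by (auto simp: A_def I_def)
        then have n0: "n > 0" using x1 by (auto intro: Nat.gr0I)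
        have "tau_window m n u v \<le> C1 * real n powr (1/200)"
          using tau_window_le[OF n0] C1(2)[OF n0] by (rule order.trans)
        also have "\<dots> \<le> C1 * (2 * x) powr (1/200)" using n C1(1) by (intro mult_left_mono powr_mono2) auto
        also have "(2 * x) powr (1/200) = 2 powr (1/200) * x powr (1/200)" using x1 by (simp add: powr_mult)
        also have "C1 * \<dots> \<le> C1 * (2 * x powr (1/200))"
          using C1(1) powr_mono[of "1/200" 1 "2::real"] by (intro mult_left_mono mult_right_mono) auto
        finally show "tau_window m n u v \<le> C1 * (2 * x powr (1/200))" .
      qed
      also have "\<dots> = real (card A) * (C1 * (2 * x powr (1/200)))" by simp
      also have "\<dots> \<le> (2 * y * (Q / Z) powr (1/2) * K) * (C1 * (2 * x powr (1/200)))"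
      proof (rule mult_right_mono)
        show "real (card A) \<le> 2 * y * (Q / Z) powr (1/2) * K"
          unfolding K_def
        proof (rule card_smooth_divisor_le[where x = x])
          fix n assume n: "n \<in> A"
          then obtain a b where ab: "n = a * b" "a > 0" "real a \<le> Z" "Z < real a * real (q n)" "\<And>p. prime p \<Longrightarrow> p dvd a \<Longrightarrow> p \<le> q n"
            using q[of n] by (auto simp: A_def)
          have qQ: "real (q n) \<le> Q" using n by (simp add: A_def)
          have "Z < real a * Q" using ab(4) mult_left_mono[OF qQ, of "real a"] by linarith
          moreover have "real p \<le> Q" if "prime p" "p dvd a" for p using ab(5)[OF that] qQ by linarith
          ultimately show "\<exists>a. a dvd n \<and> a > 0 \<and> real a \<le> Z \<and> Z < real a * Q \<and> (\<forall>p. prime p \<longrightarrow> p dvd a \<longrightarrow> real p \<le> Q)"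
            using ab(1-3) by (intro exI[of _ a]) auto
        qed (use x1 Z1 Zy AB in \<open>auto simp: Q_def I_def\<close>)
      qed (use C1(1) in auto)
      also have "(Q / Z) powr (1/2) = Q powr (1/2) * x powr (-1/100)"
      proof -
        have "(Q / Z) powr (1/2) = Q powr (1/2) / Z powr (1/2)" by (rule powr_divide)
        also have "Z powr (1/2) = x powr (1/100)" unfolding Z_def by (simp add: powr_powr)
        finally have "(Q / Z) powr (1/2) = Q powr (1/2) * (1 / x powr (1/100))" by simp
        also have "1 / x powr (1/100) = x powr (- (1/100))" by (rule powr_minus_divide[symmetric])
        finally show ?thesis by simp
      qed
      also have "(2 * y * (Q powr (1/2) * x powr (-1/100)) * K) * (C1 * (2 * x powr (1/200)))
          = C4 * y * (x powr (-1/100) * x powr (1/200))" unfolding C4_def by simp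
      also have "x powr (-1/100) * x powr (1/200) = x powr (-1/200)" by (simp flip: powr_add)
      also have "C4 * y * x powr (-1/200) \<le> C4 * y * l powr (real m - 1/2)"
      proof (rule mult_left_mono)
        have "x powr (-1/200) \<le> x powr 0" using x1 by (intro powr_mono) auto
        then show "x powr (-1/200) \<le> l powr (real m - 1/2)" using lpow x1 by simp
      qed (use C40 y0 in auto)
      finally show ?thesis .
    qed
    define st where "st = (\<lambda>n. nat \<lfloor>ln Z / ln (real (q n))\<rfloor>)"
    define T where "T = nat \<lfloor>ln Z / (8 * c)\<rfloor>"
    have Bq: "ln (real (q n)) > 8 * c" if "n \<in> B" for n
    proof -
      have "exp (8 * c) < real (q n)" using that by (simp add: B_def Q_def)
      moreover have "0 < real (q n)" using calculation exp_gt_zero[of "8 * c"] by linarith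
      ultimately have "ln (exp (8 * c)) < ln (real (q n))" by (subst ln_less_cancel_iff) auto
      then show ?thesis by simp
    qed
    have sq: "real (st n) * ln (real (q n)) \<le> ln Z" "ln Z < (real (st n) + 1) * ln (real (q n))" "8 * c * real (st n) \<le> ln Z" if "n \<in> B" for n
    proof -
      have lq: "ln (real (q n)) > 0" using Bq[OF that] c0 by linarith
      have "0 \<le> ln Z / ln (real (q n))" using lq Z1 by simp
      then have "real (st n) \<le> ln Z / ln (real (q n))" "ln Z / ln (real (q n)) < real (st n) + 1"
        unfolding st_def by linarith+
      then show *: "real (st n) * ln (real (q n)) \<le> ln Z" "ln Z < (real (st n) + 1) * ln (real (q n))"
        using lq by (auto simp: field_simps)
      have "8 * c * real (st n) \<le> ln (real (q n)) * real (st n)" using Bq[OF that] by (intro mult_right_mono) auto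
      with *(1) show "8 * c * real (st n) \<le> ln Z" by (simp add: mult.commute)
    qed
    \<comment> \<open>Of order \<open>ln x\<close>, to make the frequency 0 affordable.\<close>
    define J where "J = nat \<lceil>l\<rceil>"
    have J: "J > 0" "l \<le> real J" unfolding J_def using l1 by linarith+
    define L where "L = l powr (1/4)"
    have L0: "L > 0" unfolding L_def using l1 by simp
    have sumB: "(\<Sum>n\<in>{n \<in> B. st n = s}. tau_window m n u v) \<le> C5 / 2 * y * l powr (real m - 1/2) * (1 / 2) ^ s"
      if s: "s \<in> {..T}" for s
    proof -
      have sT: "8 * c * real s \<le> ln Z"
      proof -
        have "0 \<le> ln Z / (8 * c)" using Z1 c0 by simp
        then have "real s \<le> ln Z / (8 * c)" using s unfolding T_def by auto linarith
        then show ?thesis using c0 by (simp add: field_simps)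
      qed
      define V where "V = exp (100 * (real s + 1) * ln (real (Suc m))) * (150 * (real s + 1) / ln x * y)"
      have V0: "V \<ge> 0" unfolding V_def using y0 l1 unfolding l_def by simp
      have contrib: "(\<Sum>n\<in>{n \<in> B. st n = s}. tau_window m n u v) \<le> V *
        (8 / real J * (\<Sum>j<J. \<Sum>a\<in>prefix_class Z s. twisted_tau m (real j / (real J * L)) a / real a))"
        unfolding V_def
      proof (rule prefix_class_contribution[OF x y Z_def J(1) L0 u])
        show "v \<le> u * exp L" using v by (simp add: L_def l_def)
        show "{n \<in> B. st n = s} \<subseteq> {n. x < real n \<and> real n \<le> x + y}" by (auto simp: B_def I_def)
        fix n assume "n \<in> {n \<in> B. st n = s}"
        then have nB: "n \<in> B" and ns: "st n = s" by auto
        obtain a b where ab: "n = a * b" "a > 0" "b > 0" "real a \<le> Z" "prime (q n)" "Z < real a * real (q n)"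
          "\<And>p. prime p \<Longrightarrow> p dvd a \<Longrightarrow> p \<le> q n" "\<And>p. prime p \<Longrightarrow> p dvd b \<Longrightarrow> q n \<le> p"
          using q[of n] nB by (auto simp: B_def)
        have q0: "real (q n) > 0" using prime_gt_0_nat[OF ab(5)] by simp
        have "a \<in> prefix_class Z s"
          unfolding prefix_class_def using ab(2,4,6,7) q0 sq(1)[OF nB] ns
          by (intro CollectI conjI exI[of _ "real (q n)"]) auto
        moreover have "exp (ln x / (50 * (real s + 1))) < real p" if "prime p" "p dvd b" for p
        proof -
          have "ln x / (50 * (real s + 1)) < ln (real (q n))"
            using sq(2)[OF nB] unfolding ns lnZ l_def by (simp add: field_simps)
          then have "exp (ln x / (50 * (real s + 1))) < exp (ln (real (q n)))" by simp
          also have "\<dots> = real (q n)" using q0 by simp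
          also have "\<dots> \<le> real p" using ab(8)[OF that] by simp
          finally show ?thesis .
        qed
        ultimately show "\<exists>a b. n = a * b \<and> b > 0 \<and> a \<in> prefix_class Z s \<and>
            (\<forall>p. prime p \<longrightarrow> p dvd b \<longrightarrow> exp (ln x / (50 * (real s + 1))) < real p)"
          using ab(1,3) by blast
      qed
      have "(\<Sum>j<J. \<Sum>a\<in>prefix_class Z s. twisted_tau m (real j / (real J * L)) a / real a)
          \<le> (\<Sum>j<J. C2 * exp (- c * (real s - 1)) * exp (\<Sum>p | prime p \<and> p \<le> nat \<lfloor>x\<rfloor>. twisted_tau m (real j / (real J * L)) p / real p))"
      proof (rule sum_mono)
        fix j
        have "2 \<le> x" using x exp_ge_add_one_self[of "1::real"] by linarith
        have "Z \<le> real (nat \<lfloor>x\<rfloor>)"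
        proof (cases "Z \<le> 2")
          case True
          have "2 \<le> \<lfloor>x\<rfloor>" using \<open>2 \<le> x\<close> by (simp add: le_floor_iff)
          then have "2 \<le> real (nat \<lfloor>x\<rfloor>)" by simp
          with True show ?thesis by linarith
        next
          case False
          have "Z * Z = Z ^ 2" by (simp add: power2_eq_square)
          also have "\<dots> \<le> Z ^ 50" using Z1 by (intro power_increasing) auto
          also have "\<dots> = x" unfolding Z_def using x1 by (simp add: powr_realpow[symmetric] powr_powr)
          finally have "Z * Z \<le> x" .
          moreover have "2 * Z \<le> Z * Z" using False by (intro mult_right_mono) auto
          ultimately show ?thesis using False by linarith
        qed
        then show "(\<Sum>a\<in>prefix_class Z s. twisted_tau m (real j / (real J * L)) a / real a) \<le> C2 * exp (- c * (real s - 1)) * exp (\<Sum>p | prime p \<and> p \<le> nat \<lfloor>x\<rfloor>. twisted_tau m (real j / (real J * L)) p / real p)"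
          using C2(2)[OF Z1 sT, of "nat \<lfloor>x\<rfloor>" "real j / (real J * L)"] by simp
      qed
      then have "8 / real J * (\<Sum>j<J. \<Sum>a\<in>prefix_class Z s. twisted_tau m (real j / (real J * L)) a / real a)
          \<le> 8 / real J * (\<Sum>j<J. C2 * exp (- c * (real s - 1)) * exp (\<Sum>p | prime p \<and> p \<le> nat \<lfloor>x\<rfloor>. twisted_tau m (real j / (real J * L)) p / real p))"
        by (rule mult_left_mono) simp
      also have "\<dots> = C2 * exp (- c * (real s - 1)) * (8 / real J * (\<Sum>j<J. exp (\<Sum>p | prime p \<and> p \<le> nat \<lfloor>x\<rfloor>. twisted_tau m (real j / (real J * ln x powr (1/4))) p / real p)))"
        by (simp add: sum_distrib_left mult_ac L_def l_def)
      also have "\<dots> \<le> C2 * exp (- c * (real s - 1)) * (C3 * l powr (real m + 1/2))"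
        using C2(1) C3(2)[OF x, of J] J(2) unfolding l_def by (intro mult_left_mono) auto
      finally have "(\<Sum>n\<in>{n \<in> B. st n = s}. tau_window m n u v) \<le> V * (C2 * exp (- c * (real s - 1)) * (C3 * l powr (real m + 1/2)))"
        using contrib V0 by (meson mult_left_mono order.trans)
      also have "\<dots> = 150 * C2 * C3 * y * (l powr (real m + 1/2) / l) * (exp (100 * (real s + 1) * lM) * exp (- c * (real s - 1)) * (real s + 1))"
        unfolding V_def lM_def l_def by simp
      also have "l powr (real m + 1/2) / l = l powr (real m - 1/2)"
      proof -
        have "l powr (real m - 1/2) = l powr ((real m + 1/2) - 1)" by (simp add: field_simps)
        also have "\<dots> = l powr (real m + 1/2) / l powr 1" by (rule powr_diff)
        finally show ?thesis using l1 by simp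
      qed
      also have "150 * C2 * C3 * y * l powr (real m - 1/2) * (exp (100 * (real s + 1) * lM) * exp (- c * (real s - 1)) * (real s + 1))
         \<le> 150 * C2 * C3 * y * l powr (real m - 1/2) * (exp (200 * lM + 2) * (1 / 2) ^ s)"
      proof (rule mult_left_mono)
        have "real s + 1 \<le> exp (real s)" using exp_ge_add_one_self[of "real s"] by linarith
        then have "exp (100 * (real s + 1) * lM) * exp (- c * (real s - 1)) * (real s + 1)
          \<le> exp (100 * (real s + 1) * lM) * exp (- c * (real s - 1)) * exp (real s)" by (intro mult_left_mono) auto
        also have "\<dots> = exp (200 * lM + 2 + - real s)"
          unfolding c_def exp_add[symmetric] by (simp add: algebra_simps)
        also have "\<dots> = exp (200 * lM + 2) * exp (-1) ^ s"
          unfolding exp_add by (simp flip: exp_of_nat_mult)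
        also have "\<dots> \<le> exp (200 * lM + 2) * (1 / 2) ^ s"
        proof (intro mult_left_mono power_mono)
          have "2 \<le> exp (1::real)" using exp_ge_add_one_self[of "1::real"] by linarith
          then show "exp (-1) \<le> (1 / 2 :: real)" by (simp add: exp_minus field_simps)
        qed auto
        finally show "exp (100 * (real s + 1) * lM) * exp (- c * (real s - 1)) * (real s + 1) \<le> exp (200 * lM + 2) * (1 / 2) ^ s" .
      qed (use C2(1) C3(1) y0 in auto)
      also have "\<dots> = C5 / 2 * y * l powr (real m - 1/2) * (1 / 2) ^ s" unfolding C5_def by simp
      finally show ?thesis .
    qed
    have "(\<Sum>n\<in>B. tau_window m n u v) = (\<Sum>s\<in>{..T}. \<Sum>n\<in>{n \<in> B. st n = s}. tau_window m n u v)"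
    proof (rule sum.group[symmetric])
      show "st ` B \<subseteq> {..T}"
      proof
        fix s assume "s \<in> st ` B"
        then obtain n where "n \<in> B" "s = st n" by blast
        then have "real s \<le> ln Z / (8 * c)" using sq(3)[of n] c0 by (simp add: field_simps)
        then show "s \<in> {..T}" unfolding T_def by (simp add: le_nat_floor)
      qed
    qed (use AB in auto)
    also have "\<dots> \<le> (\<Sum>s\<in>{..T}. C5 / 2 * y * l powr (real m - 1/2) * (1 / 2) ^ s)" by (intro sum_mono sumB)
    also have "\<dots> = C5 / 2 * y * l powr (real m - 1/2) * (\<Sum>s\<in>{..T}. (1 / 2) ^ s)" by (simp add: sum_distrib_left)
    also have "\<dots> \<le> C5 / 2 * y * l powr (real m - 1/2) * 2"
    proof (rule mult_left_mono)
      have "(\<Sum>s\<in>{..T}. (1 / 2 :: real) ^ s) \<le> (\<Sum>s. (1 / 2) ^ s)"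
        by (intro sum_le_suminf summable_geometric) auto
      also have "\<dots> = 2" by (subst suminf_geometric) auto
      finally show "(\<Sum>s\<in>{..T}. (1 / 2 :: real) ^ s) \<le> 2" .
    qed (use C2(1) C3(1) y0 in \<open>auto simp: C5_def\<close>)
    finally have sumB': "(\<Sum>n\<in>B. tau_window m n u v) \<le> C5 * y * l powr (real m - 1/2)" by simp
    have "(\<Sum>n\<in>I. tau_window m n u v) = (\<Sum>n\<in>A. tau_window m n u v) + (\<Sum>n\<in>B. tau_window m n u v)"
      unfolding AB(1) using AB by (intro sum.union_disjoint) auto
    also have "\<dots> \<le> C4 * y * l powr (real m - 1/2) + C5 * y * l powr (real m - 1/2)" by (intro add_mono sumA sumB')
    finally show ?thesis unfolding I_def l_def by (simp add: algebra_simps)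
  qed
  moreover have "C4 + C5 \<ge> 0" using C40 C2(1) C3(1) by (simp add: C5_def)
  ultimately show ?thesis by blast
qed

section \<open>Sums of powers of logarithms\<close>

lemma power_Suc_diff_bounds:
  fixes u v :: real
  assumes "0 \<le> v" "v \<le> u"
  shows "u ^ Suc k - v ^ Suc k \<le> real (Suc k) * u ^ k * (u - v)"
    and "real (Suc k) * v ^ k * (u - v) \<le> u ^ Suc k - v ^ Suc k"
proof -
  show "u ^ Suc k - v ^ Suc k \<le> real (Suc k) * u ^ k * (u - v)"
  proof (induction k)
    case (Suc k)
    have "u ^ Suc (Suc k) - v ^ Suc (Suc k) = u * (u ^ Suc k - v ^ Suc k) + v ^ Suc k * (u - v)"
      by (simp add: algebra_simps)
    also have "\<dots> \<le> u * (real (Suc k) * u ^ k * (u - v)) + u ^ Suc k * (u - v)"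
      using Suc assms by (intro add_mono mult_left_mono mult_right_mono power_mono) auto
    finally show ?case by (simp add: algebra_simps)
  qed simp
  show "real (Suc k) * v ^ k * (u - v) \<le> u ^ Suc k - v ^ Suc k"
  proof (induction k)
    case (Suc k)
    have "real (Suc (Suc k)) * v ^ Suc k * (u - v) = v * (real (Suc k) * v ^ k * (u - v)) + v ^ Suc k * (u - v)"
      by (simp add: algebra_simps)
    also have "\<dots> \<le> u * (u ^ Suc k - v ^ Suc k) + v ^ Suc k * (u - v)"
    proof (rule add_right_mono)
      have "v * (real (Suc k) * v ^ k * (u - v)) \<le> v * (u ^ Suc k - v ^ Suc k)"
        using Suc assms by (intro mult_left_mono) auto
      also have "\<dots> \<le> u * (u ^ Suc k - v ^ Suc k)"
      proof (rule mult_right_mono)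
        have "v ^ Suc k \<le> u ^ Suc k" using assms by (intro power_mono) auto
        then show "0 \<le> u ^ Suc k - v ^ Suc k" by simp
      qed (use assms in simp)
      finally show "v * (real (Suc k) * v ^ k * (u - v)) \<le> u * (u ^ Suc k - v ^ Suc k)" .
    qed
    also have "\<dots> = u ^ Suc (Suc k) - v ^ Suc (Suc k)" by (simp add: algebra_simps)
    finally show ?case .
  qed simp
qed

text \<open>
Compare each summand with the increment of \<open>ln n ^ Suc j / Suc j\<close>; the differences are dominated by two telescoping sums.
\<close>
lemma sum_ln_power_div_bounds:
  assumes N: "N \<ge> 1"
  shows "(\<Sum>n\<in>{1..<N}. ln (real n) ^ j / real (Suc n)) \<le> ln (real N) ^ Suc j / real (Suc j)"
    and "ln (real N) ^ Suc j / real (Suc j) - 2 * ln (real N) ^ j \<le> (\<Sum>n\<in>{1..<N}. ln (real n) ^ j / real (Suc n))"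
proof -
  define g where "g = (\<lambda>n. ln (real n) ^ Suc j / real (Suc j))"
  have step: "ln (real n) ^ j / real (Suc n) \<le> g (Suc n) - g n"
     "g (Suc n) - g n \<le> ln (real (Suc n)) ^ j / real n" if n: "n \<ge> 1" for n
  proof -
    define u v where "u = ln (real (Suc n))" and "v = ln (real n)"
    have uv: "0 \<le> v" "v \<le> u" using n by (auto simp: u_def v_def)
    have d: "1 / real (Suc n) \<le> u - v" "u - v \<le> 1 / real n"
      unfolding u_def v_def using ln_Suc_minus_ln_bounds[of n] n by auto
    have e: "g (Suc n) - g n = (u ^ Suc j - v ^ Suc j) / real (Suc j)"
      unfolding g_def u_def v_def by (simp add: diff_divide_distrib)
    have "v ^ j * (1 / real (Suc n)) \<le> v ^ j * (u - v)" using d uv by (intro mult_left_mono) auto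
    also have "\<dots> \<le> (u ^ Suc j - v ^ Suc j) / real (Suc j)"
      using power_Suc_diff_bounds(2)[OF uv, of j] by (simp add: field_simps)
    finally show "ln (real n) ^ j / real (Suc n) \<le> g (Suc n) - g n" unfolding e by (simp add: v_def)
    have "(u ^ Suc j - v ^ Suc j) / real (Suc j) \<le> u ^ j * (u - v)"
      using power_Suc_diff_bounds(1)[OF uv, of j] by (simp add: field_simps)
    also have "\<dots> \<le> u ^ j * (1 / real n)" using d uv by (intro mult_left_mono) auto
    finally show "g (Suc n) - g n \<le> ln (real (Suc n)) ^ j / real n" unfolding e by (simp add: u_def)
  qed
  have tel: "(\<Sum>n\<in>{1..<N}. g (Suc n) - g n) = g N - g 1"
    using N by (rule sum_Suc_diff')
  have g1: "g 1 = 0" by (simp add: g_def)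
  have "(\<Sum>n\<in>{1..<N}. ln (real n) ^ j / real (Suc n)) \<le> (\<Sum>n\<in>{1..<N}. g (Suc n) - g n)"
    by (intro sum_mono step) auto
  then show "(\<Sum>n\<in>{1..<N}. ln (real n) ^ j / real (Suc n)) \<le> ln (real N) ^ Suc j / real (Suc j)"
    unfolding tel g1 by (simp add: g_def)
  define p where "p = (\<lambda>n. ln (real n) ^ j)"
  have "(\<Sum>n\<in>{1..<N}. (g (Suc n) - g n) - p n / real (Suc n))
     \<le> (\<Sum>n\<in>{1..<N}. (p (Suc n) - p n) + p N * (- 1 / real (Suc n) - - 1 / real n))"
  proof (rule sum_mono)
    fix n assume n: "n \<in> {1..<N}"
    then have n1: "n \<ge> 1" "n < N" by auto
    have p: "p n \<le> p (Suc n)" "p n \<le> p N" "0 \<le> p n"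
      unfolding p_def using n1 by (auto intro!: power_mono)
    have "(g (Suc n) - g n) - p n / real (Suc n) \<le> p (Suc n) / real n - p n / real (Suc n)"
      using step(2)[OF n1(1)] unfolding p_def by linarith
    also have "\<dots> = (p (Suc n) - p n) / real n + p n * (- 1 / real (Suc n) - - 1 / real n)"
      by (simp add: diff_divide_distrib algebra_simps)
    also have "\<dots> \<le> (p (Suc n) - p n) / 1 + p N * (- 1 / real (Suc n) - - 1 / real n)"
    proof (intro add_mono divide_left_mono mult_right_mono)
      show "0 \<le> - 1 / real (Suc n) - - 1 / real n" using n1 by (simp add: field_simps)
    qed (use p n1 in auto)
    finally show "(g (Suc n) - g n) - p n / real (Suc n) \<le> (p (Suc n) - p n) + p N * (- 1 / real (Suc n) - - 1 / real n)" by simp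
  qed
  also have "\<dots> = (p N - p 1) + p N * ((- 1 / real N) - (- 1 / real 1))"
  proof -
    have "(\<Sum>n\<in>{1..<N}. p (Suc n) - p n) = p N - p 1" using N by (rule sum_Suc_diff')
    moreover have "(\<Sum>n\<in>{1..<N}. - 1 / real (Suc n) - - 1 / real n) = - 1 / real N - - 1 / real 1"
      using N by (rule sum_Suc_diff'[where f = "\<lambda>n. - 1 / real n"])
    ultimately show ?thesis unfolding sum.distrib sum_distrib_left[symmetric] by simp
  qed
  also have "\<dots> \<le> p N + p N * 1"
  proof (rule add_mono)
    show "p N - p 1 \<le> p N" unfolding p_def by (simp add: zero_le_power)
    have "0 \<le> p N" unfolding p_def using N by simp
    then show "p N * ((- 1 / real N) - (- 1 / real 1)) \<le> p N * 1" by (intro mult_left_mono) auto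
  qed
  finally have "(\<Sum>n\<in>{1..<N}. (g (Suc n) - g n) - p n / real (Suc n)) \<le> p N + p N * 1" .
  moreover have "(\<Sum>n\<in>{1..<N}. (g (Suc n) - g n) - p n / real (Suc n))
     = (\<Sum>n\<in>{1..<N}. g (Suc n) - g n) - (\<Sum>n\<in>{1..<N}. p n / real (Suc n))"
    by (rule sum_subtractf)
  ultimately show "ln (real N) ^ Suc j / real (Suc j) - 2 * ln (real N) ^ j \<le> (\<Sum>n\<in>{1..<N}. ln (real n) ^ j / real (Suc n))"
    unfolding tel g1 by (simp add: g_def p_def)
qed

text \<open>
The summands decrease in \<open>k\<close> and interlace with the increments of \<open>ln (x / k) ^ Suc s / Suc s\<close>, so the error is
at most the first summand.
\<close>
lemma sum_ln_quotient_power_div_bounds: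
  fixes x :: real
  assumes K: "K \<ge> 1" and x: "real K \<le> x"
  shows "\<bar>(\<Sum>k\<in>{1..K}. ln (x / real k) ^ s / real k) - (ln x ^ Suc s - ln (x / real K) ^ Suc s) / real (Suc s)\<bar> \<le> ln x ^ s"
proof -
  define g where "g = (\<lambda>k. ln (x / real k) ^ Suc s / real (Suc s))"
  define \<phi> where "\<phi> = (\<lambda>k. ln (x / real k) ^ s / real k)"
  have step: "\<phi> (Suc k) \<le> g k - g (Suc k)" "g k - g (Suc k) \<le> \<phi> k" if k: "k \<in> {1..<K}" for k
  proof -
    define u v where "u = ln (x / real k)" and "v = ln (x / real (Suc k))"
    have k1: "k \<ge> 1" "real (Suc k) \<le> x" using k x by auto
    have x0: "x > 0" using k1 by linarith
    have uv': "u = ln x - ln (real k)" "v = ln x - ln (real (Suc k))"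
      unfolding u_def v_def using k1 x0 by (simp_all add: ln_div)
    have v0: "0 \<le> v" unfolding v_def using k1 x0 by simp
    have uv: "v \<le> u" unfolding uv' using k1 by simp
    have d: "1 / real (Suc k) \<le> u - v" "u - v \<le> 1 / real k"
      unfolding uv' using ln_Suc_minus_ln_bounds[of k] k1 by auto
    have e: "g k - g (Suc k) = (u ^ Suc s - v ^ Suc s) / real (Suc s)"
      unfolding g_def u_def v_def by (simp add: diff_divide_distrib)
    have "v ^ s * (1 / real (Suc k)) \<le> v ^ s * (u - v)" using d v0 by (intro mult_left_mono) auto
    also have "\<dots> \<le> (u ^ Suc s - v ^ Suc s) / real (Suc s)"
      using power_Suc_diff_bounds(2)[OF v0 uv, of s] by (simp add: field_simps)
    finally show "\<phi> (Suc k) \<le> g k - g (Suc k)" unfolding e \<phi>_def by (simp add: v_def)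
    have "(u ^ Suc s - v ^ Suc s) / real (Suc s) \<le> u ^ s * (u - v)"
      using power_Suc_diff_bounds(1)[OF v0 uv, of s] by (simp add: field_simps)
    also have "\<dots> \<le> u ^ s * (1 / real k)" using d v0 uv by (intro mult_left_mono) auto
    finally show "g k - g (Suc k) \<le> \<phi> k" unfolding e \<phi>_def by (simp add: u_def)
  qed
  have tel: "(\<Sum>k\<in>{1..<K}. g k - g (Suc k)) = g 1 - g K"
    using sum_Suc_diff'[OF K, of "\<lambda>k. - g k"] by simp
  have x1: "x \<ge> 1" using K x by linarith
  have \<phi>0: "0 \<le> \<phi> k" if "k \<in> {1..K}" for k
    unfolding \<phi>_def using that x by simp
  have "{1..K} = insert K {1..<K}" using K by auto
  then have "(\<Sum>k\<in>{1..K}. \<phi> k) = (\<Sum>k\<in>{1..<K}. \<phi> k) + \<phi> K" by simp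
  moreover have "(\<Sum>k\<in>{1..<K}. \<phi> k) \<ge> g 1 - g K" unfolding tel[symmetric] by (intro sum_mono step)
  ultimately have low: "(\<Sum>k\<in>{1..K}. \<phi> k) \<ge> g 1 - g K" using \<phi>0[of K] K by simp
  have "(\<Sum>k\<in>{1..K}. \<phi> k) = \<phi> 1 + (\<Sum>k\<in>{Suc 1..K}. \<phi> k)"
    using K by (rule sum.atLeast_Suc_atMost)
  also have "(\<Sum>k\<in>{Suc 1..K}. \<phi> k) = (\<Sum>k\<in>{1..<K}. \<phi> (Suc k))"
    by (rule sum.reindex_bij_witness[of _ Suc "\<lambda>k. k - 1"]) auto
  also have "\<dots> \<le> g 1 - g K" unfolding tel[symmetric] by (intro sum_mono step)
  finally have up: "(\<Sum>k\<in>{1..K}. \<phi> k) \<le> \<phi> 1 + (g 1 - g K)" by simp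
  have "g 1 - g K = (ln x ^ Suc s - ln (x / real K) ^ Suc s) / real (Suc s)"
    unfolding g_def by (simp add: diff_divide_distrib)
  moreover have "\<phi> 1 = ln x ^ s" by (simp add: \<phi>_def)
  moreover have "0 \<le> ln x ^ s" using x1 by simp
  ultimately show ?thesis using low up unfolding \<phi>_def by linarith
qed

section \<open>Main terms\<close>

definition partial_sum :: "(nat \<Rightarrow> complex) \<Rightarrow> real \<Rightarrow> complex" where
  "partial_sum f z = (\<Sum>n | 1 \<le> n \<and> real n \<le> z. f n)"

definition log_poly :: "(nat \<Rightarrow> complex) \<Rightarrow> nat \<Rightarrow> real \<Rightarrow> complex" where
  "log_poly a s z = (\<Sum>j\<le>s. a j * of_real (ln z ^ j))"

text \<open>
Hypothesis (i): the polynomial in \<open>ln z\<close> with coefficients \<open>a 0, \<dots>, a s\<close>, and an explicit constant \<open>B\<close> in the error term.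
\<close>
definition partial_sum_asymp :: "(nat \<Rightarrow> complex) \<Rightarrow> (nat \<Rightarrow> complex) \<Rightarrow> nat \<Rightarrow> real \<Rightarrow> real \<Rightarrow> real \<Rightarrow> bool" where
  "partial_sum_asymp f a s B \<kappa> \<beta> \<longleftrightarrow> (\<forall>z\<ge>1. norm (partial_sum f z - of_real z * log_poly a s z)
      \<le> B * (z powr \<kappa> * ln (exp 1 * z) powr \<beta>))"

lemma partial_sum_nat: "partial_sum f (real N) = (\<Sum>n\<in>{1..N}. f n)"
  unfolding partial_sum_def by (intro sum.cong) auto

lemma norm_log_poly_le:
  assumes "1 \<le> w" "0 \<le> ln z" "ln z \<le> w"
  shows "norm (log_poly a s z) \<le> (\<Sum>j\<le>s. norm (a j)) * w ^ s"
proof -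
  have "norm (log_poly a s z) \<le> (\<Sum>j\<le>s. norm (a j * of_real (ln z ^ j)))"
    unfolding log_poly_def by (rule norm_sum)
  also have "\<dots> \<le> (\<Sum>j\<le>s. norm (a j) * w ^ s)"
  proof (rule sum_mono)
    fix j assume "j \<in> {..s}"
    then have "ln z ^ j \<le> w ^ j" "w ^ j \<le> w ^ s"
      using assms by (auto intro: power_mono power_increasing)
    then have "\<bar>ln z ^ j\<bar> \<le> w ^ s" using assms by simp
    then show "norm (a j * of_real (ln z ^ j)) \<le> norm (a j) * w ^ s"
      unfolding norm_mult norm_of_real by (rule mult_left_mono) simp
  qed
  finally show ?thesis by (simp add: sum_distrib_right)
qed

lemma abel_sum_div:
  fixes f :: "nat \<Rightarrow> complex"
  assumes "N \<ge> 1"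
  shows "(\<Sum>d\<in>{1..N}. f d / of_nat d) = (\<Sum>n\<in>{1..N}. f n) / of_nat N
     + (\<Sum>n\<in>{1..<N}. (\<Sum>d\<in>{1..n}. f d) / (of_nat n * of_nat (Suc n)))"
  using assms
proof (induction N rule: dec_induct)
  case (step n)
  have e: "{1..<Suc n} = insert n {1..<n}" using step by auto
  have n0: "of_nat n \<noteq> (0::complex)" "of_nat (Suc n) \<noteq> (0::complex)"
    using step by (simp_all del: of_nat_Suc)
  have "(\<Sum>d\<in>{1..n}. f d) / of_nat n = (\<Sum>d\<in>{1..n}. f d) / (of_nat n * of_nat (Suc n)) + (\<Sum>d\<in>{1..n}. f d) / of_nat (Suc n)"
    using n0 by (simp add: divide_simps) (simp add: algebra_simps)
  then show ?case using step.IH unfolding e by (simp add: add_divide_distrib)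
qed simp


lemma partial_sum_asympD:
  assumes "partial_sum_asymp f a s B \<kappa> \<beta>" "z \<ge> 1"
  shows "norm (partial_sum f z - of_real z * log_poly a s z) \<le> \<bar>B\<bar> * (z powr \<kappa> * (1 + ln z) powr \<beta>)"
proof -
  have "norm (partial_sum f z - of_real z * log_poly a s z) \<le> B * (z powr \<kappa> * ln (exp 1 * z) powr \<beta>)"
    using assms unfolding partial_sum_asymp_def by blast
  also have "ln (exp 1 * z) = 1 + ln z" using assms(2) by (simp add: ln_mult)
  also have "B * (z powr \<kappa> * (1 + ln z) powr \<beta>) \<le> \<bar>B\<bar> * (z powr \<kappa> * (1 + ln z) powr \<beta>)"
    by (intro mult_right_mono) auto
  finally show ?thesis .
qed

text \<open>
Summation by parts. The error term of (i) is summable against \<open>1 / n ^ 2\<close> because \<open>\<kappa> < 1\<close>, and of the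
polynomial only the leading coefficient matters at the precision \<open>(ln T) ^ s\<close>.
\<close>
lemma logarithmic_mean:
  assumes \<kappa>: "\<kappa> < 1"
  shows "\<exists>C\<ge>0. \<forall>f T. partial_sum_asymp f a s B \<kappa> \<beta> \<longrightarrow> T \<ge> 1 \<longrightarrow>
    norm ((\<Sum>d | 1 \<le> d \<and> real d \<le> T. f d / of_nat d) - a s / of_nat (Suc s) * of_real (ln T ^ Suc s)) \<le> C * (1 + ln T) ^ s"
proof -
  define \<sigma> where "\<sigma> = (\<lambda>n. real n powr (\<kappa> - 2) * (1 + ln (real n)) powr \<beta>)"
  have summ: "summable \<sigma>"
  proof (rule summable_comparison_test_ev)
    \<comment> \<open>The exponent \<open>(\<kappa> - 3) / 2\<close> lies strictly between \<open>\<kappa> - 2\<close> and \<open>- 1\<close>.\<close>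
    have "((\<lambda>n. real n powr (\<kappa> - 2) * (1 + ln (real n)) powr \<beta> / real n powr ((\<kappa> - 3) / 2)) \<longlongrightarrow> 0) sequentially"
      using \<kappa> by real_asymp
    then have "eventually (\<lambda>n. norm (real n powr (\<kappa> - 2) * (1 + ln (real n)) powr \<beta> / real n powr ((\<kappa> - 3) / 2)) < 1) sequentially"
      by (simp add: tendsto_iff)
    then show "eventually (\<lambda>n. norm (\<sigma> n) \<le> real n powr ((\<kappa> - 3) / 2)) sequentially"
      using eventually_gt_at_top[of 0]
    proof eventually_elim
      case (elim n)
      then show ?case by (simp add: \<sigma>_def abs_mult field_simps)
    qed
    show "summable (\<lambda>n. real n powr ((\<kappa> - 3) / 2))"
      using \<kappa> by (subst summable_real_powr_iff) auto
  qed
  have "((\<lambda>n. real n powr (\<kappa> - 1) * (1 + ln (real n)) powr \<beta>) \<longlongrightarrow> 0) sequentially"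
    using \<kappa> by real_asymp
  then have "Bseq (\<lambda>n. real n powr (\<kappa> - 1) * (1 + ln (real n)) powr \<beta>)"
    by (intro convergent_imp_Bseq convergentI)
  then obtain D where D: "\<And>n. norm (real n powr (\<kappa> - 1) * (1 + ln (real n)) powr \<beta>) \<le> D"
    by (auto simp: Bseq_def)
  define S where "S = suminf \<sigma>"
  define Na where "Na = (\<Sum>j\<le>s. norm (a j))"
  have S0: "S \<ge> 0" unfolding S_def by (rule suminf_nonneg[OF summ]) (simp add: \<sigma>_def)
  have D0: "D \<ge> 0" using D[of 0] by simp
  have Na0: "Na \<ge> 0" unfolding Na_def by (intro sum_nonneg) auto
  define C where "C = Na + \<bar>B\<bar> * D + \<bar>B\<bar> * S + 3 * Na + norm (a s)"
  have "norm ((\<Sum>d | 1 \<le> d \<and> real d \<le> T. f d / of_nat d) - a s / of_nat (Suc s) * of_real (ln T ^ Suc s)) \<le> C * (1 + ln T) ^ s"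
    if h: "partial_sum_asymp f a s B \<kappa> \<beta>" and T: "T \<ge> 1" for f T
  proof -
    define N where "N = nat \<lfloor>T\<rfloor>"
    have N: "N \<ge> 1" "real N \<le> T" "T < real N + 1" unfolding N_def using T by linarith+
    define w where "w = 1 + ln T"
    have w: "w \<ge> 1" unfolding w_def using T by simp
    have ws: "w ^ s \<ge> 1" using w by simp
    have lnN0: "0 \<le> ln (real N)" "ln (real N) \<le> ln T" using N T by auto
    then have lnN: "0 \<le> ln (real N)" "ln (real N) \<le> ln T" "ln (real N) \<le> w" unfolding w_def by linarith+
    define R where "R = (\<lambda>n. partial_sum f (real n) - of_nat n * log_poly a s (real n))"
    have R: "norm (R n) \<le> \<bar>B\<bar> * (real n powr \<kappa> * (1 + ln (real n)) powr \<beta>)" if "n \<ge> 1" for n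
      unfolding R_def using partial_sum_asympD[OF h, of "real n"] that by simp
    have S_eq: "(\<Sum>d\<in>{1..n}. f d) = of_nat n * log_poly a s (real n) + R n" for n
      unfolding R_def partial_sum_nat by simp
    define U where "U = (\<lambda>j. \<Sum>n\<in>{1..<N}. ln (real n) ^ j / real (Suc n))"
    have set_eq: "{d. 1 \<le> d \<and> real d \<le> T} = {1..N}"
      unfolding N_def using T by (auto simp: le_nat_floor le_nat_iff le_floor_iff)
    have "(\<Sum>d | 1 \<le> d \<and> real d \<le> T. f d / of_nat d)
       = (\<Sum>n\<in>{1..N}. f n) / of_nat N + (\<Sum>n\<in>{1..<N}. (\<Sum>d\<in>{1..n}. f d) / (of_nat n * of_nat (Suc n)))"
      unfolding set_eq using N(1) by (rule abel_sum_div)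
    also have "(\<Sum>n\<in>{1..N}. f n) / of_nat N = log_poly a s (real N) + R N / of_nat N"
      unfolding S_eq using N(1) by (simp add: add_divide_distrib)
    also have "(\<Sum>n\<in>{1..<N}. (\<Sum>d\<in>{1..n}. f d) / (of_nat n * of_nat (Suc n)))
       = (\<Sum>n\<in>{1..<N}. log_poly a s (real n) / of_nat (Suc n) + R n / (of_nat n * of_nat (Suc n)))"
      unfolding S_eq by (intro sum.cong refl) (simp add: add_divide_distrib)
    also have "\<dots> = (\<Sum>n\<in>{1..<N}. log_poly a s (real n) / of_nat (Suc n)) + (\<Sum>n\<in>{1..<N}. R n / (of_nat n * of_nat (Suc n)))"
      by (rule sum.distrib)
    also have "(\<Sum>n\<in>{1..<N}. log_poly a s (real n) / of_nat (Suc n)) = (\<Sum>j\<le>s. a j * of_real (U j))"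
    proof -
      have "(\<Sum>n\<in>{1..<N}. log_poly a s (real n) / of_nat (Suc n)) = (\<Sum>n\<in>{1..<N}. \<Sum>j\<le>s. a j * of_real (ln (real n) ^ j / real (Suc n)))"
        unfolding log_poly_def by (intro sum.cong refl) (simp add: sum_divide_distrib del: of_nat_Suc)
      also have "\<dots> = (\<Sum>j\<le>s. \<Sum>n\<in>{1..<N}. a j * of_real (ln (real n) ^ j / real (Suc n)))" by (rule sum.swap)
      finally show ?thesis unfolding U_def by (simp only: sum_distrib_left of_real_sum)
    qed
    also have "(\<Sum>j\<le>s. a j * of_real (U j)) = (\<Sum>j<s. a j * of_real (U j)) + a s * of_real (U s)"
      by (simp add: lessThan_Suc_atMost[symmetric])
    finally have eq: "(\<Sum>d | 1 \<le> d \<and> real d \<le> T. f d / of_nat d) - a s / of_nat (Suc s) * of_real (ln T ^ Suc s)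
      = log_poly a s (real N) + R N / of_nat N + (\<Sum>n\<in>{1..<N}. R n / (of_nat n * of_nat (Suc n)))
        + (\<Sum>j<s. a j * of_real (U j)) + a s * of_real (U s - ln T ^ Suc s / real (Suc s))"
      by (simp add: algebra_simps)
    have b1: "norm (log_poly a s (real N)) \<le> Na * w ^ s"
      unfolding Na_def using w lnN by (intro norm_log_poly_le) auto
    have b2: "norm (R N / of_nat N) \<le> \<bar>B\<bar> * D * w ^ s"
    proof -
      have "norm (R N / of_nat N) \<le> \<bar>B\<bar> * (real N powr \<kappa> * (1 + ln (real N)) powr \<beta>) / real N"
        unfolding norm_divide norm_of_nat using N(1) by (intro divide_right_mono R) auto
      also have "\<dots> = \<bar>B\<bar> * (real N powr (\<kappa> - 1) * (1 + ln (real N)) powr \<beta>)"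
        using N(1) by (simp add: powr_diff)
      also have "\<dots> \<le> \<bar>B\<bar> * D" using D[of N] by (intro mult_left_mono) auto
      also have "\<dots> \<le> \<bar>B\<bar> * D * w ^ s" using ws D0 mult_left_mono[OF ws, of "\<bar>B\<bar> * D"] by simp
      finally show ?thesis .
    qed
    have b3: "norm (\<Sum>n\<in>{1..<N}. R n / (of_nat n * of_nat (Suc n))) \<le> \<bar>B\<bar> * S * w ^ s"
    proof -
      have "norm (\<Sum>n\<in>{1..<N}. R n / (of_nat n * of_nat (Suc n))) \<le> (\<Sum>n\<in>{1..<N}. norm (R n / (of_nat n * of_nat (Suc n))))"
        by (rule norm_sum)
      also have "\<dots> \<le> (\<Sum>n\<in>{1..<N}. \<bar>B\<bar> * \<sigma> n)"
      proof (rule sum_mono)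
        fix n assume n: "n \<in> {1..<N}"
        then have n1: "n \<ge> 1" by simp
        have "norm (R n / (of_nat n * of_nat (Suc n))) = norm (R n) / (real n * real (Suc n))"
          by (simp only: norm_divide norm_mult norm_of_nat)
        also have "\<dots> \<le> \<bar>B\<bar> * (real n powr \<kappa> * (1 + ln (real n)) powr \<beta>) / (real n * real n)"
          using n1 by (intro frac_le R mult_left_mono) auto
        also have "\<dots> = \<bar>B\<bar> * \<sigma> n"
          unfolding \<sigma>_def using n1 by (simp add: powr_diff power2_eq_square)
        finally show "norm (R n / (of_nat n * of_nat (Suc n))) \<le> \<bar>B\<bar> * \<sigma> n" .
      qed
      also have "\<dots> = \<bar>B\<bar> * (\<Sum>n\<in>{1..<N}. \<sigma> n)" by (simp add: sum_distrib_left)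
      also have "\<dots> \<le> \<bar>B\<bar> * S"
        unfolding S_def by (intro mult_left_mono sum_le_suminf[OF summ]) (auto simp: \<sigma>_def)
      also have "\<dots> \<le> \<bar>B\<bar> * S * w ^ s" using S0 mult_left_mono[OF ws, of "\<bar>B\<bar> * S"] by simp
      finally show ?thesis .
    qed
    have b4: "norm (\<Sum>j<s. a j * of_real (U j)) \<le> Na * w ^ s"
    proof -
      have "norm (\<Sum>j<s. a j * of_real (U j)) \<le> (\<Sum>j<s. norm (a j * of_real (U j)))" by (rule norm_sum)
      also have "\<dots> \<le> (\<Sum>j<s. norm (a j) * w ^ s)"
      proof (rule sum_mono)
        fix j assume j: "j \<in> {..<s}"
        have "U j \<le> ln (real N) ^ Suc j / real (Suc j)"
          unfolding U_def using N(1) by (rule sum_ln_power_div_bounds)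
        also have "\<dots> \<le> ln (real N) ^ Suc j / 1" using lnN by (intro divide_left_mono) auto
        also have "\<dots> \<le> w ^ Suc j" using lnN by (simp only: div_by_1) (intro power_mono, auto)
        also have "\<dots> \<le> w ^ s" using w j by (intro power_increasing) auto
        finally have "U j \<le> w ^ s" .
        moreover have "0 \<le> U j" unfolding U_def by (intro sum_nonneg divide_nonneg_nonneg zero_le_power) auto
        ultimately have "\<bar>U j\<bar> \<le> w ^ s" by simp
        then show "norm (a j * of_real (U j)) \<le> norm (a j) * w ^ s"
          unfolding norm_mult norm_of_real by (rule mult_left_mono) simp
      qed
      also have "\<dots> = (\<Sum>j<s. norm (a j)) * w ^ s" by (simp add: sum_distrib_right)
      also have "\<dots> \<le> Na * w ^ s"
        unfolding Na_def using ws by (intro mult_right_mono sum_mono2) auto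
      finally show ?thesis .
    qed
    have b5: "norm (a s * of_real (U s - ln T ^ Suc s / real (Suc s))) \<le> (2 * Na + norm (a s)) * w ^ s"
    proof -
      have "ln T ^ Suc s - ln (real N) ^ Suc s \<le> real (Suc s) * ln T ^ s * (ln T - ln (real N))"
        using lnN by (intro power_Suc_diff_bounds) auto
      also have "\<dots> \<le> real (Suc s) * w ^ s * 1"
      proof (intro mult_mono power_mono)
        have "ln T \<le> ln (real (Suc N))" using N T by simp
        also have "\<dots> \<le> ln (real N) + 1 / real N" using ln_Suc_minus_ln_bounds(2)[of N] N(1) by linarith
        also have "\<dots> \<le> ln (real N) + 1" using N(1) by simp
        finally show "ln T - ln (real N) \<le> 1" by simp
      qed (use lnN T w in \<open>auto simp: w_def\<close>)
      finally have 1: "ln T ^ Suc s / real (Suc s) - ln (real N) ^ Suc s / real (Suc s) \<le> w ^ s"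
        by (simp only: diff_divide_distrib[symmetric]) (simp add: field_simps)
      have 2: "ln (real N) ^ Suc s / real (Suc s) \<le> ln T ^ Suc s / real (Suc s)"
        using lnN by (intro divide_right_mono power_mono) auto
      have 3: "ln (real N) ^ s \<le> w ^ s" using lnN by (intro power_mono) auto
      have "U s \<le> ln (real N) ^ Suc s / real (Suc s)"
        unfolding U_def using N(1) by (rule sum_ln_power_div_bounds)
      moreover have "ln (real N) ^ Suc s / real (Suc s) - 2 * ln (real N) ^ s \<le> U s"
        unfolding U_def using N(1) by (rule sum_ln_power_div_bounds)
      ultimately have "\<bar>U s - ln T ^ Suc s / real (Suc s)\<bar> \<le> 3 * w ^ s" using 1 2 3 by linarith
      then have "norm (a s) * \<bar>U s - ln T ^ Suc s / real (Suc s)\<bar> \<le> norm (a s) * (3 * w ^ s)"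
        by (rule mult_left_mono) simp
      also have "\<dots> \<le> (2 * Na + norm (a s)) * w ^ s"
      proof -
        have "norm (a s) \<le> Na" unfolding Na_def by (rule member_le_sum) auto
        then have "3 * norm (a s) * w ^ s \<le> (2 * Na + norm (a s)) * w ^ s"
          using ws by (intro mult_right_mono) auto
        then show ?thesis by simp
      qed
      finally show ?thesis by (simp only: norm_mult norm_of_real)
    qed
    have "norm ((\<Sum>d | 1 \<le> d \<and> real d \<le> T. f d / of_nat d) - a s / of_nat (Suc s) * of_real (ln T ^ Suc s))
      \<le> Na * w ^ s + \<bar>B\<bar> * D * w ^ s + \<bar>B\<bar> * S * w ^ s + Na * w ^ s + (2 * Na + norm (a s)) * w ^ s"
      unfolding eq by (intro norm_triangle_mono b1 b2 b3 b4 b5)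
    also have "\<dots> = C * w ^ s" unfolding C_def by (simp add: algebra_simps)
    finally show ?thesis unfolding w_def .
  qed
  moreover have "C \<ge> 0" unfolding C_def using Na0 D0 S0 by simp
  ultimately show ?thesis by blast
qed

text \<open>
The left-hand side is \<open>v * (ln v ^ j - ln u ^ j)\<close>, and \<open>ln v - ln u \<le> (v - u) / u\<close>. Dividing the power
\<open>(2 * l) ^ s\<close> by \<open>l\<close> expresses the gain of one logarithm without an exponent \<open>s - 1\<close> that would be
truncated at \<open>s = 0\<close>.
\<close>
lemma mult_ln_power_diff_bound:
  fixes u v l :: real
  assumes u: "1 \<le> u" "u \<le> v" "v \<le> 2 * u" and l: "1 \<le> l" "ln v \<le> 2 * l" and j: "j \<le> s"
  shows "\<bar>v * ln v ^ j - u * ln u ^ j - (v - u) * ln u ^ j\<bar> \<le> (v - u) * (real s * (2 * l) ^ s / l)"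
proof (cases j)
  case 0
  then show ?thesis using u l by simp
next
  case (Suc i)
  have ln: "0 \<le> ln u" "ln u \<le> ln v" using u by auto
  have "ln v - ln u = ln (v / u)" using u by (simp add: ln_div)
  also have "\<dots> \<le> v / u - 1" using u by (intro ln_le_minus_one) auto
  also have "\<dots> = (v - u) / u" using u by (simp add: field_simps)
  finally have d: "ln v - ln u \<le> (v - u) / u" .
  have "v * ln v ^ j - u * ln u ^ j - (v - u) * ln u ^ j = v * (ln v ^ j - ln u ^ j)"
    by (simp add: algebra_simps)
  moreover have "0 \<le> v * (ln v ^ j - ln u ^ j)"
    using u ln power_mono[of "ln u" "ln v" j] by (intro mult_nonneg_nonneg) auto
  moreover have "v * (ln v ^ j - ln u ^ j) \<le> (v - u) * (real s * (2 * l) ^ s / l)"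
  proof -
    have "ln v ^ j - ln u ^ j \<le> real j * ln v ^ i * (ln v - ln u)"
      unfolding Suc using ln by (intro power_Suc_diff_bounds) auto
    also have "\<dots> \<le> real s * (2 * l) ^ (s - 1) * ((v - u) / u)"
    proof (intro mult_mono)
      have "ln v ^ i \<le> (2 * l) ^ i" using ln l by (intro power_mono) auto
      also have "\<dots> \<le> (2 * l) ^ (s - 1)" using l j Suc by (intro power_increasing) auto
      finally show "ln v ^ i \<le> (2 * l) ^ (s - 1)" .
    qed (use ln d u l j in auto)
    finally have "v * (ln v ^ j - ln u ^ j) \<le> (2 * u) * (real s * (2 * l) ^ (s - 1) * ((v - u) / u))"
      using u ln power_mono[of "ln u" "ln v" j] by (intro mult_mono) auto
    also have "\<dots> = (v - u) * (real s * (2 * (2 * l) ^ (s - 1)))" using u by simp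
    also have "2 * (2 * l) ^ (s - 1) = (2 * l) ^ s / l"
    proof -
      have "s = Suc (s - 1)" using j Suc by simp
      then have "(2 * l) ^ s = 2 * l * (2 * l) ^ (s - 1)" by (metis power_Suc)
      then show ?thesis using l by simp
    qed
    finally show ?thesis by simp
  qed
  ultimately show ?thesis by linarith
qed

lemma harmonic_sum_le:
  assumes "K \<ge> 1"
  shows "(\<Sum>k\<in>{1..K}. 1 / real k) \<le> 1 + ln (real K)"
  using ln_harm_bounds[of K] assms by linarith

text \<open>
The increment of \<open>z * ln z ^ j\<close> over \<open>(x / k, (x + y) / k]\<close> is \<open>y / k * ln (x / k) ^ j\<close> up to
\<open>O(y / k * (ln x) ^ s / ln x)\<close>, and for \<open>j < s\<close> this main term is of the size of the error. Summing
the errors over \<open>k \<le> K\<close> costs one logarithm.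
\<close>
lemma hyperbola_large_divisors:
  assumes \<kappa>: "0 \<le> \<kappa>" "\<kappa> < 1" and \<beta>: "0 \<le> \<beta>"
  shows "\<exists>C\<ge>0. \<forall>f x y K. partial_sum_asymp f a s B \<kappa> \<beta> \<longrightarrow> exp 1 \<le> x \<longrightarrow> 0 < y \<longrightarrow> y \<le> x \<longrightarrow> 1 \<le> K \<longrightarrow> real K \<le> x \<longrightarrow>
    norm ((\<Sum>k\<in>{1..K}. partial_sum f ((x + y) / real k) - partial_sum f (x / real k))
        - of_real y * (a s / of_nat (Suc s) * of_real (ln x ^ Suc s - ln (x / real K) ^ Suc s)))
    \<le> C * (y * ln x ^ s + x powr \<kappa> * real K powr (1 - \<kappa>) * ln x powr \<beta>)"
proof -
  define Na where "Na = (\<Sum>j\<le>s. norm (a j))"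
  have Na0: "Na \<ge> 0" unfolding Na_def by (intro sum_nonneg) auto
  define C1 where "C1 = 4 * \<bar>B\<bar> * 3 powr \<beta> / (1 - \<kappa>)"
  define C2 where "C2 = Na * (2 * real s * 2 ^ s + 2) + norm (a s)"
  have C0: "C1 \<ge> 0" "C2 \<ge> 0" unfolding C1_def C2_def using \<kappa> Na0 by auto
  have "norm ((\<Sum>k\<in>{1..K}. partial_sum f ((x + y) / real k) - partial_sum f (x / real k))
        - of_real y * (a s / of_nat (Suc s) * of_real (ln x ^ Suc s - ln (x / real K) ^ Suc s)))
    \<le> (C1 + C2) * (y * ln x ^ s + x powr \<kappa> * real K powr (1 - \<kappa>) * ln x powr \<beta>)"
    if h: "partial_sum_asymp f a s B \<kappa> \<beta>" and x: "exp 1 \<le> x" and y: "0 < y" "y \<le> x" and K: "1 \<le> K" "real K \<le> x" for f x y K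
  proof -
    define l where "l = ln x"
    have x1: "x > 1" using x exp_gt_one[of "1::real"] by linarith
    have x2: "x \<ge> 2" using x exp_ge_add_one_self[of "1::real"] by linarith
    have "ln (exp 1) \<le> ln x" using x x1 by (subst ln_le_cancel_iff) auto
    then have l1: "l \<ge> 1" unfolding l_def by simp
    have "ln (x * x) = 2 * l" unfolding l_def using x1 by (simp add: ln_mult)
    define R where "R = (\<lambda>z. partial_sum f z - of_real z * log_poly a s z)"
    define u where "u = (\<lambda>k. x / real k)"
    define v where "v = (\<lambda>k. (x + y) / real k)"
    have uv: "1 \<le> u k" "u k \<le> v k" "v k \<le> 2 * u k" "v k - u k = y / real k" "u k \<le> x" "v k \<le> 2 * x / real k" "ln (v k) \<le> 2 * l"
      if k: "k \<in> {1..K}" for k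
    proof -
      have k1: "real k \<ge> 1" "real k \<le> x" using k K by auto
      show "1 \<le> u k" unfolding u_def using k1 by simp
      show "u k \<le> v k" unfolding u_def v_def using k1 y by (intro divide_right_mono) auto
      show "v k \<le> 2 * u k" unfolding u_def v_def using k1 y by (simp add: field_simps)
      show "v k - u k = y / real k" unfolding u_def v_def by (simp add: add_divide_distrib)
      show ux: "u k \<le> x" unfolding u_def using k1 x1 by (simp add: field_simps)
      show vx: "v k \<le> 2 * x / real k" unfolding v_def using k1 y by (intro divide_right_mono) auto
      have "2 * x / real k \<le> 2 * x / 1" using k1 x1 by (intro divide_left_mono) auto
      then have "v k \<le> x * x" using vx x2 mult_right_mono[of 2 x x] by linarith
      moreover have "0 < v k" unfolding v_def using k1 x1 y by simp
      ultimately have "ln (v k) \<le> ln (x * x)" using x1 by (subst ln_le_cancel_iff) auto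
      then show "ln (v k) \<le> 2 * l" unfolding \<open>ln (x * x) = 2 * l\<close> .
    qed
    have "(\<Sum>k\<in>{1..K}. partial_sum f (v k) - partial_sum f (u k))
       = (\<Sum>k\<in>{1..K}. (of_real (v k) * log_poly a s (v k) - of_real (u k) * log_poly a s (u k)) + (R (v k) - R (u k)))"
      unfolding R_def by (intro sum.cong refl) simp
    also have "\<dots> = (\<Sum>k\<in>{1..K}. of_real (v k) * log_poly a s (v k) - of_real (u k) * log_poly a s (u k)) + (\<Sum>k\<in>{1..K}. R (v k) - R (u k))"
      by (rule sum.distrib)
    finally have eq: "(\<Sum>k\<in>{1..K}. partial_sum f (v k) - partial_sum f (u k))
        = (\<Sum>k\<in>{1..K}. of_real (v k) * log_poly a s (v k) - of_real (u k) * log_poly a s (u k)) + (\<Sum>k\<in>{1..K}. R (v k) - R (u k))" .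
    have err: "norm (\<Sum>k\<in>{1..K}. R (v k) - R (u k)) \<le> C1 * (x powr \<kappa> * real K powr (1 - \<kappa>) * l powr \<beta>)"
    proof -
      have Rz: "norm (R z) \<le> \<bar>B\<bar> * (2 * x powr \<kappa> * real k powr (- \<kappa>) * (3 powr \<beta> * l powr \<beta>))"
        if z: "1 \<le> z" "z \<le> 2 * x / real k" "ln z \<le> 2 * l" and k: "k \<in> {1..K}" for z k
      proof -
        have "norm (R z) \<le> \<bar>B\<bar> * (z powr \<kappa> * (1 + ln z) powr \<beta>)"
          unfolding R_def using h z(1) by (rule partial_sum_asympD)
        also have "\<dots> \<le> \<bar>B\<bar> * ((2 * x powr \<kappa> * real k powr (- \<kappa>)) * (3 powr \<beta> * l powr \<beta>))"
        proof (intro mult_left_mono mult_mono)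
          have "z powr \<kappa> \<le> (2 * x / real k) powr \<kappa>" using z \<kappa> by (intro powr_mono2) auto
          also have "\<dots> = 2 powr \<kappa> * x powr \<kappa> * real k powr (- \<kappa>)"
            by (simp add: powr_divide powr_mult powr_minus_divide)
          also have "\<dots> \<le> 2 powr 1 * x powr \<kappa> * real k powr (- \<kappa>)"
            using \<kappa> by (intro mult_right_mono powr_mono) auto
          finally show "z powr \<kappa> \<le> 2 * x powr \<kappa> * real k powr (- \<kappa>)" by simp
          have "(1 + ln z) powr \<beta> \<le> (3 * l) powr \<beta>" using z l1 \<beta> by (intro powr_mono2) auto
          then show "(1 + ln z) powr \<beta> \<le> 3 powr \<beta> * l powr \<beta>" using l1 by (simp add: powr_mult)
        qed auto
        finally show ?thesis .
      qed
      have "norm (\<Sum>k\<in>{1..K}. R (v k) - R (u k)) \<le> (\<Sum>k\<in>{1..K}. norm (R (v k) - R (u k)))" by (rule norm_sum)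
      also have "\<dots> \<le> (\<Sum>k\<in>{1..K}. 4 * \<bar>B\<bar> * 3 powr \<beta> * x powr \<kappa> * l powr \<beta> * real k powr (- \<kappa>))"
      proof (rule sum_mono)
        fix k assume k: "k \<in> {1..K}"
        have "norm (R (v k) - R (u k)) \<le> norm (R (v k)) + norm (R (u k))" by (rule norm_triangle_ineq4)
        also have "\<dots> \<le> \<bar>B\<bar> * (2 * x powr \<kappa> * real k powr (- \<kappa>) * (3 powr \<beta> * l powr \<beta>)) + \<bar>B\<bar> * (2 * x powr \<kappa> * real k powr (- \<kappa>) * (3 powr \<beta> * l powr \<beta>))"
        proof (rule add_mono)
          have "ln (u k) \<le> ln (v k)" using uv(1,2)[OF k] by auto
          then have lnu: "ln (u k) \<le> 2 * l" using uv(7)[OF k] by linarith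
          have vk: "1 \<le> v k" "u k \<le> 2 * x / real k" using uv(1,2,6)[OF k] by linarith+
          show "norm (R (v k)) \<le> \<bar>B\<bar> * (2 * x powr \<kappa> * real k powr (- \<kappa>) * (3 powr \<beta> * l powr \<beta>))"
            by (rule Rz[OF vk(1) uv(6)[OF k] uv(7)[OF k] k])
          show "norm (R (u k)) \<le> \<bar>B\<bar> * (2 * x powr \<kappa> * real k powr (- \<kappa>) * (3 powr \<beta> * l powr \<beta>))"
            by (rule Rz[OF uv(1)[OF k] vk(2) lnu k])
        qed
        finally show "norm (R (v k) - R (u k)) \<le> 4 * \<bar>B\<bar> * 3 powr \<beta> * x powr \<kappa> * l powr \<beta> * real k powr (- \<kappa>)"
          by (simp add: mult_ac)
      qed
      also have "\<dots> = 4 * \<bar>B\<bar> * 3 powr \<beta> * x powr \<kappa> * l powr \<beta> * (\<Sum>k\<in>{1..K}. real k powr (- \<kappa>))"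
        by (simp add: sum_distrib_left)
      also have "\<dots> \<le> 4 * \<bar>B\<bar> * 3 powr \<beta> * x powr \<kappa> * l powr \<beta> * (real K powr (1 - \<kappa>) / (1 - \<kappa>))"
        using sum_powr_neg_le[OF \<kappa>, of K] by (intro mult_left_mono) auto
      also have "\<dots> = C1 * (x powr \<kappa> * real K powr (1 - \<kappa>) * l powr \<beta>)" unfolding C1_def by simp
      finally show ?thesis .
    qed
    \<comment> \<open>The error of the power \<open>j\<close> at \<open>k\<close>; only for \<open>j = s\<close> is there a main term.\<close>
    define e where "e = (\<lambda>j k. v k * ln (v k) ^ j - u k * ln (u k) ^ j - (if j = s then (v k - u k) * ln (u k) ^ s else 0))"
    have ebound: "\<bar>e j k\<bar> \<le> y / real k * ((real s * 2 ^ s + 1) * (l ^ s / l))" if j: "j \<le> s" and k: "k \<in> {1..K}" for j k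
    proof -
      have 1: "\<bar>v k * ln (v k) ^ j - u k * ln (u k) ^ j - (v k - u k) * ln (u k) ^ j\<bar> \<le> (v k - u k) * (real s * (2 * l) ^ s / l)"
        using uv[OF k] l1 j by (intro mult_ln_power_diff_bound) auto
      have vu0: "0 \<le> v k - u k" using uv[OF k] by simp
      have 2: "\<bar>(v k - u k) * ln (u k) ^ j\<bar> \<le> (v k - u k) * (l ^ s / l)" if "j \<noteq> s"
      proof -
        have "ln (u k) \<le> l" "0 \<le> ln (u k)" unfolding l_def using uv[OF k] x1 by auto
        then have "ln (u k) ^ j \<le> l ^ j" by (intro power_mono) auto
        also have "\<dots> \<le> l ^ (s - 1)" using l1 that j by (intro power_increasing) auto
        also have "\<dots> = l ^ s / l"
        proof -
          have "s = Suc (s - 1)" using that j by simp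
          then have "l ^ s = l * l ^ (s - 1)" by (metis power_Suc)
          then show ?thesis using l1 by simp
        qed
        finally have "(v k - u k) * ln (u k) ^ j \<le> (v k - u k) * (l ^ s / l)" using vu0 by (intro mult_left_mono) auto
        moreover have "0 \<le> (v k - u k) * ln (u k) ^ j" using vu0 \<open>0 \<le> ln (u k)\<close> by simp
        ultimately show ?thesis by simp
      qed
      have "0 \<le> (v k - u k) * (l ^ s / l)" using vu0 l1 by simp
      then have "\<bar>e j k\<bar> \<le> (v k - u k) * (real s * (2 * l) ^ s / l) + (v k - u k) * (l ^ s / l)"
        using 1 2 unfolding e_def by (cases "j = s") auto
      also have "\<dots> = y / real k * ((real s * 2 ^ s + 1) * (l ^ s / l))"
        unfolding uv(4)[OF k] by (simp add: power_mult_distrib algebra_simps add_divide_distrib)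
      finally show ?thesis .
    qed
    have main: "(\<Sum>k\<in>{1..K}. of_real (v k) * log_poly a s (v k) - of_real (u k) * log_poly a s (u k))
        = a s * of_real (\<Sum>k\<in>{1..K}. (v k - u k) * ln (u k) ^ s) + (\<Sum>k\<in>{1..K}. \<Sum>j\<le>s. a j * of_real (e j k))"
    proof -
      have "of_real (v k) * log_poly a s (v k) - of_real (u k) * log_poly a s (u k)
         = a s * of_real ((v k - u k) * ln (u k) ^ s) + (\<Sum>j\<le>s. a j * of_real (e j k))" for k
      proof -
        have "of_real (v k) * log_poly a s (v k) - of_real (u k) * log_poly a s (u k)
           = (\<Sum>j\<le>s. a j * of_real (v k * ln (v k) ^ j - u k * ln (u k) ^ j))"
          unfolding log_poly_def sum_distrib_left sum_subtractf[symmetric]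
          by (intro sum.cong refl) (simp add: algebra_simps)
        also have "\<dots> = (\<Sum>j\<le>s. a j * of_real (if j = s then (v k - u k) * ln (u k) ^ s else 0) + a j * of_real (e j k))"
          unfolding e_def by (intro sum.cong refl) (simp add: algebra_simps)
        also have "\<dots> = (\<Sum>j\<le>s. a j * of_real (if j = s then (v k - u k) * ln (u k) ^ s else 0)) + (\<Sum>j\<le>s. a j * of_real (e j k))"
          by (rule sum.distrib)
        also have "(\<Sum>j\<le>s. a j * of_real (if j = s then (v k - u k) * ln (u k) ^ s else 0)) = (\<Sum>j\<le>s. if j = s then a s * of_real ((v k - u k) * ln (u k) ^ s) else 0)"
          by (intro sum.cong refl) simp
        also have "\<dots> = a s * of_real ((v k - u k) * ln (u k) ^ s)" by (simp add: sum.delta)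
        finally show ?thesis .
      qed
      then show ?thesis by (simp add: sum.distrib sum_distrib_left)
    qed
    have err2: "norm (\<Sum>k\<in>{1..K}. \<Sum>j\<le>s. a j * of_real (e j k)) \<le> Na * (2 * real s * 2 ^ s + 2) * (y * l ^ s)"
    proof -
      have "norm (\<Sum>k\<in>{1..K}. \<Sum>j\<le>s. a j * of_real (e j k)) \<le> (\<Sum>k\<in>{1..K}. \<Sum>j\<le>s. norm (a j * of_real (e j k)))"
        by (rule order.trans[OF norm_sum sum_mono[OF norm_sum]])
      also have "\<dots> \<le> (\<Sum>k\<in>{1..K}. \<Sum>j\<le>s. norm (a j) * (y / real k * ((real s * 2 ^ s + 1) * (l ^ s / l))))"
        unfolding norm_mult norm_of_real by (intro sum_mono mult_left_mono ebound) auto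
      also have "\<dots> = (\<Sum>k\<in>{1..K}. Na * (y / real k * ((real s * 2 ^ s + 1) * (l ^ s / l))))"
        unfolding Na_def sum_distrib_right ..
      also have "\<dots> = (\<Sum>k\<in>{1..K}. Na * y * (real s * 2 ^ s + 1) * (l ^ s / l) * (1 / real k))"
        by (intro sum.cong refl) (simp add: mult_ac)
      also have "\<dots> = Na * y * (real s * 2 ^ s + 1) * (l ^ s / l) * (\<Sum>k\<in>{1..K}. 1 / real k)"
        by (simp only: sum_distrib_left)
      also have "\<dots> \<le> Na * y * (real s * 2 ^ s + 1) * (l ^ s / l) * (2 * l)"
      proof (rule mult_left_mono)
        have "(\<Sum>k\<in>{1..K}. 1 / real k) \<le> 1 + ln (real K)" using K(1) by (rule harmonic_sum_le)
        also have "ln (real K) \<le> l" unfolding l_def using K by simp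
        finally show "(\<Sum>k\<in>{1..K}. 1 / real k) \<le> 2 * l" using l1 by simp
      qed (use Na0 y l1 in auto)
      also have "\<dots> = Na * (2 * real s * 2 ^ s + 2) * (y * l ^ s)" using l1 by (simp add: algebra_simps)
      finally show ?thesis .
    qed
    define W where "W = (\<Sum>k\<in>{1..K}. ln (u k) ^ s / real k) - (l ^ Suc s - ln (x / real K) ^ Suc s) / real (Suc s)"
    have W: "\<bar>W\<bar> \<le> l ^ s"
      unfolding W_def l_def u_def using K by (rule sum_ln_quotient_power_div_bounds)
    have mainW: "(\<Sum>k\<in>{1..K}. (v k - u k) * ln (u k) ^ s) = y * ((l ^ Suc s - ln (x / real K) ^ Suc s) / real (Suc s)) + y * W"
    proof -
      have "(\<Sum>k\<in>{1..K}. (v k - u k) * ln (u k) ^ s) = (\<Sum>k\<in>{1..K}. y * (ln (u k) ^ s / real k))"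
        using uv(4) by (intro sum.cong refl) simp
      also have "\<dots> = y * (\<Sum>k\<in>{1..K}. ln (u k) ^ s / real k)" by (simp only: sum_distrib_left)
      also have "\<dots> = y * ((l ^ Suc s - ln (x / real K) ^ Suc s) / real (Suc s)) + y * W"
        unfolding W_def by (simp only: distrib_left[symmetric]) simp
      finally show ?thesis .
    qed
    have "(\<Sum>k\<in>{1..K}. partial_sum f ((x + y) / real k) - partial_sum f (x / real k))
        - of_real y * (a s / of_nat (Suc s) * of_real (ln x ^ Suc s - ln (x / real K) ^ Suc s))
       = a s * of_real (y * W) + (\<Sum>k\<in>{1..K}. \<Sum>j\<le>s. a j * of_real (e j k)) + (\<Sum>k\<in>{1..K}. R (v k) - R (u k))"
    proof -
      define DD where "DD = l ^ Suc s - ln (x / real K) ^ Suc s"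
      define E1 where "E1 = (\<Sum>k\<in>{1..K}. R (v k) - R (u k))"
      define E2 where "E2 = (\<Sum>k\<in>{1..K}. \<Sum>j\<le>s. a j * of_real (e j k))"
      have alg: "a s * of_real (y * (DD / real (Suc s)) + y * W) - of_real y * (a s / of_nat (Suc s) * of_real DD) = a s * of_real (y * W)"
        by (simp add: distrib_left del: of_nat_Suc)
      have "(\<Sum>k\<in>{1..K}. partial_sum f (v k) - partial_sum f (u k)) - of_real y * (a s / of_nat (Suc s) * of_real DD)
        = (a s * of_real (y * (DD / real (Suc s)) + y * W) - of_real y * (a s / of_nat (Suc s) * of_real DD)) + E2 + E1"
        unfolding eq main mainW DD_def[symmetric] E1_def[symmetric] E2_def[symmetric] by simp
      then show ?thesis unfolding alg unfolding DD_def E1_def E2_def u_def v_def l_def .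
    qed
    also have "norm \<dots> \<le> norm (a s) * (y * l ^ s) + Na * (2 * real s * 2 ^ s + 2) * (y * l ^ s) + C1 * (x powr \<kappa> * real K powr (1 - \<kappa>) * l powr \<beta>)"
    proof (intro norm_triangle_mono err err2)
      have "norm (a s * of_real (y * W)) = norm (a s) * (y * \<bar>W\<bar>)"
        using y(1) by (simp add: norm_mult abs_mult)
      also have "\<dots> \<le> norm (a s) * (y * l ^ s)" using W y(1) by (intro mult_left_mono) auto
      finally show "norm (a s * of_real (y * W)) \<le> norm (a s) * (y * l ^ s)" .
    qed
    also have "\<dots> = C2 * (y * l ^ s) + C1 * (x powr \<kappa> * real K powr (1 - \<kappa>) * l powr \<beta>)"
      unfolding C2_def by (simp add: algebra_simps)
    also have "\<dots> \<le> (C1 + C2) * (y * l ^ s) + (C1 + C2) * (x powr \<kappa> * real K powr (1 - \<kappa>) * l powr \<beta>)"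
      using C0 y l1 by (intro add_mono mult_right_mono) auto
    finally show ?thesis unfolding l_def by (simp only: distrib_left)
  qed
  then show ?thesis using C0 by (intro exI[of _ "C1 + C2"]) auto
qed

section \<open>The hyperbola method in a short interval\<close>

lemma sum_piltz_tau_le:
  assumes "z \<ge> 1"
  shows "(\<Sum>n | 1 \<le> n \<and> real n \<le> z. real (piltz_tau (Suc m) n)) \<le> z * (1 + ln z) ^ m"
  using assms
proof (induction m arbitrary: z)
  case 0
  have "(\<Sum>n | 1 \<le> n \<and> real n \<le> z. real (piltz_tau (Suc 0) n)) = (\<Sum>n | 1 \<le> n \<and> real n \<le> z. 1)"
  proof (intro sum.cong refl)
    fix n assume "n \<in> {n. 1 \<le> n \<and> real n \<le> z}"
    then have n: "n > 0" by auto
    have "(\<Sum>d | d dvd n. piltz_tau 0 d) = (\<Sum>d\<in>{1}. piltz_tau 0 d)"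
      using n by (intro sum.mono_neutral_right) (auto simp: piltz_tau_0)
    then show "real (piltz_tau (Suc 0) n) = 1" using n by (simp add: piltz_tau_Suc piltz_tau_0)
  qed
  also have "\<dots> = real (nat \<lfloor>z\<rfloor>)"
  proof -
    have "{n. 1 \<le> n \<and> real n \<le> z} = {1..nat \<lfloor>z\<rfloor>}"
      using 0 by (auto simp: le_nat_floor le_nat_iff le_floor_iff)
    then show ?thesis by simp
  qed
  also have "\<dots> \<le> z" using 0 by linarith
  finally show ?case by simp
next
  case (Suc m)
  define N where "N = nat \<lfloor>z\<rfloor>"
  have N: "N \<ge> 1" "real N \<le> z" unfolding N_def using Suc.prems by linarith+
  have set_eq: "{n. 1 \<le> n \<and> real n \<le> z} = {1..N}"
    unfolding N_def using Suc.prems by (auto simp: le_nat_floor le_nat_iff le_floor_iff)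
  have "(\<Sum>n | 1 \<le> n \<and> real n \<le> z. real (piltz_tau (Suc (Suc m)) n)) = (\<Sum>n\<in>{1..N}. \<Sum>d | d dvd n. real (piltz_tau (Suc m) d))"
    unfolding set_eq by (intro sum.cong refl) (simp add: piltz_tau_Suc[of _ "Suc m"])
  also have "\<dots> = (\<Sum>n\<in>{1..N}. \<Sum>k | k dvd n. real (piltz_tau (Suc m) (n div k)))"
  proof (rule sum.cong[OF refl])
    fix n assume "n \<in> {1..N}"
    then show "(\<Sum>d | d dvd n. real (piltz_tau (Suc m) d)) = (\<Sum>k | k dvd n. real (piltz_tau (Suc m) (n div k)))"
      by (intro sum.reindex_bij_witness[of _ "\<lambda>k. n div k" "\<lambda>k. n div k"]) auto
  qed
  also have "\<dots> = (\<Sum>n\<in>{1..N}. \<Sum>k\<in>{k \<in> {1..N}. k dvd n}. real (piltz_tau (Suc m) (n div k)))"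
  proof (intro sum.cong refl)
    fix n assume n: "n \<in> {1..N}"
    then show "{k. k dvd n} = {k \<in> {1..N}. k dvd n}"
      using dvd_imp_le[of _ n] by (auto intro: order.trans dvd_pos_nat simp: Suc_le_eq)
  qed
  also have "\<dots> = (\<Sum>k\<in>{1..N}. \<Sum>n\<in>{n \<in> {1..N}. k dvd n}. real (piltz_tau (Suc m) (n div k)))"
    by (rule sum.swap_restrict) auto
  also have "\<dots> = (\<Sum>k\<in>{1..N}. \<Sum>d | 1 \<le> d \<and> real d \<le> z / real k. real (piltz_tau (Suc m) d))"
  proof (rule sum.cong[OF refl])
    fix k assume k: "k \<in> {1..N}"
    have le: "k * d \<le> N \<longleftrightarrow> real d \<le> z / real k" for d
    proof -
      have "k * d \<le> N \<longleftrightarrow> real (k * d) \<le> z"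
        unfolding N_def using Suc.prems by (simp add: le_nat_iff le_floor_iff)
      then show ?thesis using k by (simp add: field_simps)
    qed
    show "(\<Sum>n\<in>{n \<in> {1..N}. k dvd n}. real (piltz_tau (Suc m) (n div k))) = (\<Sum>d | 1 \<le> d \<and> real d \<le> z / real k. real (piltz_tau (Suc m) d))"
    proof -
      have img: "{n \<in> {1..N}. k dvd n} = (\<lambda>d. k * d) ` {d. 1 \<le> d \<and> real d \<le> z / real k}"
      proof (intro equalityI subsetI)
        fix n assume n: "n \<in> {n \<in> {1..N}. k dvd n}"
        then obtain d where d: "n = k * d" unfolding dvd_def by blast
        have "1 \<le> d" using n unfolding d by (cases d) auto
        moreover have "real d \<le> z / real k" using n le[of d] unfolding d by simp
        ultimately show "n \<in> (\<lambda>d. k * d) ` {d. 1 \<le> d \<and> real d \<le> z / real k}" unfolding d by blast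
      next
        fix n assume "n \<in> (\<lambda>d. k * d) ` {d. 1 \<le> d \<and> real d \<le> z / real k}"
        then obtain d where d: "n = k * d" "1 \<le> d" "real d \<le> z / real k" by blast
        then show "n \<in> {n \<in> {1..N}. k dvd n}" using le[of d] k by simp
      qed
      have "inj_on (\<lambda>d. k * d) {d. 1 \<le> d \<and> real d \<le> z / real k}" using k by (auto simp: inj_on_def)
      then show ?thesis unfolding img using k by (simp add: sum.reindex)
    qed
  qed
  also have "\<dots> \<le> (\<Sum>k\<in>{1..N}. z * (1 + ln z) ^ m * (1 / real k))"
  proof (rule sum_mono)
    fix k assume k: "k \<in> {1..N}"
    then have k1: "real k \<ge> 1" "real k \<le> z" using N by auto
    then have zk: "z / real k \<ge> 1" by simp
    have "(\<Sum>d | 1 \<le> d \<and> real d \<le> z / real k. real (piltz_tau (Suc m) d)) \<le> z / real k * (1 + ln (z / real k)) ^ m"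
      using zk by (rule Suc.IH)
    also have "\<dots> \<le> z / real k * (1 + ln z) ^ m"
    proof (intro mult_left_mono power_mono add_left_mono)
      have "z / real k \<le> z / 1" using k1 by (intro divide_left_mono) auto
      then show "ln (z / real k) \<le> ln z" using zk by simp
    qed (use zk k1 in auto)
    finally show "(\<Sum>d | 1 \<le> d \<and> real d \<le> z / real k. real (piltz_tau (Suc m) d)) \<le> z * (1 + ln z) ^ m * (1 / real k)" by simp
  qed
  also have "\<dots> = z * (1 + ln z) ^ m * (\<Sum>k\<in>{1..N}. 1 / real k)" by (simp add: sum_distrib_left)
  also have "\<dots> \<le> z * (1 + ln z) ^ m * (1 + ln z)"
  proof (rule mult_left_mono)
    have "(\<Sum>k\<in>{1..N}. 1 / real k) \<le> 1 + ln (real N)" using N(1) by (rule harmonic_sum_le)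
    also have "ln (real N) \<le> ln z" using N by simp
    finally show "(\<Sum>k\<in>{1..N}. 1 / real k) \<le> 1 + ln z" by simp
  qed (use Suc.prems in auto)
  finally show ?case by (simp add: mult_ac)
qed

text \<open>
If \<open>d > x / K\<close> and \<open>k \<ge> K + 1\<close>, then \<open>d * k > x + x / K \<ge> x + y\<close> as \<open>K * y \<le> x\<close>; conversely,
\<open>d * k > x\<close> and \<open>k \<le> K\<close> imply \<open>d > x / K\<close>. Thus cutting at
\<open>d = x / K\<close> is the same as cutting at \<open>k = K\<close>, and no incomplete intervals arise.
\<close>
lemma short_sum_hyperbola_split:
  fixes f :: "nat \<Rightarrow> complex" and x y :: real
  assumes K: "1 \<le> K" and x: "0 < x" and y: "0 < y" and Ky: "real K * y \<le> x"
  shows "(\<Sum>n | x < real n \<and> real n \<le> x + y. \<Sum>d | d dvd n. f d)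
    = (\<Sum>d | 1 \<le> d \<and> real d \<le> x / real K. f d * of_nat (card {n. x < real n \<and> real n \<le> x + y \<and> d dvd n}))
      + (\<Sum>k\<in>{1..K}. partial_sum f ((x + y) / real k) - partial_sum f (x / real k))"
proof -
  define I where "I = {n. x < real n \<and> real n \<le> x + y}"
  define T where "T = x / real K"
  define D where "D = {d. 1 \<le> d \<and> real d \<le> T}"
  have finI: "finite I" unfolding I_def by (rule finite_real_interval)
  have finD: "finite D" unfolding D_def by (rule finite_subset[of _ "{..nat \<lfloor>T\<rfloor>}"]) (auto simp: le_nat_floor)
  have I0: "n > 0" if "n \<in> I" for n using that x by (auto simp: I_def intro: Nat.gr0I)
  have split: "(\<Sum>d | d dvd n. f d) = (\<Sum>d\<in>{d \<in> D. d dvd n}. f d) + (\<Sum>d | d dvd n \<and> T < real d. f d)" if n: "n \<in> I" for n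
  proof -
    have e: "{d. d dvd n} = {d \<in> D. d dvd n} \<union> {d. d dvd n \<and> T < real d}"
      using I0[OF n] by (auto simp: D_def Suc_le_eq intro: dvd_pos_nat)
    have fin: "finite {d. d dvd n}" using I0[OF n] by simp
    show ?thesis unfolding e
      by (rule sum.union_disjoint) (use fin in \<open>auto simp: D_def intro: finite_subset\<close>)
  qed
  have "(\<Sum>n\<in>I. \<Sum>d | d dvd n. f d) = (\<Sum>n\<in>I. (\<Sum>d\<in>{d \<in> D. d dvd n}. f d) + (\<Sum>d | d dvd n \<and> T < real d. f d))"
    by (intro sum.cong refl split)
  also have "\<dots> = (\<Sum>n\<in>I. \<Sum>d\<in>{d \<in> D. d dvd n}. f d) + (\<Sum>n\<in>I. \<Sum>d | d dvd n \<and> T < real d. f d)"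
    by (rule sum.distrib)
  also have "(\<Sum>n\<in>I. \<Sum>d\<in>{d \<in> D. d dvd n}. f d) = (\<Sum>d\<in>D. \<Sum>n\<in>{n \<in> I. d dvd n}. f d)"
    using finI finD by (rule sum.swap_restrict)
  also have "\<dots> = (\<Sum>d\<in>D. f d * of_nat (card {n. x < real n \<and> real n \<le> x + y \<and> d dvd n}))"
  proof (intro sum.cong refl)
    fix d
    have "{n \<in> I. d dvd n} = {n. x < real n \<and> real n \<le> x + y \<and> d dvd n}" by (auto simp: I_def)
    then show "(\<Sum>n\<in>{n \<in> I. d dvd n}. f d) = f d * of_nat (card {n. x < real n \<and> real n \<le> x + y \<and> d dvd n})"
      by (simp add: mult.commute)
  qed
  also have "(\<Sum>n\<in>I. \<Sum>d | d dvd n \<and> T < real d. f d) = (\<Sum>k\<in>{1..K}. \<Sum>d | x / real k < real d \<and> real d \<le> (x + y) / real k. f d)"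
  proof -
    have "(\<Sum>n\<in>I. \<Sum>d | d dvd n \<and> T < real d. f d) = (\<Sum>(n, d)\<in>(SIGMA n:I. {d. d dvd n \<and> T < real d}). f d)"
      using finI I0 by (intro sum.Sigma) auto
    also have "\<dots> = (\<Sum>(k, d)\<in>(SIGMA k:{1..K}. {d. x / real k < real d \<and> real d \<le> (x + y) / real k}). f d)"
    proof (rule sum.reindex_bij_witness[of _ "\<lambda>(k, d). (d * k, d)" "\<lambda>(n, d). (n div d, d)"])
      fix p assume p: "p \<in> (SIGMA n:I. {d. d dvd n \<and> T < real d})"
      obtain n d where nd: "p = (n, d)" by (cases p)
      have n: "n \<in> I" "d dvd n" "T < real d" using p unfolding nd by auto
      obtain k where k: "n = d * k" using n(2) by (auto simp: dvd_def)
      have pos: "d > 0" "k > 0" using I0[OF n(1)] unfolding k by auto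
      have div: "n div d = k" using k pos by simp
      have nx: "x < real d * real k" "real d * real k \<le> x + y" using n(1) unfolding I_def k by auto
      show "(case (case p of (n, d) \<Rightarrow> (n div d, d)) of (k, d) \<Rightarrow> (d * k, d)) = p"
        unfolding nd using div k by simp
      have "k \<le> K"
      proof (rule ccontr)
        assume "\<not> k \<le> K"
        then have "real k \<ge> real K + 1" by linarith
        then have "real d * (real K + 1) \<le> real d * real k" by (intro mult_left_mono) auto
        then have 1: "real d * (real K + 1) \<le> x + y" using nx by linarith
        have "x < real d * real K" using n(3) K unfolding T_def by (simp add: field_simps)
        then have "x * (real K + 1) < real d * real K * (real K + 1)" using K by (intro mult_strict_right_mono) auto
        also have "\<dots> = (real d * (real K + 1)) * real K" by simp
        also have "\<dots> \<le> (x + y) * real K" using 1 by (intro mult_right_mono) auto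
        finally have "x < real K * y" by (simp add: algebra_simps)
        with Ky show False by linarith
      qed
      moreover have "x / real k < real d" "real d \<le> (x + y) / real k" using nx pos by (auto simp: field_simps)
      ultimately show "(case p of (n, d) \<Rightarrow> (n div d, d)) \<in> (SIGMA k:{1..K}. {d. x / real k < real d \<and> real d \<le> (x + y) / real k})"
        unfolding nd using div pos by simp
      show "(case (case p of (n, d) \<Rightarrow> (n div d, d)) of (k, d) \<Rightarrow> f d) = (case p of (n, d) \<Rightarrow> f d)"
        unfolding nd by simp
    next
      fix p assume p: "p \<in> (SIGMA k:{1..K}. {d. x / real k < real d \<and> real d \<le> (x + y) / real k})"
      obtain k d where kd: "p = (k, d)" by (cases p)
      have k: "k \<ge> 1" "k \<le> K" "x / real k < real d" "real d \<le> (x + y) / real k" using p unfolding kd by auto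
      have "0 < x / real k" using x k(1) by simp
      then have d0: "d > 0" using k(3) by (auto intro: Nat.gr0I)
      show "(case (case p of (k, d) \<Rightarrow> (d * k, d)) of (n, d) \<Rightarrow> (n div d, d)) = p"
        unfolding kd using d0 by simp
      have "T \<le> x / real k" unfolding T_def using k(1,2) x by (intro divide_left_mono) auto
      then have "T < real d" using k(3) by linarith
      moreover have "x < real d * real k" "real d * real k \<le> x + y" using k by (auto simp: field_simps)
      ultimately show "(case p of (k, d) \<Rightarrow> (d * k, d)) \<in> (SIGMA n:I. {d. d dvd n \<and> T < real d})"
        unfolding kd I_def by simp
    qed
    also have "\<dots> = (\<Sum>k\<in>{1..K}. \<Sum>d | x / real k < real d \<and> real d \<le> (x + y) / real k. f d)"
      using finite_real_interval by (intro sum.Sigma[symmetric]) auto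
    finally show ?thesis .
  qed
  also have "\<dots> = (\<Sum>k\<in>{1..K}. partial_sum f ((x + y) / real k) - partial_sum f (x / real k))"
  proof (intro sum.cong refl)
    fix k assume k: "k \<in> {1..K}"
    define u v where "u = x / real k" and "v = (x + y) / real k"
    have u: "0 < u" "u \<le> v" unfolding u_def v_def using k x y by (auto intro: divide_right_mono)
    have e: "{n. 1 \<le> n \<and> real n \<le> v} = {n. 1 \<le> n \<and> real n \<le> u} \<union> {d. u < real d \<and> real d \<le> v}"
      using u by (auto simp: Suc_le_eq intro: Nat.gr0I)
    have fin: "finite {n. 1 \<le> n \<and> real n \<le> u}" by (rule finite_subset[of _ "{..nat \<lfloor>u\<rfloor>}"]) (auto simp: le_nat_floor)
    have "partial_sum f v = partial_sum f u + (\<Sum>d | u < real d \<and> real d \<le> v. f d)"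
      unfolding partial_sum_def e
      by (rule sum.union_disjoint[OF fin finite_real_interval]) auto
    then show "(\<Sum>d | x / real k < real d \<and> real d \<le> (x + y) / real k. f d) = partial_sum f ((x + y) / real k) - partial_sum f (x / real k)"
      unfolding u_def v_def by simp
  qed
  finally show ?thesis unfolding I_def D_def T_def .
qed

lemma sum_tau_window_eq:
  fixes x y u v :: real
  assumes x: "0 \<le> x"
  shows "(\<Sum>n | x < real n \<and> real n \<le> x + y. tau_window m n u v)
    = (\<Sum>d | u < real d \<and> real d \<le> v. real (piltz_tau m d) * real (card {n. x < real n \<and> real n \<le> x + y \<and> d dvd n}))"
proof -
  define I where "I = {n. x < real n \<and> real n \<le> x + y}"
  define D where "D = {d. u < real d \<and> real d \<le> v}"
  have fin: "finite I" "finite D" unfolding I_def D_def by (rule finite_real_interval)+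
  have "(\<Sum>n\<in>I. tau_window m n u v) = (\<Sum>n\<in>I. \<Sum>d\<in>{d \<in> D. d dvd n}. real (piltz_tau m d))"
    unfolding tau_window_def D_def by (intro sum.cong refl) auto
  also have "\<dots> = (\<Sum>d\<in>D. \<Sum>n\<in>{n \<in> I. d dvd n}. real (piltz_tau m d))"
    using fin by (rule sum.swap_restrict)
  also have "\<dots> = (\<Sum>d\<in>D. real (piltz_tau m d) * real (card {n. x < real n \<and> real n \<le> x + y \<and> d dvd n}))"
  proof (intro sum.cong refl)
    fix d
    have "{n \<in> I. d dvd n} = {n. x < real n \<and> real n \<le> x + y \<and> d dvd n}" by (auto simp: I_def)
    then show "(\<Sum>n\<in>{n \<in> I. d dvd n}. real (piltz_tau m d)) = real (piltz_tau m d) * real (card {n. x < real n \<and> real n \<le> x + y \<and> d dvd n})"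
      by (simp add: mult.commute)
  qed
  finally show ?thesis unfolding I_def D_def .
qed

text \<open>
The error of counting the multiples of \<open>d\<close> by \<open>y / d\<close> is at most 1, which is good enough for \<open>d \<le> y\<close>. For \<open>y < d \<le> T\<close>
both the count and \<open>y / d\<close> are bounded separately. The first is the windowed divisor sum over \<open>(x, x + y]\<close>; the second is
at most \<open>2 * y / x\<close> times the count of multiples in \<open>(x, 2 * x]\<close>, hence again a windowed divisor sum.
\<close>
lemma small_divisors_error:
  assumes m: "m \<ge> 1"
  shows "\<exists>C\<ge>0. \<forall>(f :: nat \<Rightarrow> complex) A \<delta> x y T. 0 \<le> A \<longrightarrow> 0 \<le> \<delta> \<longrightarrow>
    (\<forall>n\<ge>1. norm (f n) \<le> A * real (piltz_tau m n) * ln (exp 1 * real n) powr \<delta>) \<longrightarrow>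
    exp 1 \<le> x \<longrightarrow> x powr (2/5) \<le> y \<longrightarrow> 1 \<le> y \<longrightarrow> y \<le> T \<longrightarrow> T \<le> x / exp 1 \<longrightarrow> T \<le> y * exp (ln x powr (1/4)) \<longrightarrow>
    norm ((\<Sum>d | 1 \<le> d \<and> real d \<le> T. f d * of_nat (card {n. x < real n \<and> real n \<le> x + y \<and> d dvd n}))
       - of_real y * (\<Sum>d | 1 \<le> d \<and> real d \<le> T. f d / of_nat d))
    \<le> A * C * (y * ln x powr (\<delta> + real m - 1/2))"
proof -
  obtain C where C: "C \<ge> 0" "\<And>x y u v. x \<ge> exp 1 \<Longrightarrow> x powr (2/5) \<le> y \<Longrightarrow> y \<le> x \<Longrightarrow> 0 < u \<Longrightarrow> v \<le> u * exp (ln x powr (1/4)) \<Longrightarrow>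
     (\<Sum>n | x < real n \<and> real n \<le> x + y. tau_window m n u v) \<le> C * y * ln x powr (real m - 1/2)"
    using short_sum_tau_window[OF m] by blast
  have "norm ((\<Sum>d | 1 \<le> d \<and> real d \<le> T. f d * of_nat (card {n. x < real n \<and> real n \<le> x + y \<and> d dvd n}))
       - of_real y * (\<Sum>d | 1 \<le> d \<and> real d \<le> T. f d / of_nat d))
    \<le> A * (1 + 3 * C) * (y * ln x powr (\<delta> + real m - 1/2))"
    if A: "0 \<le> A" and \<delta>: "0 \<le> \<delta>"
      and h: "\<forall>n\<ge>1. norm (f n) \<le> A * real (piltz_tau m n) * ln (exp 1 * real n) powr \<delta>"
      and x: "exp 1 \<le> x" and y: "x powr (2/5) \<le> y" "1 \<le> y" and T: "y \<le> T" "T \<le> x / exp 1" "T \<le> y * exp (ln x powr (1/4))"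
    for f :: "nat \<Rightarrow> complex" and A \<delta> x y T :: real
  proof -
    define l where "l = ln x"
    have x1: "x > 1" using x exp_gt_one[of "1::real"] by linarith
    have "ln (exp 1) \<le> ln x" using x x1 by (subst ln_le_cancel_iff) auto
    then have l1: "l \<ge> 1" unfolding l_def by simp
    have e2: "2 \<le> exp (1::real)" using exp_ge_add_one_self[of "1::real"] by linarith
    have xe: "x / exp 1 \<le> x / 2" using e2 x1 by (intro divide_left_mono) auto
    have yx: "y \<le> x" "2 * T \<le> x" using T xe x1 by linarith+
    define c where "c = (\<lambda>d. real (card {n. x < real n \<and> real n \<le> x + y \<and> d dvd n}))"
    define c' where "c' = (\<lambda>d. real (card {n. x < real n \<and> real n \<le> x + x \<and> d dvd n}))"
    define t where "t = (\<lambda>d. real (piltz_tau m d))"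
    have fin: "finite {d. 1 \<le> d \<and> real d \<le> w}" for w
      by (rule finite_subset[of _ "{..nat \<lfloor>w\<rfloor>}"]) (auto simp: le_nat_floor)
    have fd: "norm (f d) \<le> A * l powr \<delta> * t d" if d: "1 \<le> d" "real d \<le> T" for d
    proof -
      have "ln (exp 1 * real d) \<le> ln x"
      proof -
        have "exp 1 * real d \<le> exp 1 * (x / exp 1)" using d T by (intro mult_left_mono) auto
        then have "exp 1 * real d \<le> x" by simp
        then show ?thesis using d x1 by (subst ln_le_cancel_iff) auto
      qed
      moreover have "0 \<le> ln (exp 1 * real d)" using d by (simp add: ln_mult)
      ultimately have "ln (exp 1 * real d) powr \<delta> \<le> l powr \<delta>" unfolding l_def using \<delta> by (intro powr_mono2) auto
      then have "A * t d * ln (exp 1 * real d) powr \<delta> \<le> A * t d * l powr \<delta>"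
        using A by (intro mult_left_mono) (auto simp: t_def)
      moreover have "norm (f d) \<le> A * t d * ln (exp 1 * real d) powr \<delta>" using h d unfolding t_def by blast
      ultimately show ?thesis by (simp add: mult_ac)
    qed
    have "(\<Sum>d | 1 \<le> d \<and> real d \<le> T. f d * of_nat (card {n. x < real n \<and> real n \<le> x + y \<and> d dvd n}))
       - of_real y * (\<Sum>d | 1 \<le> d \<and> real d \<le> T. f d / of_nat d)
      = (\<Sum>d | 1 \<le> d \<and> real d \<le> T. f d * of_real (c d - y / real d))"
      unfolding c_def by (simp add: sum_distrib_left sum_subtractf algebra_simps)
    also have "norm \<dots> \<le> (\<Sum>d | 1 \<le> d \<and> real d \<le> T. norm (f d * of_real (c d - y / real d)))"
      by (rule norm_sum)
    also have "\<dots> \<le> (\<Sum>d | 1 \<le> d \<and> real d \<le> T. A * l powr \<delta> * (t d * \<bar>c d - y / real d\<bar>))"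
    proof (rule sum_mono)
      fix d assume d: "d \<in> {d. 1 \<le> d \<and> real d \<le> T}"
      have "norm (f d) * \<bar>c d - y / real d\<bar> \<le> A * l powr \<delta> * t d * \<bar>c d - y / real d\<bar>"
        using d by (intro mult_right_mono fd) auto
      then show "norm (f d * of_real (c d - y / real d)) \<le> A * l powr \<delta> * (t d * \<bar>c d - y / real d\<bar>)"
        by (simp only: norm_mult norm_of_real mult.assoc)
    qed
    also have "\<dots> = A * l powr \<delta> * (\<Sum>d | 1 \<le> d \<and> real d \<le> T. t d * \<bar>c d - y / real d\<bar>)"
      by (simp only: sum_distrib_left)
    also have "(\<Sum>d | 1 \<le> d \<and> real d \<le> T. t d * \<bar>c d - y / real d\<bar>) \<le> (1 + 3 * C) * (y * l powr (real m - 1/2))"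
    proof -
      have "{d. 1 \<le> d \<and> real d \<le> T} = {d. 1 \<le> d \<and> real d \<le> y} \<union> {d. y < real d \<and> real d \<le> T}"
        using T y by (auto simp: Suc_le_eq intro: Nat.gr0I)
      then have "(\<Sum>d | 1 \<le> d \<and> real d \<le> T. t d * \<bar>c d - y / real d\<bar>)
         = (\<Sum>d | 1 \<le> d \<and> real d \<le> y. t d * \<bar>c d - y / real d\<bar>) + (\<Sum>d | y < real d \<and> real d \<le> T. t d * \<bar>c d - y / real d\<bar>)"
        by (simp only:) (rule sum.union_disjoint[OF fin finite_real_interval], auto)
      also have "(\<Sum>d | 1 \<le> d \<and> real d \<le> y. t d * \<bar>c d - y / real d\<bar>) \<le> y * l powr (real m - 1/2)"
      proof -
        have "(\<Sum>d | 1 \<le> d \<and> real d \<le> y. t d * \<bar>c d - y / real d\<bar>) \<le> (\<Sum>d | 1 \<le> d \<and> real d \<le> y. t d * 1)"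
        proof (intro sum_mono mult_left_mono)
          fix d assume "d \<in> {d. 1 \<le> d \<and> real d \<le> y}"
          then show "\<bar>c d - y / real d\<bar> \<le> 1" unfolding c_def using x1 y by (intro card_multiples_interval) auto
        qed (auto simp: t_def)
        also have "\<dots> \<le> y * (1 + ln y) ^ (m - 1)"
          using sum_piltz_tau_le[OF y(2), of "m - 1"] m unfolding t_def by simp
        also have "\<dots> \<le> y * l ^ (m - 1)"
        proof (intro mult_left_mono power_mono)
          have "y \<le> x / exp 1" using T by linarith
          then have "ln y \<le> ln (x / exp 1)" using y x1 by (subst ln_le_cancel_iff) auto
          also have "\<dots> = l - 1" unfolding l_def using x1 by (simp add: ln_div)
          finally show "1 + ln y \<le> l" by simp
        qed (use y in auto)
        also have "l ^ (m - 1) = l powr (real m - 1)" using l1 m by (simp add: powr_realpow[symmetric] of_nat_diff)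
        also have "y * \<dots> \<le> y * l powr (real m - 1/2)" using y l1 by (intro mult_left_mono powr_mono) auto
        finally show ?thesis .
      qed
      also have "(\<Sum>d | y < real d \<and> real d \<le> T. t d * \<bar>c d - y / real d\<bar>) \<le> 3 * C * (y * l powr (real m - 1/2))"
      proof -
        have "(\<Sum>d | y < real d \<and> real d \<le> T. t d * \<bar>c d - y / real d\<bar>)
           \<le> (\<Sum>d | y < real d \<and> real d \<le> T. t d * c d + 2 * y / x * (t d * c' d))"
        proof (rule sum_mono)
          fix d assume d: "d \<in> {d. y < real d \<and> real d \<le> T}"
          then have d0: "d > 0" using y by (auto intro: Nat.gr0I)
          \<comment> \<open>As \<open>2 * d \<le> x\<close>, at least half of the expected multiples of \<open>d\<close> occur in \<open>(x, 2 * x]\<close>.\<close>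
          have "\<bar>c' d - x / real d\<bar> \<le> 1" unfolding c'_def using x1 d0 by (intro card_multiples_interval) auto
          moreover have "2 \<le> x / real d"
          proof -
            have "2 * real d \<le> x" using d yx by auto
            then show ?thesis using d0 by (simp add: field_simps)
          qed
          ultimately have "x / real d \<le> 2 * c' d" by linarith
          then have "y / x * (x / real d) \<le> y / x * (2 * c' d)" using y x1 by (intro mult_left_mono) auto
          then have yd: "y / real d \<le> 2 * y / x * c' d" using x1 by (simp add: mult_ac)
          have "0 \<le> y / real d" "0 \<le> c d" using y by (auto simp: c_def)
          then have "\<bar>c d - y / real d\<bar> \<le> c d + 2 * y / x * c' d" using yd by linarith
          then have "t d * \<bar>c d - y / real d\<bar> \<le> t d * (c d + 2 * y / x * c' d)"
            by (rule mult_left_mono) (simp add: t_def)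
          then show "t d * \<bar>c d - y / real d\<bar> \<le> t d * c d + 2 * y / x * (t d * c' d)" by (simp add: algebra_simps)
        qed
        also have "\<dots> = (\<Sum>d | y < real d \<and> real d \<le> T. t d * c d) + 2 * y / x * (\<Sum>d | y < real d \<and> real d \<le> T. t d * c' d)"
          by (simp only: sum.distrib sum_distrib_left)
        also have "(\<Sum>d | y < real d \<and> real d \<le> T. t d * c d) = (\<Sum>n | x < real n \<and> real n \<le> x + y. tau_window m n y T)"
          unfolding t_def c_def using x1 by (subst sum_tau_window_eq) auto
        also have "\<dots> \<le> C * y * l powr (real m - 1/2)"
          unfolding l_def using x y yx T by (intro C(2)) auto
        also have "(\<Sum>d | y < real d \<and> real d \<le> T. t d * c' d) = (\<Sum>n | x < real n \<and> real n \<le> x + x. tau_window m n y T)"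
          unfolding t_def c'_def using x1 by (subst sum_tau_window_eq) auto
        also have "2 * y / x * \<dots> \<le> 2 * y / x * (C * x * l powr (real m - 1/2))"
        proof (rule mult_left_mono)
          have "x powr (2/5) \<le> x powr 1" using x1 by (intro powr_mono) auto
          then have "x powr (2/5) \<le> x" using x1 by simp
          then show "(\<Sum>n | x < real n \<and> real n \<le> x + x. tau_window m n y T) \<le> C * x * l powr (real m - 1/2)"
            unfolding l_def using x y T by (intro C(2)) auto
        qed (use x1 y in auto)
        also have "2 * y / x * (C * x * l powr (real m - 1/2)) = 2 * C * (y * l powr (real m - 1/2))" using x1 by simp
        finally show ?thesis by (simp add: algebra_simps)
      qed
      finally show ?thesis by (simp add: algebra_simps)
    qed
    also have "A * l powr \<delta> * ((1 + 3 * C) * (y * l powr (real m - 1/2))) = A * (1 + 3 * C) * (y * (l powr \<delta> * l powr (real m - 1/2)))"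
      by (simp add: mult_ac)
    also have "l powr \<delta> * l powr (real m - 1/2) = l powr (\<delta> + real m - 1/2)"
      by (simp flip: powr_add add: algebra_simps)
    finally show ?thesis using A unfolding l_def by (simp add: mult_left_mono)
  qed
  then show ?thesis using C(1) by (intro exI[of _ "1 + 3 * C"]) auto
qed

section \<open>Short sums of arithmetic functions\<close>

lemma eps_nonneg:
  assumes "r \<ge> 1" "x > exp (exp 1)"
  shows "eps r x \<ge> 0"
proof -
  have e1: "exp 1 > (1::real)" by simp
  have x0: "x > 0" using assms(2) exp_gt_zero[of "exp (1::real)"] by linarith
  have "ln (exp (exp 1)) < ln x" using assms(2) x0 by (subst ln_less_cancel_iff) auto
  then have 1: "exp 1 < ln x" by simp
  then have "0 < ln x" using e1 by linarith
  with 1 have "ln (exp 1) < ln (ln x)" by (subst ln_less_cancel_iff) auto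
  then have 2: "1 < ln (ln x)" by simp
  then have "0 < ln (ln (ln x))" by simp
  then show ?thesis unfolding eps_def using assms(1) 2
    by (intro mult_nonneg_nonneg add_nonneg_nonneg) auto
qed

text \<open>
Differences of consecutive partial sums in (i) bound \<open>f\<close> on a bounded range, independently of \<open>\<delta>\<close>.
\<close>
lemma bounded_range_bound:
  assumes \<kappa>: "0 \<le> \<kappa>" and \<beta>: "0 \<le> \<beta>"
  shows "\<exists>C\<ge>0. \<forall>f x y. partial_sum_asymp f a s B \<kappa> \<beta> \<longrightarrow> 1 \<le> x \<longrightarrow> x \<le> exp 16 \<longrightarrow> 0 < y \<longrightarrow> y \<le> x \<longrightarrow>
    norm ((\<Sum>n | x < real n \<and> real n \<le> x + y. \<Sum>d | d dvd n. f d)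
      - of_real y * a s / of_nat (s + 1) * of_real (ln x ^ (s + 1))) \<le> C"
proof -
  define X :: real where "X = 2 * exp 16"
  have X2: "X \<ge> 2" unfolding X_def using exp_ge_add_one_self[of "16::real"] by linarith
  have lnX: "ln X \<le> 17" unfolding X_def using ln_2_less_1 by (simp add: ln_mult)
  define Na where "Na = (\<Sum>j\<le>s. norm (a j))"
  have Na0: "Na \<ge> 0" unfolding Na_def by (intro sum_nonneg) auto
  define M where "M = X * (Na * 17 ^ s) + \<bar>B\<bar> * (X powr \<kappa> * 18 powr \<beta>)"
  have M0: "M \<ge> 0" unfolding M_def using X2 Na0 by simp
  define C where "C = X * (X * (2 * M)) + exp 16 * norm (a s) * 16 ^ (s + 1)"
  have "norm ((\<Sum>n | x < real n \<and> real n \<le> x + y. \<Sum>d | d dvd n. f d)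
      - of_real y * a s / of_nat (s + 1) * of_real (ln x ^ (s + 1))) \<le> C"
    if h: "partial_sum_asymp f a s B \<kappa> \<beta>" and x: "1 \<le> x" "x \<le> exp 16" and y: "0 < y" "y \<le> x" for f x y
  proof -
    have S: "norm (partial_sum f (real n)) \<le> M" if n: "real n \<le> X" for n
    proof (cases "n = 0")
      case True
      then have "partial_sum f (real n) = 0" unfolding partial_sum_nat by simp
      then show ?thesis using M0 by simp
    next
      case False
      then have n1: "real n \<ge> 1" by simp
      have ln: "0 \<le> ln (real n)" "ln (real n) \<le> 17"
      proof -
        have "ln (real n) \<le> ln X" using n n1 X2 by (subst ln_le_cancel_iff) auto
        then show "ln (real n) \<le> 17" using lnX by linarith
      qed (use n1 in simp)
      define R where "R = partial_sum f (real n) - of_real (real n) * log_poly a s (real n)"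
      have "norm R \<le> \<bar>B\<bar> * (real n powr \<kappa> * (1 + ln (real n)) powr \<beta>)"
        unfolding R_def using h n1 by (rule partial_sum_asympD)
      also have "\<dots> \<le> \<bar>B\<bar> * (X powr \<kappa> * 18 powr \<beta>)"
        using n n1 ln \<kappa> \<beta> by (intro mult_left_mono mult_mono powr_mono2) auto
      finally have 1: "norm R \<le> \<bar>B\<bar> * (X powr \<kappa> * 18 powr \<beta>)" .
      have "norm (log_poly a s (real n)) \<le> Na * 17 ^ s"
        unfolding Na_def using ln by (intro norm_log_poly_le) auto
      then have "real n * norm (log_poly a s (real n)) \<le> X * (Na * 17 ^ s)"
        using n X2 by (intro mult_mono) auto
      then have 2: "norm (of_real (real n) * log_poly a s (real n)) \<le> X * (Na * 17 ^ s)"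
        by (simp add: norm_mult)
      have "partial_sum f (real n) = of_real (real n) * log_poly a s (real n) + R" unfolding R_def by simp
      then show ?thesis unfolding M_def using norm_triangle_mono[OF 2 1] by simp
    qed
    have fb: "norm (f n) \<le> 2 * M" if n: "1 \<le> n" "real n \<le> X" for n
    proof -
      have "{1..n} = insert n {1..n - 1}" using n by auto
      then have "partial_sum f (real n) = f n + partial_sum f (real (n - 1))"
        unfolding partial_sum_nat using n by simp
      then have "f n = partial_sum f (real n) - partial_sum f (real (n - 1))" by simp
      also have "norm \<dots> \<le> norm (partial_sum f (real n)) + norm (partial_sum f (real (n - 1)))"
        by (rule norm_triangle_ineq4)
      also have "\<dots> \<le> M + M" using n by (intro add_mono S) auto
      finally show ?thesis by simp
    qed
    define I where "I = {n. x < real n \<and> real n \<le> x + y}"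
    have I: "1 \<le> n" "real n \<le> X" if "n \<in> I" for n
    proof -
      show "1 \<le> n" using that x by (cases n) (auto simp: I_def)
      have "real n \<le> x + y" using that by (simp add: I_def)
      then show "real n \<le> X" unfolding X_def using x y by linarith
    qed
    have Fb: "norm (\<Sum>d | d dvd n. f d) \<le> X * (2 * M)" if n: "n \<in> I" for n
    proof -
      have sub: "{d. d dvd n} \<subseteq> {1..n}" using I(1)[OF n] by (auto intro: dvd_imp_le dvd_pos_nat simp: Suc_le_eq)
      have "norm (\<Sum>d | d dvd n. f d) \<le> (\<Sum>d | d dvd n. norm (f d))" by (rule norm_sum)
      also have "\<dots> \<le> (\<Sum>d\<in>{1..n}. norm (f d))" using sub by (intro sum_mono2) auto
      also have "\<dots> \<le> (\<Sum>d\<in>{1..n}. 2 * M)"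
        using I(2)[OF n] by (intro sum_mono fb) auto
      also have "\<dots> = real n * (2 * M)" by simp
      also have "\<dots> \<le> X * (2 * M)" using I(2)[OF n] M0 by (intro mult_right_mono) auto
      finally show ?thesis .
    qed
    have "I \<subseteq> {1..nat \<lfloor>X\<rfloor>}" using I by (auto simp: le_nat_floor)
    then have "card I \<le> card {1..nat \<lfloor>X\<rfloor>}" by (intro card_mono) auto
    then have "real (card I) \<le> real (nat \<lfloor>X\<rfloor>)" by simp
    also have "\<dots> \<le> X" using X2 by linarith
    finally have cI: "real (card I) \<le> X" .
    have "norm (\<Sum>n\<in>I. \<Sum>d | d dvd n. f d) \<le> (\<Sum>n\<in>I. norm (\<Sum>d | d dvd n. f d))" by (rule norm_sum)
    also have "\<dots> \<le> (\<Sum>n\<in>I. X * (2 * M))" by (intro sum_mono Fb)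
    also have "\<dots> = real (card I) * (X * (2 * M))" by simp
    also have "\<dots> \<le> X * (X * (2 * M))" using cI M0 X2 by (intro mult_right_mono) auto
    finally have 1: "norm (\<Sum>n\<in>I. \<Sum>d | d dvd n. f d) \<le> X * (X * (2 * M))" .
    have lx: "0 \<le> ln x" "ln x \<le> 16"
    proof -
      have "ln x \<le> ln (exp 16)" using x by (subst ln_le_cancel_iff) auto
      then show "ln x \<le> 16" by simp
    qed (use x in simp)
    have "norm (of_real y * a s / of_nat (s + 1) * of_real (ln x ^ (s + 1))) = y * norm (a s) / real (s + 1) * ln x ^ (s + 1)"
      using y lx by (simp add: norm_mult norm_divide norm_power del: of_nat_Suc of_nat_add)
    also have "\<dots> \<le> exp 16 * norm (a s) / 1 * 16 ^ (s + 1)"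
      using x y lx by (intro mult_mono frac_le power_mono) auto
    finally have 2: "norm (of_real y * a s / of_nat (s + 1) * of_real (ln x ^ (s + 1))) \<le> exp 16 * norm (a s) * 16 ^ (s + 1)" by simp
    show ?thesis unfolding C_def I_def[symmetric]
      using norm_triangle_ineq4[of "\<Sum>n\<in>I. \<Sum>d | d dvd n. f d" "of_real y * a s / of_nat (s + 1) * of_real (ln x ^ (s + 1))"] 1 2
      by linarith
  qed
  moreover have "C \<ge> 0" unfolding C_def using X2 M0 by simp
  ultimately show ?thesis by blast
qed

text \<open>
\<open>K\<close> is \<open>exp (1 - L) * x / y\<close> rounded up. The factor \<open>exp 1\<close> ensures \<open>x / K \<le> x / exp 1\<close>, and \<open>K \<le> x / y\<close>
holds because \<open>L \<ge> 2\<close>, which is the reason for the threshold \<open>exp 16\<close>.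
\<close>
lemma cutoff_exists:
  fixes x y :: real
  defines "L \<equiv> ln x powr (1/4)"
  assumes x: "exp 16 \<le> x" and y: "1 \<le> y" "x powr (1/2) * exp (- (1/2) * L) \<le> y" "y \<le> x * exp (- L)"
  obtains K :: nat where "1 \<le> K" "real K \<le> x" "real K * y \<le> x" "real K \<le> 2 * exp 1 * (x / y) * exp (- L)"
    "y \<le> x / real K" "x / real K \<le> x / exp 1" "x / real K \<le> y * exp L" "x powr (2/5) \<le> y"
proof -
  define l where "l = ln x"
  have x1: "x > 1" using x exp_gt_one[of "16::real"] by linarith
  have "ln (exp 16) \<le> ln x" using x x1 by (subst ln_le_cancel_iff) auto
  then have l16: "l \<ge> 16" unfolding l_def by simp
  have L4: "L ^ 4 = l" unfolding L_def l_def[symmetric] using l16 by (simp add: powr_realpow[symmetric] powr_powr)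
  have L2: "L \<ge> 2"
  proof (rule ccontr)
    assume "\<not> L \<ge> 2"
    moreover have "0 \<le> L" unfolding L_def by simp
    ultimately have "L ^ 4 < 2 ^ 4" by (intro power_strict_mono) auto
    then show False using L4 l16 by simp
  qed
  have "5 * L \<le> L ^ 3 * L" using L2 power_mono[of 2 L 3] by (intro mult_right_mono) auto
  also have "L ^ 3 * L = l" unfolding L4[symmetric] by (simp add: power_numeral_reduce)
  finally have Ll: "5 * L \<le> l" .
  define X where "X = x / y"
  have "exp L * y \<le> exp L * (x * exp (- L))" using y by (intro mult_left_mono) auto
  also have "\<dots> = x" by (simp add: exp_minus)
  finally have X: "exp L \<le> X" unfolding X_def using y by (simp add: field_simps)
  have e2: "2 \<le> exp (1::real)" using exp_ge_add_one_self[of "1::real"] by linarith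
  have X3: "X \<ge> 3"
  proof -
    have "3 \<le> 1 + L" using L2 by simp
    also have "\<dots> \<le> exp L" by (rule exp_ge_add_one_self)
    finally show ?thesis using X by linarith
  qed
  define E where "E = exp 1 * X * exp (- L)"
  have E1: "exp 1 \<le> E"
  proof -
    have "exp 1 * 1 = exp 1 * (exp L * exp (- L))" by (simp add: exp_minus)
    also have "\<dots> \<le> exp 1 * (X * exp (- L))" using X by (intro mult_left_mono mult_right_mono) auto
    finally show ?thesis unfolding E_def by simp
  qed
  have EX: "E + 1 \<le> X"
  proof -
    have "exp 1 * exp (- L) = exp (1 - L)" by (simp flip: exp_add)
    also have "\<dots> \<le> exp (-1)" using L2 by simp
    also have "\<dots> \<le> 1 / 2" using e2 by (simp add: exp_minus field_simps)
    finally have "exp 1 * exp (- L) * X \<le> 1 / 2 * X" using X3 by (intro mult_right_mono) auto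
    then have "E \<le> X / 2" unfolding E_def by (simp add: mult_ac)
    then show ?thesis using X3 by linarith
  qed
  define K where "K = nat \<lceil>E\<rceil>"
  have K: "E \<le> real K" "real K \<le> E + 1" unfolding K_def using E1 e2 by linarith+
  have Xx: "X \<le> x"
  proof -
    have "x / y \<le> x / 1" using y x1 by (intro divide_left_mono) auto
    then show ?thesis unfolding X_def by simp
  qed
  have Kpos: "real K > 0" using K(1) E1 e2 by linarith
  have KX: "real K \<le> X" using K(2) EX by linarith
  show thesis
  proof
    show "1 \<le> K" using Kpos by simp
    show "real K \<le> x" using KX Xx by linarith
    show Ky: "real K * y \<le> x" using KX y unfolding X_def by (simp add: field_simps)
    have "real K \<le> 2 * E" using K(2) E1 e2 by linarith
    then show "real K \<le> 2 * exp 1 * (x / y) * exp (- L)" unfolding E_def X_def by simp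
    show "y \<le> x / real K" using Ky Kpos by (simp add: field_simps)
    show "x / real K \<le> x / exp 1" using K(1) E1 x1 Kpos by (intro divide_left_mono) auto
    have "x / real K \<le> x / E" using K(1) x1 Kpos E1 e2 by (intro divide_left_mono) auto
    also have "x / E = y * exp L / exp 1" unfolding E_def X_def using x1 y by (simp add: exp_minus field_simps)
    also have "\<dots> \<le> y * exp L / 1" using e2 y by (intro divide_left_mono) auto
    finally show "x / real K \<le> y * exp L" by simp
    have "x powr (2/5) = x powr (1/2 + (-1/10))" by simp
    also have "\<dots> = x powr (1/2) * x powr (-1/10)" by (rule powr_add)
    also have "x powr (-1/10) = exp (- (1/10) * l)" unfolding l_def powr_def using x1 by simp
    also have "x powr (1/2) * exp (- (1/10) * l) \<le> x powr (1/2) * exp (- (1/2) * L)"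
      using Ll by (intro mult_left_mono) auto
    also have "\<dots> \<le> y" by (rule y)
    finally show "x powr (2/5) \<le> y" .
  qed
qed

theorem theorem1:
  fixes \<kappa> \<beta> A B \<epsilon> :: real and s m :: nat and a :: "nat \<Rightarrow> complex"
  assumes "0 \<le> \<kappa>" and "\<kappa> < 1" and "0 \<le> \<beta>" and "0 < A" and "1 \<le> m" and "a s \<noteq> 0"
    and "0 < \<epsilon>" and "\<epsilon> \<le> 1 / 2"
  shows "\<exists>K::real. \<forall>(\<delta>::real) (F :: nat \<Rightarrow> complex) (x::real) (y::real).
    0 \<le> \<delta> \<longrightarrow>
    (\<forall>z::real\<ge>1.
       norm ((\<Sum>n | 1 \<le> n \<and> real n \<le> z. (F \<star> moebius_mu) n)
             - of_real z * (\<Sum>j\<le>s. a j * of_real (ln z ^ j)))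
         \<le> B * (z powr \<kappa> * ln (exp 1 * z) powr \<beta>)) \<longrightarrow>
    (\<forall>n\<ge>1. norm ((F \<star> moebius_mu) n)
         \<le> A * real (piltz_tau m n) * ln (exp 1 * real n) powr \<delta>) \<longrightarrow>
    exp (exp 1) < y \<longrightarrow> y \<le> x \<longrightarrow>
    x powr (1 / 2) * exp (- (1 / 2) * ln x powr (1 / 4)) \<le> y \<longrightarrow>
    y \<le> x * exp (- (ln x powr (1 / 4))) \<longrightarrow>
    norm ((\<Sum>n | x < real n \<and> real n \<le> x + y. F n)
          - of_real y * a s / of_nat (s + 1) * of_real (ln x ^ (s + 1)))
      \<le> K * (x * y powr (\<kappa> - 1) * exp ((\<kappa> - 1) * ln x powr (1 / 4)) * ln x powr \<beta>
             + y * ln x powr max (real s) (\<delta> + real m - 1 / 2 + eps (m + 1) x)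
             + x powr \<epsilon>)"
proof -
  obtain C1 where C1: "C1 \<ge> 0" "\<And>f T. partial_sum_asymp f a s B \<kappa> \<beta> \<Longrightarrow> T \<ge> 1 \<Longrightarrow>
    norm ((\<Sum>d | 1 \<le> d \<and> real d \<le> T. f d / of_nat d) - a s / of_nat (Suc s) * of_real (ln T ^ Suc s)) \<le> C1 * (1 + ln T) ^ s"
    using logarithmic_mean[OF assms(2), of a s B \<beta>] by blast
  obtain C2 where C2: "C2 \<ge> 0" "\<And>f x y K. partial_sum_asymp f a s B \<kappa> \<beta> \<Longrightarrow> exp 1 \<le> x \<Longrightarrow> 0 < y \<Longrightarrow> y \<le> x \<Longrightarrow> 1 \<le> K \<Longrightarrow> real K \<le> x \<Longrightarrow>
    norm ((\<Sum>k\<in>{1..K}. partial_sum f ((x + y) / real k) - partial_sum f (x / real k))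
        - of_real y * (a s / of_nat (Suc s) * of_real (ln x ^ Suc s - ln (x / real K) ^ Suc s)))
    \<le> C2 * (y * ln x ^ s + x powr \<kappa> * real K powr (1 - \<kappa>) * ln x powr \<beta>)"
    using hyperbola_large_divisors[OF assms(1-3), of a s B] by blast
  obtain C3 where C3: "C3 \<ge> 0" "\<And>(f :: nat \<Rightarrow> complex) A \<delta> x y T. 0 \<le> A \<Longrightarrow> 0 \<le> \<delta> \<Longrightarrow>
    (\<forall>n\<ge>1. norm (f n) \<le> A * real (piltz_tau m n) * ln (exp 1 * real n) powr \<delta>) \<Longrightarrow>
    exp 1 \<le> x \<Longrightarrow> x powr (2/5) \<le> y \<Longrightarrow> 1 \<le> y \<Longrightarrow> y \<le> T \<Longrightarrow> T \<le> x / exp 1 \<Longrightarrow> T \<le> y * exp (ln x powr (1/4)) \<Longrightarrow>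
    norm ((\<Sum>d | 1 \<le> d \<and> real d \<le> T. f d * of_nat (card {n. x < real n \<and> real n \<le> x + y \<and> d dvd n}))
       - of_real y * (\<Sum>d | 1 \<le> d \<and> real d \<le> T. f d / of_nat d))
    \<le> A * C3 * (y * ln x powr (\<delta> + real m - 1/2))"
    using small_divisors_error[OF assms(5)] by blast
  obtain C4 where C4: "C4 \<ge> 0" "\<And>f x y. partial_sum_asymp f a s B \<kappa> \<beta> \<Longrightarrow> 1 \<le> x \<Longrightarrow> x \<le> exp 16 \<Longrightarrow> 0 < y \<Longrightarrow> y \<le> x \<Longrightarrow>
    norm ((\<Sum>n | x < real n \<and> real n \<le> x + y. \<Sum>d | d dvd n. f d)
      - of_real y * a s / of_nat (s + 1) * of_real (ln x ^ (s + 1))) \<le> C4"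
    using bounded_range_bound[OF assms(1,3), of a s B] by blast
  define K where "K = A * C3 + C1 + C2 + C2 * (2 * exp 1) + C4"
  have "norm ((\<Sum>n | x < real n \<and> real n \<le> x + y. F n)
          - of_real y * a s / of_nat (s + 1) * of_real (ln x ^ (s + 1)))
      \<le> K * (x * y powr (\<kappa> - 1) * exp ((\<kappa> - 1) * ln x powr (1 / 4)) * ln x powr \<beta>
             + y * ln x powr max (real s) (\<delta> + real m - 1 / 2 + eps (m + 1) x)
             + x powr \<epsilon>)"
    if \<delta>: "0 \<le> \<delta>"
      and h1: "\<forall>z::real\<ge>1. norm ((\<Sum>n | 1 \<le> n \<and> real n \<le> z. (F \<star> moebius_mu) n)
             - of_real z * (\<Sum>j\<le>s. a j * of_real (ln z ^ j)))
         \<le> B * (z powr \<kappa> * ln (exp 1 * z) powr \<beta>)"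
      and h2: "\<forall>n\<ge>1. norm ((F \<star> moebius_mu) n) \<le> A * real (piltz_tau m n) * ln (exp 1 * real n) powr \<delta>"
      and y: "exp (exp 1) < y" "y \<le> x"
      and y_low: "x powr (1 / 2) * exp (- (1 / 2) * ln x powr (1 / 4)) \<le> y"
      and y_up: "y \<le> x * exp (- (ln x powr (1 / 4)))"
    for \<delta> x y :: real and F :: "nat \<Rightarrow> complex"
  proof -
    define f where "f = F \<star> moebius_mu"
    define l where "l = ln x"
    define L where "L = l powr (1/4)"
    define E1 where "E1 = x * y powr (\<kappa> - 1) * exp ((\<kappa> - 1) * L) * l powr \<beta>"
    define E2 where "E2 = y * l powr max (real s) (\<delta> + real m - 1 / 2 + eps (m + 1) x)"
    define main where "main = of_real y * a s / of_nat (s + 1) * of_real (l ^ (s + 1))"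
    have asy: "partial_sum_asymp f a s B \<kappa> \<beta>"
      unfolding partial_sum_asymp_def partial_sum_def log_poly_def f_def using h1 .
    have ee: "1 \<le> exp (exp (1::real))" "exp 1 \<le> exp (exp (1::real))"
      using exp_ge_add_one_self[of "1::real"] by auto
    have y1: "1 \<le> y" "0 < y" using y ee by linarith+
    have xe: "exp 1 \<le> x" "exp (exp 1) < x" using y ee by linarith+
    have x1: "1 < x" using xe exp_gt_one[of "1::real"] by linarith
    have "ln (exp 1) \<le> ln x" using xe x1 by (subst ln_le_cancel_iff) auto
    then have l1: "1 \<le> l" unfolding l_def by simp
    have Fsum: "(\<Sum>n | x < real n \<and> real n \<le> x + y. F n) = (\<Sum>n | x < real n \<and> real n \<le> x + y. \<Sum>d | d dvd n. f d)"
    proof (rule sum.cong[OF refl])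
      fix n assume "n \<in> {n. x < real n \<and> real n \<le> x + y}"
      then have "n > 0" using x1 by (cases n) auto
      then show "F n = (\<Sum>d | d dvd n. f d)" unfolding f_def by (rule dirichlet_prod_moebius_inversion[symmetric])
    qed
    have pow_ge: "l powr t \<le> l powr max (real s) (\<delta> + real m - 1 / 2 + eps (m + 1) x)"
      if "t \<le> real s \<or> t \<le> \<delta> + real m - 1/2" for t
    proof -
      have "0 \<le> eps (m + 1) x" using xe(2) by (intro eps_nonneg) auto
      then show ?thesis using that l1 by (intro powr_mono) auto
    qed
    have E1_nonneg: "0 \<le> E1" unfolding E1_def using x1 by simp
    have E2_ge: "y * l ^ s \<le> E2" "y * l powr (\<delta> + real m - 1/2) \<le> E2"
    proof -
      have "l ^ s = l powr (real s)" using l1 by (simp add: powr_realpow)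
      then show "y * l ^ s \<le> E2" unfolding E2_def using pow_ge[of "real s"] y1 by simp
      show "y * l powr (\<delta> + real m - 1/2) \<le> E2"
        unfolding E2_def using pow_ge y1 by (intro mult_left_mono) auto
    qed
    have "1 * 1 \<le> y * l ^ s" using y1 l1 by (intro mult_mono) auto
    then have E2_1: "1 \<le> E2" using E2_ge(1) by linarith
    have "norm ((\<Sum>n | x < real n \<and> real n \<le> x + y. F n) - main) \<le> K * (E1 + E2)"
    proof (cases "x \<le> exp 16")
      case True
      have "norm ((\<Sum>n | x < real n \<and> real n \<le> x + y. F n) - main) \<le> C4"
        unfolding Fsum main_def l_def using asy x1 True y y1 by (intro C4(2)) auto
      also have "\<dots> \<le> K * 1" unfolding K_def using assms(4) C1(1) C2(1) C3(1) by simp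
      also have "\<dots> \<le> K * (E1 + E2)"
        using E1_nonneg E2_1 assms(4) C1(1) C2(1) C3(1) C4(1) by (intro mult_left_mono) (auto simp: K_def)
      finally show ?thesis .
    next
      case False
      then have x16: "exp 16 \<le> x" by simp
      obtain k :: nat where k: "1 \<le> k" "real k \<le> x" "real k * y \<le> x" "real k \<le> 2 * exp 1 * (x / y) * exp (- L)"
        "y \<le> x / real k" "x / real k \<le> x / exp 1" "x / real k \<le> y * exp L" "x powr (2/5) \<le> y"
        using cutoff_exists[OF x16 y1(1) y_low y_up] unfolding L_def l_def by blast
      define T where "T = x / real k"
      define P where "P = (\<Sum>d | 1 \<le> d \<and> real d \<le> T. f d * of_nat (card {n. x < real n \<and> real n \<le> x + y \<and> d dvd n}))"
      define Q where "Q = (\<Sum>k\<in>{1..k}. partial_sum f ((x + y) / real k) - partial_sum f (x / real k))"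
      define H where "H = (\<Sum>d | 1 \<le> d \<and> real d \<le> T. f d / of_nat d)"
      define c where "c = a s / of_nat (Suc s)"
      have T1: "T \<ge> 1" unfolding T_def using k(5) y1 by linarith
      have "(\<Sum>n | x < real n \<and> real n \<le> x + y. F n) = P + Q"
        unfolding Fsum P_def Q_def T_def using k(1,3) x1 y1 by (intro short_sum_hyperbola_split) auto
      moreover have "main = of_real y * (c * of_real (ln T ^ Suc s)) + of_real y * (c * of_real (l ^ Suc s - ln T ^ Suc s))"
        unfolding main_def c_def by (simp add: algebra_simps del: of_nat_Suc)
      ultimately have "(\<Sum>n | x < real n \<and> real n \<le> x + y. F n) - main
         = (P - of_real y * H) + of_real y * (H - c * of_real (ln T ^ Suc s)) + (Q - of_real y * (c * of_real (l ^ Suc s - ln T ^ Suc s)))"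
        by (simp add: algebra_simps del: of_nat_Suc power_Suc)
      also have "norm \<dots> \<le> A * C3 * E2 + C1 * E2 + C2 * (E2 + 2 * exp 1 * E1)"
      proof (intro norm_triangle_mono)
        have "norm (P - of_real y * H) \<le> A * C3 * (y * ln x powr (\<delta> + real m - 1/2))"
          unfolding P_def H_def T_def using assms(4) \<delta> h2 xe(1) k y1 unfolding f_def L_def l_def by (intro C3(2)) auto
        also have "\<dots> \<le> A * C3 * E2" using E2_ge(2) assms(4) C3(1) unfolding l_def by (intro mult_left_mono) auto
        finally show "norm (P - of_real y * H) \<le> A * C3 * E2" .
        have "norm (H - c * of_real (ln T ^ Suc s)) \<le> C1 * (1 + ln T) ^ s"
          unfolding H_def c_def using asy T1 by (rule C1(2))
        also have "\<dots> \<le> C1 * l ^ s"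
        proof (intro mult_left_mono power_mono)
          have "ln T \<le> ln (x / exp 1)" using k(6) T1 x1 unfolding T_def by (subst ln_le_cancel_iff) auto
          also have "\<dots> = l - 1" unfolding l_def using x1 by (simp add: ln_div)
          finally show "1 + ln T \<le> l" by simp
        qed (use T1 C1 in auto)
        finally have "y * norm (H - c * of_real (ln T ^ Suc s)) \<le> y * (C1 * l ^ s)" using y1 by (intro mult_left_mono) auto
        also have "\<dots> = C1 * (y * l ^ s)" by simp
        also have "\<dots> \<le> C1 * E2" using E2_ge(1) C1(1) by (intro mult_left_mono) auto
        finally show "norm (of_real y * (H - c * of_real (ln T ^ Suc s))) \<le> C1 * E2"
          using y1 by (simp add: norm_mult del: power_Suc)
        have "norm (Q - of_real y * (c * of_real (l ^ Suc s - ln T ^ Suc s))) \<le> C2 * (y * ln x ^ s + x powr \<kappa> * real k powr (1 - \<kappa>) * ln x powr \<beta>)"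
          unfolding Q_def c_def T_def l_def using asy xe(1) y1(2) y(2) k(1,2) by (rule C2(2))
        also have "\<dots> \<le> C2 * (E2 + 2 * exp 1 * E1)"
        proof (intro mult_left_mono add_mono)
          have "real k powr (1 - \<kappa>) \<le> (2 * exp 1 * (x / y) * exp (- L)) powr (1 - \<kappa>)"
            using k(4) assms(2) by (intro powr_mono2) auto
          also have "\<dots> = (2 * exp 1) powr (1 - \<kappa>) * (x / y) powr (1 - \<kappa>) * exp (- L) powr (1 - \<kappa>)"
            by (simp only: powr_mult)
          also have "\<dots> \<le> (2 * exp 1) powr 1 * (x / y) powr (1 - \<kappa>) * exp (- L) powr (1 - \<kappa>)"
          proof (intro mult_right_mono powr_mono)
            show "1 \<le> 2 * exp (1::real)" using exp_ge_add_one_self[of "1::real"] by linarith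
          qed (use assms(1) in auto)
          also have "(x / y) powr (1 - \<kappa>) = x powr (1 - \<kappa>) * y powr (\<kappa> - 1)"
          proof -
            have "(x / y) powr (1 - \<kappa>) = x powr (1 - \<kappa>) / y powr (1 - \<kappa>)" by (rule powr_divide)
            also have "\<dots> = x powr (1 - \<kappa>) * (1 / y powr (1 - \<kappa>))" by simp
            also have "1 / y powr (1 - \<kappa>) = y powr (- (1 - \<kappa>))" by (rule powr_minus_divide[symmetric])
            finally show ?thesis by simp
          qed
          also have "exp (- L) powr (1 - \<kappa>) = exp ((\<kappa> - 1) * L)"
            by (simp add: powr_def algebra_simps)
          finally have "x powr \<kappa> * real k powr (1 - \<kappa>) \<le> x powr \<kappa> * ((2 * exp 1) powr 1 * (x powr (1 - \<kappa>) * y powr (\<kappa> - 1)) * exp ((\<kappa> - 1) * L))"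
            by (rule mult_left_mono) simp
          also have "\<dots> = 2 * exp 1 * ((x powr \<kappa> * x powr (1 - \<kappa>)) * y powr (\<kappa> - 1) * exp ((\<kappa> - 1) * L))" by simp
          also have "x powr \<kappa> * x powr (1 - \<kappa>) = x" using x1 by (simp flip: powr_add)
          finally have "x powr \<kappa> * real k powr (1 - \<kappa>) * l powr \<beta> \<le> 2 * exp 1 * (x * y powr (\<kappa> - 1) * exp ((\<kappa> - 1) * L)) * l powr \<beta>"
            by (rule mult_right_mono) simp
          then show "x powr \<kappa> * real k powr (1 - \<kappa>) * ln x powr \<beta> \<le> 2 * exp 1 * E1"
            unfolding E1_def l_def by simp
        qed (use E2_ge(1) C2(1) in \<open>auto simp: l_def\<close>)
        finally show "norm (Q - of_real y * (c * of_real (l ^ Suc s - ln T ^ Suc s))) \<le> C2 * (E2 + 2 * exp 1 * E1)" .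
      qed
      also have "\<dots> = (A * C3 + C1 + C2) * E2 + C2 * (2 * exp 1) * E1" by (simp add: algebra_simps)
      also have "\<dots> \<le> K * E2 + K * E1"
        using E1_nonneg E2_1 assms(4) C1(1) C2(1) C3(1) C4(1)
        by (intro add_mono mult_right_mono) (auto simp: K_def)
      finally show ?thesis by (simp add: algebra_simps)
    qed
    also have "\<dots> \<le> K * (E1 + E2 + x powr \<epsilon>)"
      using assms(4) C1(1) C2(1) C3(1) C4(1) by (intro mult_left_mono) (auto simp: K_def)
    finally show ?thesis unfolding E1_def E2_def main_def L_def l_def .
  qed
  then show ?thesis by blast
qed

end
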